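(* Let $F$ be a computable field of characteristic $0$ and let $R=F[x_1,\dots,x_n]$ with the ranking $x_1<\dots<x_n$. There is an algorithm which, given any algebraic system $S'$ over $R$ (a finite set of polynomial equations and inequations), terminates after finitely many steps and returns an (algebraic) Thomas decomposition of $S'$, i.e. a finite family $(S_1,\dots,S_m)$ of simple algebraic systems over $R$ with $\mathfrak{Sol}(S')=\bigcup_{i=1}^m\mathfrak{Sol}(S_i)$ and $\mathfrak{Sol}(S_i)\cap\mathfrak{Sol}(S_j)=\emptyset$ for all $i\ne j$.
   Context: Leaders and initials: for $p\in R\setminus F$ the leader $\mathrm{ld}(p)$ is the $<$-largest variable occurring in $p$; for $p\in F$ put $\mathrm{ld}(p)=1$, with the convention $1<x_i$ for all $i$. The rank $\mathrm{rank}(p)$ is the degree of $p$ in $\mathrm{ld}(p)$ and the initial $\mathrm{init}(p)$ is the coefficient of $\mathrm{ld}(p)^{\mathrm{rank}(p)}$ in $p$, a polynomial in the variables smaller than $\mathrm{ld}(p)$. Systems: for $p\in R$ the symbols $p_=$ and $p_{\neq}$ denote the equation $p=0$ and the inequation $p\ne0$. An algebraic system over $R$ is a finite set of equations and inequations. Let $\overline F$ be the algebraic closure of $F$. A solution of $S$ is a tuple $\mathbf a\in\overline F^n$ with $p(\mathbf a)=0$ for all $p_=\in S$ and $p(\mathbf a)\neq0$ for all $p_{\neq}\in S$; the set of solutions is $\mathfrak{Sol}(S)$. Put $S_{x}=\{p\in S\mid \mathrm{ld}(p)=x\}$ and $S_{<x}=\{p\in S\mid\mathrm{ld}(p)<x\}$;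 the latter is regarded as a system over $F[y\mid y<x]$, with solutions being tuples indexed by the variables $y<x$. For such a tuple $\mathbf a$, $\phi_{\mathbf a}$ denotes evaluation at $\mathbf a$ of polynomials in the variables $y<x$, and $\phi_{<x,\mathbf a}$ denotes substitution of $\mathbf a$ for the variables smaller than $x$, leaving the variables $\ge x$ untouched. Simple systems: a system $S$ is simple if (1) (triangular) $|S_{x_i}|\le1$ for all $1\le i\le n$ and $S$ contains no $c_=$ or $c_{\neq}$ with $c\in F$; (2) (non-vanishing initials) $\phi_{\mathbf a}(\mathrm{init}(p))\neq0$ for all $1\le i\le n$, $p\in S_{x_i}$ and $\mathbf a\in\mathfrak{Sol}(S_{<x_i})$; (3) (square-free) for all $1\le i\le n$, $p\in S_{x_i}$ and $\mathbf a\in\mathfrak{Sol}(S_{<x_i})$ the univariate polynomial $\phi_{<x_i,\mathbf a}(p)\in\overline F[x_i]$ is square-free. The family in a decomposition is allowed to be empty ($m=0$), which is the output when $\mathfrak{Sol}(S')=\emptyset$. *)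

theory Defs
  imports
    "HOL-Library.Poly_Mapping"
    "HOL-Library.FuncSet"
    "HOL-Library.Nat_Bijection"
    "HOL-Computational_Algebra.Squarefree"
    "HOL-Algebra.Algebraic_Closure_Type"
begin

section \<open>Algorithms: partial recursive functions\<close>

text \<open>
  Kleene's partial recursive functions. The value \<open>None\<close> stands for divergence (and for an
  application to the wrong number of arguments); composition is strict, and minimisation
  diverges if the minimised function diverges before its first zero. An algorithm that
  terminates on the input \<open>xs\<close> with output \<open>y\<close> is a program \<open>P\<close> with
  \<open>rec_eval P xs = Some y\<close>.
\<close>

datatype recf =
    ZeroR
  | SuccR
  | ProjR nat
  | CompR recf "recf list"
  | PrimR recf recf
  | MinR recf

fun rec_eval :: "recf \<Rightarrow> nat list \<Rightarrow> nat option" where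
  "rec_eval ZeroR xs = Some 0"
| "rec_eval SuccR xs = (case xs of [x] \<Rightarrow> Some (Suc x) | _ \<Rightarrow> None)"
| "rec_eval (ProjR i) xs = (if i < length xs then Some (xs ! i) else None)"
| "rec_eval (CompR f gs) xs =
     Option.bind (those (map (\<lambda>g. rec_eval g xs) gs)) (\<lambda>ys. rec_eval f ys)"
| "rec_eval (PrimR f g) xs =
     (case xs of [] \<Rightarrow> None
      | x # ys \<Rightarrow>
          rec_nat (rec_eval f ys) (\<lambda>k r. Option.bind r (\<lambda>v. rec_eval g (k # v # ys))) x)"
| "rec_eval (MinR f) xs =
     (if \<exists>z. rec_eval f (z # xs) = Some 0 \<and> (\<forall>y<z. \<exists>v>0. rec_eval f (y # xs) = Some v)
      then Some (LEAST z. rec_eval f (z # xs) = Some 0)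
      else None)"

text \<open>
  A computable field in the sense of Froehlich-Shepherdson and Rabin, presented by an injective
  coding \<open>\<iota>\<close> of its elements by natural numbers: the set of codes is decidable and the field
  operations are computable on codes. Equality of elements is equality of codes.
\<close>

definition computable_field :: "('a::field \<Rightarrow> nat) \<Rightarrow> bool" where
  "computable_field \<iota> \<longleftrightarrow>
     inj \<iota> \<and>
     (\<exists>P. \<forall>c. rec_eval P [c] = Some (if c \<in> range \<iota> then 1 else 0)) \<and>
     (\<exists>P. \<forall>a b. rec_eval P [\<iota> a, \<iota> b] = Some (\<iota> (a + b))) \<and>
     (\<exists>P. \<forall>a. rec_eval P [\<iota> a] = Some (\<iota> (- a))) \<and>
     (\<exists>P. \<forall>a b. rec_eval P [\<iota> a, \<iota> b] = Some (\<iota> (a * b))) \<and>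
     (\<exists>P. \<forall>a. a \<noteq> 0 \<longrightarrow> rec_eval P [\<iota> a] = Some (\<iota> (inverse a)))"


section \<open>Multivariate polynomials\<close>

text \<open>
  A monomial maps variable indices to exponents. The variable \<open>x\<^sub>i\<close> has index \<open>i\<close>, ranked by the
  order on \<open>nat\<close>; the index \<open>0\<close> is no variable of \<open>F[x\<^sub>1,\<dots>,x\<^sub>n]\<close> but plays the role
  of \<open>1\<close> as the leader of a constant, so that \<open>1 < x\<^sub>i\<close> becomes \<open>0 < i\<close>.
\<close>

type_synonym monom = "nat \<Rightarrow>\<^sub>0 nat"
type_synonym 'a mpoly = "monom \<Rightarrow>\<^sub>0 'a"

definition vars :: "'a::zero mpoly \<Rightarrow> nat set" where
  "vars p = (\<Union>m\<in>Poly_Mapping.keys p. Poly_Mapping.keys m)"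

definition poly_ring :: "nat \<Rightarrow> 'a::zero mpoly set" where
  "poly_ring n = {p. vars p \<subseteq> {1..n}}"

definition ld :: "'a::zero mpoly \<Rightarrow> nat" where
  "ld p = (if vars p = {} then 0 else Max (vars p))"

definition degree_in :: "nat \<Rightarrow> 'a::zero mpoly \<Rightarrow> nat" where
  "degree_in x p = Max (insert 0 ((\<lambda>m. Poly_Mapping.lookup m x) ` Poly_Mapping.keys p))"

text \<open>The coefficient of \<open>x\<^sup>k\<close> in \<open>p\<close>, a polynomial in the variables other than \<open>x\<close>:\<close>

definition coeff_in :: "nat \<Rightarrow> nat \<Rightarrow> 'a::comm_monoid_add mpoly \<Rightarrow> 'a mpoly" where
  "coeff_in x k p =
     (\<Sum>m | m \<in> Poly_Mapping.keys p \<and> Poly_Mapping.lookup m x = k.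
        Poly_Mapping.single (Poly_Mapping.update x 0 m) (Poly_Mapping.lookup p m))"

definition rank :: "'a::zero mpoly \<Rightarrow> nat" where
  "rank p = degree_in (ld p) p"

definition init :: "'a::comm_monoid_add mpoly \<Rightarrow> 'a mpoly" where
  "init p = coeff_in (ld p) (rank p) p"

definition eval_at :: "(nat \<Rightarrow> 'a alg_closure) \<Rightarrow> 'a::field mpoly \<Rightarrow> 'a alg_closure" where
  "eval_at a p =
     (\<Sum>m\<in>Poly_Mapping.keys p. to_ac (Poly_Mapping.lookup p m) *
        (\<Prod>i\<in>Poly_Mapping.keys m. a i ^ Poly_Mapping.lookup m i))"

text \<open>
  The substitution \<open>\<phi>\<^bsub><x,a\<^esub>(p)\<close> for a polynomial \<open>p\<close> with leader \<open>x\<close>: view \<open>p\<close> as an element of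
  \<open>F[y | y < x][x]\<close> and evaluate its coefficients at \<open>a\<close>.
\<close>

definition subst_below ::
    "nat \<Rightarrow> (nat \<Rightarrow> 'a alg_closure) \<Rightarrow> 'a::field mpoly \<Rightarrow> 'a alg_closure poly" where
  "subst_below x a p =
     (\<Sum>k\<le>degree_in x p. Polynomial.monom (eval_at a (coeff_in x k p)) k)"


section \<open>Algebraic systems, simple systems and Thomas decompositions\<close>

datatype 'p constr = Eqn (lhs: 'p) | Ineqn (lhs: 'p)

type_synonym 'a system = "'a mpoly constr set"

definition alg_system :: "nat \<Rightarrow> 'a::zero system \<Rightarrow> bool" where
  "alg_system n S \<longleftrightarrow> finite S \<and> lhs ` S \<subseteq> poly_ring n"

text \<open>Tuples indexed by a set \<open>V\<close> of variables are extensional functions on \<open>V\<close>.\<close>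

definition Sol :: "nat set \<Rightarrow> 'a::field system \<Rightarrow> (nat \<Rightarrow> 'a alg_closure) set" where
  "Sol V S = {a \<in> V \<rightarrow>\<^sub>E UNIV.
     (\<forall>p. Eqn p \<in> S \<longrightarrow> eval_at a p = 0) \<and> (\<forall>p. Ineqn p \<in> S \<longrightarrow> eval_at a p \<noteq> 0)}"

definition sys_at :: "'a::zero system \<Rightarrow> nat \<Rightarrow> 'a system" where
  "sys_at S x = {c \<in> S. ld (lhs c) = x}"

definition sys_below :: "'a::zero system \<Rightarrow> nat \<Rightarrow> 'a system" where
  "sys_below S x = {c \<in> S. ld (lhs c) < x}"

definition simple_system :: "nat \<Rightarrow> 'a::field system \<Rightarrow> bool" where
  "simple_system n S \<longleftrightarrow>
     alg_system n S \<and>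
     (\<forall>i\<in>{1..n}. card (sys_at S i) \<le> 1) \<and>
     (\<forall>c. Eqn (Poly_Mapping.single 0 c) \<notin> S \<and> Ineqn (Poly_Mapping.single 0 c) \<notin> S) \<and>
     (\<forall>i\<in>{1..n}. \<forall>c\<in>sys_at S i. \<forall>a\<in>Sol {1..<i} (sys_below S i).
        eval_at a (init (lhs c)) \<noteq> 0) \<and>
     (\<forall>i\<in>{1..n}. \<forall>c\<in>sys_at S i. \<forall>a\<in>Sol {1..<i} (sys_below S i).
        squarefree (subst_below i a (lhs c)))"

definition thomas_decomposition :: "nat \<Rightarrow> 'a::field system \<Rightarrow> 'a system list \<Rightarrow> bool" where
  "thomas_decomposition n S Ss \<longleftrightarrow>
     (\<forall>T\<in>set Ss. simple_system n T) \<and>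
     Sol {1..n} S = (\<Union>T\<in>set Ss. Sol {1..n} T) \<and>
     (\<forall>i<length Ss. \<forall>j<length Ss. i \<noteq> j \<longrightarrow> Sol {1..n} (Ss ! i) \<inter> Sol {1..n} (Ss ! j) = {})"


section \<open>Coding of systems by natural numbers\<close>

text \<open>
  A polynomial is coded by a list of pairs of a coefficient and the exponents of
  \<open>x\<^sub>1,\<dots>,x\<^sub>n\<close>. Zero coefficients, repeated monomials and any order of the terms are
  allowed, and a system may list a constraint repeatedly, so an object has many codes. In
  \<open>Poly_Mapping.nth (0 # es)\<close> the prepended \<open>0\<close> is the exponent of the unused index \<open>0\<close>.
\<close>

definition codes_poly :: "('a::field \<Rightarrow> nat) \<Rightarrow> nat \<Rightarrow> nat \<Rightarrow> 'a mpoly \<Rightarrow> bool" where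
  "codes_poly \<iota> n c p \<longleftrightarrow>
     (\<exists>ts. (\<forall>(a, es)\<in>set ts. length es = n) \<and>
           p = (\<Sum>(a, es)\<leftarrow>ts. Poly_Mapping.single (Poly_Mapping.nth (0 # es)) a) \<and>
           c = list_encode (map (\<lambda>(a, es). prod_encode (\<iota> a, list_encode es)) ts))"

fun codes_constr :: "('a::field \<Rightarrow> nat) \<Rightarrow> nat \<Rightarrow> nat \<Rightarrow> 'a mpoly constr \<Rightarrow> bool" where
  "codes_constr \<iota> n c (Eqn p) \<longleftrightarrow> (\<exists>d. codes_poly \<iota> n d p \<and> c = prod_encode (0, d))"
| "codes_constr \<iota> n c (Ineqn p) \<longleftrightarrow> (\<exists>d. codes_poly \<iota> n d p \<and> c = prod_encode (1, d))"

definition codes_system :: "('a::field \<Rightarrow> nat) \<Rightarrow> nat \<Rightarrow> nat \<Rightarrow> 'a system \<Rightarrow> bool" where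
  "codes_system \<iota> n c S \<longleftrightarrow>
     (\<exists>cs Cs. list_all2 (codes_constr \<iota> n) cs Cs \<and> c = list_encode cs \<and> S = set Cs)"

definition codes_family :: "('a::field \<Rightarrow> nat) \<Rightarrow> nat \<Rightarrow> nat \<Rightarrow> 'a system list \<Rightarrow> bool" where
  "codes_family \<iota> n c Ss \<longleftrightarrow>
     (\<exists>cs. list_all2 (codes_system \<iota> n) cs Ss \<and> c = list_encode cs)"

lemma codes_poly_exists:
  assumes "p \<in> poly_ring n"
  shows "\<exists>c. codes_poly \<iota> n c p"
proof -
  obtain ms where ms: "set ms = Poly_Mapping.keys p" "distinct ms"
    using finite_distinct_list[OF finite_keys[of p]] by blast
  define ex where "ex m = map (Poly_Mapping.lookup m) [1..<Suc n]" for m :: monom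
  define ts where "ts = map (\<lambda>m. (Poly_Mapping.lookup p m, ex m)) ms"
  have ex: "Poly_Mapping.nth (0 # ex m) = m" if "m \<in> Poly_Mapping.keys p" for m
  proof (rule poly_mapping_eqI)
    fix i
    have sub: "Poly_Mapping.keys m \<subseteq> {1..n}"
      using assms that by (auto simp: poly_ring_def vars_def)
    show "Poly_Mapping.lookup (Poly_Mapping.nth (0 # ex m)) i = Poly_Mapping.lookup m i"
    proof (cases "i \<in> {1..n}")
      case True
      then show ?thesis
        by (cases i) (auto simp: nth_default_def ex_def simp del: upt_Suc)
    next
      case False
      then have "Poly_Mapping.lookup m i = 0"
        using sub by (meson in_keys_iff subsetD)
      then show ?thesis
        using False by (cases i) (auto simp: nth_default_def ex_def simp del: upt_Suc)
    qed
  qed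
  have "(\<Sum>(a, es)\<leftarrow>ts. Poly_Mapping.single (Poly_Mapping.nth (0 # es)) a) =
        (\<Sum>m\<leftarrow>ms. Poly_Mapping.single m (Poly_Mapping.lookup p m))"
    unfolding ts_def using ex ms(1) by (auto simp: comp_def intro!: arg_cong[of _ _ sum_list])
  also have "\<dots> = (\<Sum>m\<in>Poly_Mapping.keys p. Poly_Mapping.single m (Poly_Mapping.lookup p m))"
    using ms by (simp add: sum_list_distinct_conv_sum_set)
  also have "\<dots> = p"
    by (rule poly_mapping_eqI)
       (auto simp: lookup_sum lookup_single when_def in_keys_iff)
  finally have "p = (\<Sum>(a, es)\<leftarrow>ts. Poly_Mapping.single (Poly_Mapping.nth (0 # es)) a)"
    by simp
  moreover have "\<forall>(a, es)\<in>set ts. length es = n"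
    by (auto simp: ts_def ex_def)
  ultimately show ?thesis
    unfolding codes_poly_def by blast
qed

lemma codes_system_exists:
  assumes "alg_system n S"
  shows "\<exists>c. codes_system \<iota> n c S"
proof -
  obtain Cs where Cs: "set Cs = S"
    using assms finite_list unfolding alg_system_def by blast
  have "\<exists>d. codes_constr \<iota> n d C" if "C \<in> S" for C
  proof -
    have "lhs C \<in> poly_ring n"
      using assms that by (auto simp: alg_system_def)
    then show ?thesis
      using codes_poly_exists[of "lhs C" n \<iota>] by (cases C) auto
  qed
  then obtain f where "\<And>C. C \<in> S \<Longrightarrow> codes_constr \<iota> n (f C) C"
    by metis
  then have "list_all2 (codes_constr \<iota> n) (map f Cs) Cs"
    using Cs by (auto simp: list_all2_conv_all_nth)
  then show ?thesis
    using Cs unfolding codes_system_def by blast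
qed

lemma codes_poly_unique:
  assumes "inj \<iota>" "codes_poly \<iota> n c p" "codes_poly \<iota> n c q"
  shows "p = q"
proof -
  have "inj (\<lambda>(a, es). prod_encode (\<iota> a, list_encode es))"
    using assms(1) inj_list_encode[of UNIV] by (auto simp: inj_on_def)
  then show ?thesis
    using assms(2,3) unfolding codes_poly_def
    by (metis (no_types, lifting) list_encode_inverse map_injective)
qed

lemma codes_system_unique:
  assumes "inj \<iota>" "codes_system \<iota> n c S" "codes_system \<iota> n c T"
  shows "S = T"
proof -
  have C: "C = D" if "codes_constr \<iota> n d C" "codes_constr \<iota> n d D" for d C D
    using that codes_poly_unique[OF assms(1)] by (cases C; cases D) auto
  obtain cs Cs Ds where *: "list_all2 (codes_constr \<iota> n) cs Cs" "S = set Cs"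
      "list_all2 (codes_constr \<iota> n) cs Ds" "T = set Ds"
    using assms(2,3) unfolding codes_system_def by (metis list_encode_inverse)
  have "Cs = Ds"
    using *(1,3) C by (auto simp: list_all2_conv_all_nth intro!: nth_equalityI)
  then show ?thesis
    using * by simp
qed

end

theory Submission
  imports Defs
begin

text \<open>
  The algorithm is an unbounded search: it runs through all families of systems, together with
  finite certificates that the family is a Thomas decomposition of the input, and stops at the first
  family whose certificates are correct. It is correct and terminates for three reasons.

  A Thomas decomposition exists (\<open>decomposition_exists\<close>). By induction on the number of variables, the
  equations and inequations in the last variable are treated as univariate polynomials whose
  coefficients are polynomials in the other variables. Finitely many tests whether a polynomial in the
  other variables vanishes lead to cases in which the Euclidean algorithm runs uniformly in the
  parameters. In each case the constraints for the last variable become one square-free equation or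
  inequation (\<open>by_cases_fiber\<close>). The cases are disjoint and are themselves given by algebraic systems,
  which are decomposed by induction.

  Each property of a Thomas decomposition says that certain systems are unsolvable
  (\<open>obligations\<close>). The initial of \<open>p\<close> does not vanish on the solutions of \<open>S\<^bsub><x\<^esub>\<close> if adding it as an
  equation makes that system unsolvable; \<open>p\<close> is square-free on them if \<open>p\<close> and its derivative with
  respect to \<open>x\<close> have no common zero above them; and disjointness and equality of solution sets are
  expressed by adding and negating constraints.

  A system over \<open>F\<close> without solution in the algebraic closure has a certificate
  (\<open>nullstellensatz\<close>): a product of left-hand sides of its inequations is a combination of the
  left-hand sides of its equations, with coefficients in \<open>F[x\<^sub>1,\<dots>,x\<^sub>n]\<close>. Checking this identity only
  needs the arithmetic of \<open>F\<close>. For the proof, an ideal without such an identity is contained in a prime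
  ideal that avoids the inequations, and a zero of the prime ideal is built one variable at a time
  (\<open>prime_extension\<close>).

  It remains to see that the check is a partial recursive function. For this purpose computability is
  defined for functions between types with a coding by numbers and shown to be closed under
  pairing, conditionals, primitive recursion and folds over lists. All functions of the check are
  written with these operations on lists of terms, and \<open>computable_search\<close> adds the minimisation.
\<close>

section \<open>Programs for arithmetic and pairing\<close>

fun const_prog :: "nat \<Rightarrow> recf" where
  "const_prog 0 = ZeroR"
| "const_prog (Suc c) = CompR SuccR [const_prog c]"

definition "pred_prog = PrimR ZeroR (ProjR 0)"
definition "sgn_prog = PrimR ZeroR (const_prog 1)"
definition "add_prog = PrimR (ProjR 0) (CompR SuccR [ProjR 1])"
definition "diff_prog = PrimR (ProjR 0) (CompR pred_prog [ProjR 1])"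
definition "triangle_prog = PrimR ZeroR (CompR add_prog [ProjR 1, CompR SuccR [ProjR 0]])"
definition "pair_prog = CompR add_prog [CompR triangle_prog [add_prog], ProjR 0]"
definition "root_prog =
  MinR (CompR diff_prog [CompR triangle_prog [CompR SuccR [ProjR 0]], CompR SuccR [ProjR 1]])"
definition "fst_prog = CompR diff_prog [CompR triangle_prog [root_prog], ProjR 0]"
definition "snd_prog = CompR diff_prog [fst_prog, root_prog]"

lemma const_prog [simp]: "rec_eval (const_prog c) xs = Some c"
  by (induction c) auto

lemma pred_prog [simp]: "rec_eval pred_prog [x] = Some (x - 1)"
  by (cases x) (auto simp: pred_prog_def, induct_tac nat, auto)

lemma sgn_prog [simp]: "rec_eval sgn_prog [x] = Some (of_bool (x \<noteq> 0))"
  by (induction x) (auto simp: sgn_prog_def)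

lemma add_prog [simp]: "rec_eval add_prog [x, y] = Some (x + y)"
  by (induction x) (auto simp: add_prog_def)

lemma diff_prog [simp]: "rec_eval diff_prog [y, x] = Some (x - y)"
  by (induction y) (auto simp: diff_prog_def)

lemma triangle_prog [simp]: "rec_eval triangle_prog [x] = Some (triangle x)"
  by (induction x) (auto simp: triangle_prog_def)

lemma pair_prog [simp]: "rec_eval pair_prog [x, y] = Some (prod_encode (x, y))"
  by (simp add: pair_prog_def prod_encode_def)

lemma triangle_mono: "m \<le> n \<Longrightarrow> triangle m \<le> triangle n"
  by (induction n) (auto simp: le_Suc_eq)

text \<open>The code of \<open>(x, y)\<close> lies in the interval from \<open>triangle (x + y)\<close> to
  \<open>triangle (Suc (x + y))\<close>, so the diagonal \<open>x + y\<close> is the least \<open>s\<close> for which the code is below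
  \<open>triangle (Suc s)\<close>. Both components are differences from there.\<close>

lemma root_prog [simp]: "rec_eval root_prog [prod_encode (x, y)] = Some (x + y)"
proof -
  have iff: "prod_encode (x, y) < triangle (Suc s) \<longleftrightarrow> x + y \<le> s" for s
  proof
    assume "prod_encode (x, y) < triangle (Suc s)"
    then have "\<not> Suc s \<le> x + y"
      using triangle_mono[of "Suc s" "x + y"] by (auto simp: prod_encode_def)
    then show "x + y \<le> s" by simp
  next
    assume "x + y \<le> s"
    then show "prod_encode (x, y) < triangle (Suc s)"
      using triangle_mono[of "x + y" s] by (simp add: prod_encode_def)
  qed
  let ?f = "\<lambda>s. Suc (prod_encode (x, y)) - triangle (Suc s)"
  have z: "?f s = 0 \<longleftrightarrow> x + y \<le> s" for s
    using iff[of s] by linarith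
  have ex: "\<exists>z. ?f z = 0 \<and> (\<forall>y<z. \<exists>v>0. ?f y = v)"
    using z by (intro exI[of _ "x + y"]) (metis leD neq0_conv order_refl)
  have least: "(LEAST z. ?f z = 0) = x + y"
    unfolding z by (rule Least_equality) auto
  show ?thesis
    using ex least unfolding root_prog_def by (simp del: triangle_Suc)
qed

lemma fst_prog [simp]: "rec_eval fst_prog [prod_encode (x, y)] = Some x"
  by (simp add: fst_prog_def) (simp add: prod_encode_def)

lemma snd_prog [simp]: "rec_eval snd_prog [prod_encode (x, y)] = Some y"
  by (simp add: snd_prog_def)

section \<open>Computable functions between coded types\<close>

text \<open>The program is specified on codes only. The programs of a computable field may diverge on
  numbers that code no element, and with this notion they can be used as they are.\<close>

definition computable :: "('a \<Rightarrow> nat) \<Rightarrow> ('b \<Rightarrow> nat) \<Rightarrow> ('a \<Rightarrow> 'b) \<Rightarrow> bool" where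
  "computable e d f \<longleftrightarrow> (\<exists>P. \<forall>x. rec_eval P [e x] = Some (d (f x)))"

text \<open>These codings agree with the coding of algebraic systems: a constraint is a pair of a tag and
  a list of terms, with the tag \<open>True\<close> for an inequation.\<close>

definition nat_code :: "nat \<Rightarrow> nat" where "nat_code n = n"
definition bool_code :: "bool \<Rightarrow> nat" where "bool_code b = of_bool b"
definition pair_code :: "('a \<Rightarrow> nat) \<Rightarrow> ('b \<Rightarrow> nat) \<Rightarrow> 'a \<times> 'b \<Rightarrow> nat" where
  "pair_code c d p = prod_encode (c (fst p), d (snd p))"
definition list_code :: "('a \<Rightarrow> nat) \<Rightarrow> 'a list \<Rightarrow> nat" where
  "list_code c xs = list_encode (map c xs)"

lemma inj_nat_code [simp]: "inj nat_code" by (simp add: inj_def nat_code_def)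
lemma inj_bool_code [simp]: "inj bool_code" by (simp add: inj_def bool_code_def)
lemma inj_pair_code [simp]: "inj c \<Longrightarrow> inj d \<Longrightarrow> inj (pair_code c d)"
  by (auto simp: inj_def pair_code_def)
lemma inj_list_code [simp]: "inj c \<Longrightarrow> inj (list_code c)"
  by (auto simp: inj_def list_code_def list_encode_eq inj_map_eq_map)

lemma computableI: "(\<And>x. rec_eval P [e x] = Some (d (f x))) \<Longrightarrow> computable e d f"
  unfolding computable_def by blast

lemma computable_id: "computable e e (\<lambda>x. x)"
  by (rule computableI[of "ProjR 0"]) simp

lemma computable_const: "computable e d (\<lambda>x. c)"
  by (rule computableI[of "const_prog (d c)"]) simp

lemma computable_comp:
  assumes "computable d c g" "computable e d f"
  shows "computable e c (\<lambda>x. g (f x))"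
proof -
  obtain P where P: "\<And>x. rec_eval P [d x] = Some (c (g x))"
    using assms(1) unfolding computable_def by blast
  obtain Q where Q: "\<And>x. rec_eval Q [e x] = Some (d (f x))"
    using assms(2) unfolding computable_def by blast
  show ?thesis by (rule computableI[of "CompR P [Q]"]) (simp add: P Q)
qed

lemma computable_binary:
  assumes P: "\<And>x y. rec_eval P [c x, d y] = Some (b (h x y))"
    and "computable e c f" "computable e d g"
  shows "computable e b (\<lambda>x. h (f x) (g x))"
proof -
  obtain Q where Q: "\<And>x. rec_eval Q [e x] = Some (c (f x))"
    using assms(2) unfolding computable_def by blast
  obtain R where R: "\<And>x. rec_eval R [e x] = Some (d (g x))"
    using assms(3) unfolding computable_def by blast
  show ?thesis by (rule computableI[of "CompR P [Q, R]"]) (simp add: P Q R)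
qed

lemma computable_pair:
  "computable e c f \<Longrightarrow> computable e d g \<Longrightarrow> computable e (pair_code c d) (\<lambda>x. (f x, g x))"
  by (rule computable_binary[of pair_prog c d "pair_code c d" Pair]) (simp_all add: pair_code_def)

lemma computable_fst: "computable e (pair_code c d) f \<Longrightarrow> computable e c (\<lambda>x. fst (f x))"
  by (rule computable_comp[of "pair_code c d" c fst])
     (auto intro: computableI[of fst_prog] simp: pair_code_def)

lemma computable_snd: "computable e (pair_code c d) f \<Longrightarrow> computable e d (\<lambda>x. snd (f x))"
  by (rule computable_comp[of "pair_code c d" d snd])
     (auto intro: computableI[of snd_prog] simp: pair_code_def)

lemma computable_app2:
  assumes "computable (pair_code c d) b (\<lambda>z. f (fst z) (snd z))"
    and "computable e c u" "computable e d v"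
  shows "computable e b (\<lambda>x. f (u x) (v x))"
  using computable_comp[OF assms(1) computable_pair[OF assms(2,3)]] by simp

lemma computable_app3:
  assumes "computable (pair_code c (pair_code d a)) b (\<lambda>z. f (fst z) (fst (snd z)) (snd (snd z)))"
    and "computable e c u" "computable e d v" "computable e a w"
  shows "computable e b (\<lambda>x. f (u x) (v x) (w x))"
  using computable_comp[OF assms(1) computable_pair[OF assms(2) computable_pair[OF assms(3,4)]]] by simp

lemmas computable_basic = computable_id computable_fst computable_snd computable_pair computable_const

text \<open>Programs have one argument, and the environment \<open>x\<close> in which the step is computed is
  carried along as the first component of a pair. The same device serves for the other operators
  that bind variables.\<close>

lemma computable_rec_nat:
  assumes "computable e nat_code m" "computable e b s"
    and "computable (pair_code e (pair_code nat_code b)) b (\<lambda>z. t (fst z) (fst (snd z)) (snd (snd z)))"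
  shows "computable e b (\<lambda>x. rec_nat (s x) (t x) (m x))"
proof -
  obtain M where M: "\<And>x. rec_eval M [e x] = Some (m x)"
    using assms(1) unfolding computable_def nat_code_def by blast
  obtain S where S: "\<And>x. rec_eval S [e x] = Some (b (s x))"
    using assms(2) unfolding computable_def by blast
  obtain T where T': "\<And>z. rec_eval T [pair_code e (pair_code nat_code b) z]
      = Some (b (t (fst z) (fst (snd z)) (snd (snd z))))"
    using assms(3) unfolding computable_def by blast
  have T: "rec_eval T [prod_encode (e x, prod_encode (k, b v))] = Some (b (t x k v))" for x k v
    using T'[of "(x, k, v)"] by (simp add: pair_code_def nat_code_def)
  define P where
    "P = PrimR S (CompR T [CompR pair_prog [ProjR 2, CompR pair_prog [ProjR 0, ProjR 1]]])"
  have P: "rec_eval P [k, e x] = Some (b (rec_nat (s x) (t x) k))" for k x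
    by (induction k) (simp_all add: P_def S T)
  show ?thesis by (rule computableI[of "CompR P [M, ProjR 0]"]) (simp add: M P)
qed

lemma computable_if:
  assumes "computable e bool_code c" "computable e b f" "computable e b g"
  shows "computable e b (\<lambda>x. if c x then f x else g x)"
proof -
  obtain C where C: "\<And>x. rec_eval C [e x] = Some (of_bool (c x))"
    using assms(1) unfolding computable_def bool_code_def by blast
  obtain F where F: "\<And>x. rec_eval F [e x] = Some (b (f x))"
    using assms(2) unfolding computable_def by blast
  obtain G where G: "\<And>x. rec_eval G [e x] = Some (b (g x))"
    using assms(3) unfolding computable_def by blast
  show ?thesis
    by (rule computableI[of "CompR (PrimR G (CompR F [ProjR 2])) [C, ProjR 0]"])
       (simp add: C F G)
qed

lemma computable_nat_eq:
  assumes "computable e nat_code f" "computable e nat_code g"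
  shows "computable e bool_code (\<lambda>x. f x = g x)"
proof (rule computable_binary[OF _ assms])
  fix x y
  show "rec_eval (CompR diff_prog [CompR sgn_prog [CompR add_prog [diff_prog,
          CompR diff_prog [ProjR 1, ProjR 0]]], const_prog 1]) [nat_code x, nat_code y]
    = Some (bool_code (x = y))"
    by (auto simp: nat_code_def bool_code_def)
qed

lemma computable_le:
  assumes "computable e nat_code f" "computable e nat_code g"
  shows "computable e bool_code (\<lambda>x. f x \<le> g x)"
proof (rule computable_binary[OF _ assms])
  fix x y
  show "rec_eval (CompR diff_prog [CompR sgn_prog [CompR diff_prog [ProjR 1, ProjR 0]], const_prog 1])
      [nat_code x, nat_code y] = Some (bool_code (x \<le> y))"
    by (auto simp: nat_code_def bool_code_def)
qed

lemma computable_code: "computable e c f \<Longrightarrow> computable e nat_code (\<lambda>x. c (f x))"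
  unfolding computable_def nat_code_def .

lemma computable_eq:
  assumes "inj c" "computable e c f" "computable e c g"
  shows "computable e bool_code (\<lambda>x. f x = g x)"
  using computable_nat_eq[OF assms(2,3)[THEN computable_code]] assms(1) by (simp add: inj_eq)

lemma computable_Suc: "computable e nat_code f \<Longrightarrow> computable e nat_code (\<lambda>x. Suc (f x))"
  by (rule computable_comp[of nat_code nat_code Suc])
     (auto intro: computableI[of SuccR] simp: nat_code_def)

lemma computable_add:
  "computable e nat_code f \<Longrightarrow> computable e nat_code g \<Longrightarrow> computable e nat_code (\<lambda>x. f x + g x)"
  by (rule computable_binary[of add_prog]) (auto simp: nat_code_def)

lemma computable_diff:
  "computable e nat_code f \<Longrightarrow> computable e nat_code g \<Longrightarrow> computable e nat_code (\<lambda>x. f x - g x)"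
  by (rule computable_binary[of "CompR diff_prog [ProjR 1, ProjR 0]"]) (auto simp: nat_code_def)

lemma computable_not:
  assumes "computable e bool_code f"
  shows "computable e bool_code (\<lambda>x. \<not> f x)"
proof -
  have "(\<lambda>x. \<not> f x) = (\<lambda>x. if f x then False else True)" by auto
  then show ?thesis
    using computable_if[OF assms, of bool_code "\<lambda>x. False" "\<lambda>x. True"] by (simp only: computable_const)
qed

lemma computable_conj:
  assumes "computable e bool_code f" "computable e bool_code g"
  shows "computable e bool_code (\<lambda>x. f x \<and> g x)"
proof -
  have "(\<lambda>x. f x \<and> g x) = (\<lambda>x. if f x then g x else False)" by auto
  then show ?thesis
    using computable_if[OF assms, of "\<lambda>x. False"] by (simp only: computable_const)
qed

lemma computable_imp:
  assumes "computable e bool_code f" "computable e bool_code g"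
  shows "computable e bool_code (\<lambda>x. f x \<longrightarrow> g x)"
proof -
  have "(\<lambda>x. f x \<longrightarrow> g x) = (\<lambda>x. if f x then g x else True)" by auto
  then show ?thesis
    using computable_if[OF assms, of "\<lambda>x. True"] by (simp only: computable_const)
qed

lemma computable_Cons:
  assumes "computable e c f" "computable e (list_code c) g"
  shows "computable e (list_code c) (\<lambda>x. f x # g x)"
  by (rule computable_binary[OF _ assms, of "CompR SuccR [pair_prog]"]) (simp add: list_code_def)

lemma computable_case_list:
  assumes "computable e (list_code a) l" "computable e b f"
    and "computable (pair_code e (pair_code a (list_code a))) b (\<lambda>z. g (fst z) (fst (snd z)) (snd (snd z)))"
  shows "computable e b (\<lambda>x. case l x of [] \<Rightarrow> f x | y # ys \<Rightarrow> g x y ys)"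
proof -
  obtain L where L: "\<And>x. rec_eval L [e x] = Some (list_code a (l x))"
    using assms(1) unfolding computable_def by blast
  obtain F where F: "\<And>x. rec_eval F [e x] = Some (b (f x))"
    using assms(2) unfolding computable_def by blast
  obtain G where G': "\<And>z. rec_eval G [pair_code e (pair_code a (list_code a)) z]
      = Some (b (g (fst z) (fst (snd z)) (snd (snd z))))"
    using assms(3) unfolding computable_def by blast
  have G: "rec_eval G [prod_encode (e x, prod_encode (a y, list_encode (map a ys)))]
    = Some (b (g x y ys))" for x y ys
    using G'[of "(x, y, ys)"] by (simp add: pair_code_def list_code_def)
  \<comment> \<open>The recursion runs over the sign of the code, so that \<open>G\<close> is only run on a nonempty list.\<close>
  define P where
    "P = PrimR (CompR F [ProjR 1]) (CompR G [CompR pair_prog [ProjR 3, CompR pred_prog [ProjR 2]]])"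
  have "rec_eval (CompR P [CompR sgn_prog [L], L, ProjR 0]) [e x]
      = Some (b (case l x of [] \<Rightarrow> f x | y # ys \<Rightarrow> g x y ys))" for x
    by (cases "l x") (simp_all add: P_def L F G list_code_def)
  then show ?thesis by (rule computableI)
qed

lemma length_le_list_encode: "length xs \<le> list_encode xs"
proof (induction xs)
  case (Cons x xs)
  then show ?case using le_prod_encode_2[of "list_encode xs" x] by simp
qed simp

text \<open>A fold is an iteration on pairs of a rest list and an accumulator. The code of the list
  bounds its length, and further iterations leave the pair unchanged.\<close>

lemma computable_fold:
  assumes "computable e (list_code a) l" "computable e b s"
    and "computable (pair_code e (pair_code a b)) b (\<lambda>z. g (fst z) (fst (snd z)) (snd (snd z)))"
  shows "computable e b (\<lambda>x. fold (g x) (l x) (s x))"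
proof -
  define t where "t x k st =
    (case fst st of [] \<Rightarrow> st | y # ys \<Rightarrow> (ys, g x y (snd st)))" for x :: 'a and k :: nat and st
  have iter: "k \<ge> length ys \<Longrightarrow> rec_nat (ys, v) (t x) k = ([], fold (g x) ys v)" for x k ys v
  proof -
    have shift: "rec_nat (ys, v) (t x) (Suc k) = rec_nat (t x 0 (ys, v)) (t x) k" for ys v k
      by (induction k) (simp_all add: t_def)
    show "k \<ge> length ys \<Longrightarrow> rec_nat (ys, v) (t x) k = ([], fold (g x) ys v)"
    proof (induction k arbitrary: ys v)
      case (Suc k)
      show ?case
        unfolding shift using Suc
        by (cases ys) (simp_all add: t_def[of _ 0] del: old.nat.rec(2))
    qed simp
  qed
  have len: "list_code a ys \<ge> length ys" for ys
    using length_le_list_encode[of "map a ys"] by (simp add: list_code_def)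
  have "computable e (pair_code (list_code a) b)
    (\<lambda>x. rec_nat (l x, s x) (t x) (list_code a (l x)))"
  proof (rule computable_rec_nat)
    show "computable e nat_code (\<lambda>x. list_code a (l x))"
      by (rule computable_code) (rule assms)
    show "computable e (pair_code (list_code a) b) (\<lambda>x. (l x, s x))"
      by (intro computable_pair assms)
    let ?e = "pair_code e (pair_code nat_code (pair_code (list_code a) b))"
    let ?e' = "pair_code ?e (pair_code a (list_code a))"
    show "computable ?e (pair_code (list_code a) b) (\<lambda>z. t (fst z) (fst (snd z)) (snd (snd z)))"
      unfolding t_def
      by (rule computable_case_list computable_app3[OF assms(3)] computable_basic)+
  qed
  then have "computable e b (\<lambda>x. snd (rec_nat (l x, s x) (t x) (list_code a (l x))))"
    by (rule computable_snd)
  then show ?thesis using iter[OF len] by simp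
qed

lemma rev_conv_fold: "rev xs = fold Cons xs []"
  by (simp add: fold_Cons_rev)

lemma computable_rev:
  assumes "computable e (list_code a) l"
  shows "computable e (list_code a) (\<lambda>x. rev (l x))"
  unfolding rev_conv_fold
  by (rule assms computable_fold computable_Cons computable_basic)+

lemma computable_map:
  assumes "computable e (list_code a) l" "computable (pair_code e a) b (\<lambda>z. f (fst z) (snd z))"
  shows "computable e (list_code b) (\<lambda>x. map (f x) (l x))"
proof -
  have eq: "map f xs = rev (fold (\<lambda>y acc. f y # acc) xs [])" for f :: "'b \<Rightarrow> 'c" and xs
    by (induction xs rule: rev_induct) auto
  show ?thesis
    unfolding eq by (rule assms(1) computable_app2[OF assms(2)] computable_rev computable_fold computable_Cons computable_basic)+
qed

lemma computable_append:
  assumes "computable e (list_code a) l" "computable e (list_code a) m"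
  shows "computable e (list_code a) (\<lambda>x. l x @ m x)"
proof -
  have eq: "xs @ ys = fold Cons (rev xs) ys" for xs ys :: "'b list"
    by (simp flip: foldr_conv_fold, induction xs, auto)
  show ?thesis
    unfolding eq by (rule assms(1) assms(2) computable_fold computable_rev computable_Cons computable_basic)+
qed

lemma computable_concat:
  assumes "computable e (list_code (list_code a)) l"
  shows "computable e (list_code a) (\<lambda>x. concat (l x))"
proof -
  have eq: "concat xs = fold (\<lambda>y acc. acc @ y) xs []" for xs :: "'b list list"
    by (induction xs rule: rev_induct) auto
  show ?thesis
    unfolding eq by (rule assms computable_fold computable_append computable_basic)+
qed

lemma computable_list_all:
  assumes "computable e (list_code a) l" "computable (pair_code e a) bool_code (\<lambda>z. f (fst z) (snd z))"
  shows "computable e bool_code (\<lambda>x. \<forall>y\<in>set (l x). f x y)"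
proof -
  have eq: "(\<forall>y\<in>set xs. f y) = fold (\<lambda>y acc. f y \<and> acc) xs True" for f :: "'b \<Rightarrow> bool" and xs
    by (induction xs rule: rev_induct) auto
  show ?thesis
    unfolding eq by (rule assms(1) computable_app2[OF assms(2)] computable_fold computable_conj computable_basic)+
qed

lemma computable_list_ex:
  assumes "computable e (list_code a) l" "computable (pair_code e a) bool_code (\<lambda>z. f (fst z) (snd z))"
  shows "computable e bool_code (\<lambda>x. \<exists>y\<in>set (l x). f x y)"
  using computable_not[OF computable_list_all[OF assms(1) computable_not[OF assms(2)]]] by simp

lemma computable_filter:
  assumes "computable e (list_code a) l" "computable (pair_code e a) bool_code (\<lambda>z. f (fst z) (snd z))"
  shows "computable e (list_code a) (\<lambda>x. filter (f x) (l x))"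
proof -
  have eq: "filter f xs = rev (fold (\<lambda>y acc. if f y then y # acc else acc) xs [])" for f :: "'b \<Rightarrow> bool" and xs
    by (induction xs rule: rev_induct) auto
  show ?thesis
    unfolding eq by (rule assms(1) computable_app2[OF assms(2)] computable_rev computable_fold computable_Cons computable_if computable_basic)+
qed

lemma computable_length:
  assumes "computable e (list_code a) l"
  shows "computable e nat_code (\<lambda>x. length (l x))"
proof -
  have eq: "length xs = fold (\<lambda>y acc. Suc acc) xs 0" for xs :: "'b list"
    by (induction xs rule: rev_induct) auto
  show ?thesis
    unfolding eq by (rule assms computable_fold computable_Suc computable_basic)+
qed

lemma computable_nth_default:
  assumes "computable e (list_code a) l" "computable e nat_code m"
  shows "computable e a (\<lambda>x. nth_default d (l x) (m x))"
proof -
  have drop: "rec_nat xs (\<lambda>_ ys. case ys of [] \<Rightarrow> [] | z # zs \<Rightarrow> zs) k = drop k xs" for k and xs :: "'b list"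
    unfolding tl_def[symmetric] by (induction k) (simp_all add: drop_Suc tl_drop)
  have "nth_default d xs k = (case drop k xs of [] \<Rightarrow> d | z # zs \<Rightarrow> z)" for xs k
    by (auto simp: nth_default_def nth_via_drop not_less[symmetric] split: list.split)
  then have eq: "nth_default d xs k = (case rec_nat xs (\<lambda>_ ys. case ys of [] \<Rightarrow> [] | z # zs \<Rightarrow> zs) k
      of [] \<Rightarrow> d | z # zs \<Rightarrow> z)" for xs k
    unfolding drop by simp
  show ?thesis
    unfolding eq
    by (rule assms computable_case_list computable_rec_nat computable_basic)+
qed

section \<open>Unbounded search\<close>

text \<open>Unbounded search runs through all numbers, whether or not they are codes, so each number has
  to be turned into some candidate.\<close>

definition searchable :: "('a \<Rightarrow> nat) \<Rightarrow> bool" where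
  "searchable e \<longleftrightarrow> (\<exists>D. computable nat_code e D \<and> (\<forall>x. D (e x) = x))"

lemma searchable_nat: "searchable nat_code"
  unfolding searchable_def using computable_id[of nat_code] by (auto simp: nat_code_def)

lemma searchable_bool: "searchable bool_code"
  unfolding searchable_def
  by (rule exI[of _ "\<lambda>z. z = 1"], intro conjI computable_nat_eq computable_id computable_const)
     (simp add: bool_code_def)

lemma searchable_pair:
  assumes "searchable c" "searchable d"
  shows "searchable (pair_code c d)"
proof -
  obtain C D where C: "computable nat_code c C" "\<And>x. C (c x) = x"
    and D: "computable nat_code d D" "\<And>x. D (d x) = x"
    using assms unfolding searchable_def by metis
  have dec: "computable nat_code (pair_code nat_code nat_code) prod_decode"
    by (rule computableI[of "ProjR 0"]) (simp add: pair_code_def nat_code_def)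
  show ?thesis
    unfolding searchable_def
    by (rule exI[of _ "\<lambda>z. (C (fst (prod_decode z)), D (snd (prod_decode z)))"])
       (rule conjI dec computable_comp[OF C(1)] computable_comp[OF D(1)] computable_basic
          | simp add: C D pair_code_def)+
qed

lemma searchable_list:
  assumes "searchable c"
  shows "searchable (list_code c)"
proof -
  obtain C where C: "computable nat_code c C" "\<And>x. C (c x) = x"
    using assms unfolding searchable_def by metis
  have dec: "computable nat_code (list_code nat_code) list_decode"
    by (rule computableI[of "ProjR 0"]) (simp add: list_code_def nat_code_def[abs_def])
  have "computable nat_code (list_code c) (\<lambda>z. map C (list_decode z))"
    by (rule computable_map[OF dec] computable_comp[OF C(1)] computable_basic)+
  then show ?thesis
    unfolding searchable_def
    by (rule exI[of _ "\<lambda>z. map C (list_decode z)", OF conjI]) (simp add: list_code_def comp_def C)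
qed

text \<open>Decoding is total, so every number can be tested, and the minimisation ends as soon as some
  witness exists.\<close>

theorem computable_search:
  assumes "computable (pair_code e d) bool_code (\<lambda>z. R (fst z) (snd z))" "searchable d"
  shows "\<exists>P. \<forall>x. (\<exists>y. R x y) \<longrightarrow> (\<exists>y. R x y \<and> rec_eval P [e x] = Some (d y))"
proof -
  obtain D where D: "computable nat_code d D" "\<And>y. D (d y) = y"
    using assms(2) unfolding searchable_def by metis
  have "computable (pair_code nat_code e) bool_code (\<lambda>z. R (snd z) (D (fst z)))"
    by (rule computable_app2[OF assms(1)] computable_comp[OF D(1)] computable_basic)+
  then obtain Q where "\<And>z. rec_eval Q [pair_code nat_code e z] = Some (of_bool (R (snd z) (D (fst z))))"
    unfolding computable_def bool_code_def by blast
  from this[of "(z, x)" for z x]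
  have Q: "rec_eval Q [prod_encode (z, e x)] = Some (of_bool (R x (D z)))" for x z
    by (simp add: pair_code_def nat_code_def)
  define B where "B = CompR diff_prog [CompR Q [pair_prog], const_prog 1]"
  obtain P where P: "\<And>z. rec_eval P [z] = Some (d (D z))"
    using D(1) unfolding computable_def nat_code_def by blast
  have "\<exists>y. R x y \<and> rec_eval (CompR P [MinR B]) [e x] = Some (d y)" if ex: "\<exists>y. R x y" for x
  proof -
    have f: "rec_eval B [z, e x] = Some (1 - of_bool (R x (D z)))" for z
      by (simp add: B_def Q)
    define z where "z = (LEAST z. R x (D z))"
    have z: "R x (D z)" "\<And>y. y < z \<Longrightarrow> \<not> R x (D y)"
      using ex D(2) unfolding z_def by (metis LeastI, metis not_less_Least)
    have "(LEAST z. 1 - of_bool (R x (D z)) = (0::nat)) = z"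
      unfolding z_def by (rule arg_cong[of _ _ Least]) (auto simp: fun_eq_iff)
    moreover have "\<exists>z. 1 - of_bool (R x (D z)) = (0::nat) \<and> (\<forall>y<z. 1 - of_bool (R x (D y)) > (0::nat))"
      using z by (intro exI[of _ z]) auto
    ultimately have "rec_eval (MinR B) [e x] = Some z"
      unfolding rec_eval.simps(6) f option.inject by simp
    then show ?thesis using z(1) by (auto simp: P)
  qed
  then show ?thesis by blast
qed

section \<open>Multivariate polynomials and their evaluation\<close>

abbreviation lookup :: "('b \<Rightarrow>\<^sub>0 'c::zero) \<Rightarrow> 'b \<Rightarrow> 'c" where
  "lookup \<equiv> Poly_Mapping.lookup"
abbreviation keys :: "('b \<Rightarrow>\<^sub>0 'c::zero) \<Rightarrow> 'b set" where
  "keys \<equiv> Poly_Mapping.keys"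
abbreviation single :: "'b \<Rightarrow> 'c::zero \<Rightarrow> 'b \<Rightarrow>\<^sub>0 'c" where
  "single \<equiv> Poly_Mapping.single"
abbreviation update :: "'b \<Rightarrow> 'c::zero \<Rightarrow> ('b \<Rightarrow>\<^sub>0 'c) \<Rightarrow> 'b \<Rightarrow>\<^sub>0 'c" where
  "update \<equiv> Poly_Mapping.update"

type_synonym 'a point = "nat \<Rightarrow> 'a alg_closure"

lemma mpoly_as_sum: "p = (\<Sum>m\<in>keys p. single m (lookup p m))"
  for p :: "'b \<Rightarrow>\<^sub>0 'a::comm_monoid_add"
  by (rule poly_mapping_eqI) (auto simp: lookup_sum lookup_single when_def in_keys_iff)

lemma mpoly_induct [case_names zero add single]:
  fixes p :: "'b \<Rightarrow>\<^sub>0 'a::comm_monoid_add"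
  assumes "P 0" "\<And>p q. P p \<Longrightarrow> P q \<Longrightarrow> P (p + q)"
    and "\<And>m. m \<in> keys p \<Longrightarrow> P (single m (lookup p m))"
  shows "P p"
proof -
  have "P (\<Sum>m\<in>A. single m (lookup p m))"
    if "finite A" "A \<subseteq> keys p" for A
    using that by induction (auto intro: assms)
  then show ?thesis using mpoly_as_sum[of p] by (metis finite_keys order_refl)
qed

lemma mpoly_induct_single [case_names zero add single]:
  fixes p :: "'b \<Rightarrow>\<^sub>0 'a::comm_monoid_add"
  assumes "P 0" "\<And>p q. P p \<Longrightarrow> P q \<Longrightarrow> P (p + q)" "\<And>m c. P (single m c)"
  shows "P p"
  using assms by (rule mpoly_induct) auto

definition eval_monom :: "(nat \<Rightarrow> 'b::comm_monoid_mult) \<Rightarrow> monom \<Rightarrow> 'b" where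
  "eval_monom a m = (\<Prod>i\<in>keys m. a i ^ lookup m i)"

lemma eval_monom_superset:
  "finite A \<Longrightarrow> keys m \<subseteq> A \<Longrightarrow> eval_monom a m = (\<Prod>i\<in>A. a i ^ lookup m i)"
  unfolding eval_monom_def by (rule prod.mono_neutral_left) (auto simp: in_keys_iff)

lemma eval_monom_add: "eval_monom a (m + m') = eval_monom a m * eval_monom a m'"
proof -
  let ?A = "keys m \<union> keys m'"
  have "eval_monom a (m + m') = (\<Prod>i\<in>?A. a i ^ lookup (m + m') i)"
    by (intro eval_monom_superset) (simp_all add: Poly_Mapping.keys_add)
  then show ?thesis
    by (simp add: eval_monom_superset[of ?A] lookup_add power_add prod.distrib)
qed

lemma eval_at_superset:
  assumes "finite A" "keys p \<subseteq> A"
  shows "eval_at a p = (\<Sum>m\<in>A. to_ac (lookup p m) * eval_monom a m)"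
  unfolding eval_at_def eval_monom_def[symmetric]
  using assms by (intro sum.mono_neutral_left) (auto simp: in_keys_iff)

lemma eval_at_single: "eval_at a (single m c) = to_ac c * eval_monom a m"
  by (subst eval_at_superset[of "{m}"]) auto

lemma eval_at_0 [simp]: "eval_at a 0 = 0"
  by (simp add: eval_at_def)

lemma eval_at_add [simp]: "eval_at a (p + q) = eval_at a p + eval_at a q"
proof -
  let ?A = "keys p \<union> keys q"
  have "eval_at a (p + q) = (\<Sum>m\<in>?A. to_ac (lookup (p + q) m) * eval_monom a m)"
    by (intro eval_at_superset) (simp_all add: Poly_Mapping.keys_add)
  then show ?thesis
    by (simp add: eval_at_superset[of ?A] lookup_add algebra_simps sum.distrib)
qed

lemma eval_at_mult [simp]: "eval_at a (p * q) = eval_at a p * eval_at a q"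
proof (induction p rule: mpoly_induct_single)
  case (single m c)
  show ?case
    by (induction q rule: mpoly_induct_single)
       (simp_all add: mult_single eval_at_single eval_monom_add distrib_left)
qed (simp_all add: distrib_right)

lemma eval_at_const: "eval_at a (single 0 c) = to_ac c"
  by (simp add: eval_at_single eval_monom_def)

lemma eval_at_1 [simp]: "eval_at a 1 = 1"
  using eval_at_const[of a 1] by simp

lemma eval_at_uminus [simp]: "eval_at a (- p) = - eval_at a p"
  using eval_at_add[of a p "- p"] by (simp add: add_eq_0_iff2 del: eval_at_add)

lemma eval_at_diff [simp]: "eval_at a (p - q) = eval_at a p - eval_at a q"
  using eval_at_add[of a p "- q"] by simp

lemma eval_at_power [simp]: "eval_at a (p ^ k) = eval_at a p ^ k"
  by (induction k) auto

lemma eval_at_sum_list [simp]: "eval_at a (sum_list ps) = (\<Sum>p\<leftarrow>ps. eval_at a p)"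
  by (induction ps) auto

lemma eval_at_prod_list [simp]: "eval_at a (prod_list ps) = (\<Prod>p\<leftarrow>ps. eval_at a p)"
  by (induction ps) auto

lemma eval_at_of_nat [simp]: "eval_at a (of_nat k) = of_nat k"
  by (induction k) auto

lemma eval_at_cong:
  assumes "\<And>i. i \<in> vars p \<Longrightarrow> a i = b i"
  shows "eval_at a p = eval_at b p"
proof -
  have "i \<in> vars p" if "m \<in> keys p" "i \<in> keys m" for m i
    using that by (auto simp: vars_def)
  then show ?thesis
    unfolding eval_at_def using assms
    by (intro sum.cong arg_cong[of _ _ "(*) _"] prod.cong) auto
qed

lemma finite_vars [simp]: "finite (vars p)"
  by (simp add: vars_def)

lemma vars_0 [simp]: "vars 0 = {}" by (simp add: vars_def)

lemma vars_single: "vars (single m c) \<subseteq> keys m"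
  by (auto simp: vars_def)

lemma vars_const [simp]: "vars (single 0 c) = {}"
  by (auto simp: vars_def)

lemma vars_1 [simp]: "vars (1 :: 'a::zero_neq_one mpoly) = {}"
  using vars_const[of "1 :: 'a"] by simp

lemma vars_add: "vars (p + q) \<subseteq> vars p \<union> vars q"
  using Poly_Mapping.keys_add[of p q] by (auto simp: vars_def)

lemma vars_uminus [simp]: "vars (- p :: 'a::ab_group_add mpoly) = vars p"
  by (simp add: vars_def)

lemma vars_diff: "vars (p - q :: 'a::ab_group_add mpoly) \<subseteq> vars p \<union> vars q"
  using vars_add[of p "- q"] by simp

lemma vars_mult: "vars (p * q) \<subseteq> vars p \<union> vars q"
proof
  fix x assume "x \<in> vars (p * q)"
  then obtain m where "m \<in> keys (p * q)" "x \<in> keys m"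
    by (auto simp: vars_def)
  then obtain m1 m2 where "m = m1 + m2" "m1 \<in> keys p" "m2 \<in> keys q"
    using keys_mult[of p q] by auto
  then show "x \<in> vars p \<union> vars q"
    using \<open>x \<in> keys m\<close> Poly_Mapping.keys_add[of m1 m2] by (auto simp: vars_def)
qed

lemma vars_empty_iff: "vars p = {} \<longleftrightarrow> (\<exists>c. p = single 0 c)"
proof
  assume *: "vars p = {}"
  have "lookup p m = 0" if "m \<noteq> 0" for m
    using * that by (auto simp: vars_def in_keys_iff)
  then have "p = single 0 (lookup p 0)"
    by (intro poly_mapping_eqI) (auto simp: lookup_single when_def)
  then show "\<exists>c. p = single 0 c" by blast
qed auto

text \<open>All polynomials, in whatever variables, have one type. The ring of polynomials in the first
  \<open>n\<close> variables, over which the inductions on \<open>n\<close> run, is a subset of it that is closed under the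
  ring operations.\<close>

definition is_subring :: "'b::comm_ring_1 set \<Rightarrow> bool" where
  "is_subring A \<longleftrightarrow> 1 \<in> A \<and> (\<forall>x\<in>A. \<forall>y\<in>A. x - y \<in> A \<and> x * y \<in> A)"

context
  fixes A :: "'b::comm_ring_1 set"
  assumes A: "is_subring A"
begin

lemma is_subring_1: "1 \<in> A" using A by (simp add: is_subring_def)
lemma is_subring_diff: "x \<in> A \<Longrightarrow> y \<in> A \<Longrightarrow> x - y \<in> A" using A by (simp add: is_subring_def)
lemma is_subring_mult: "x \<in> A \<Longrightarrow> y \<in> A \<Longrightarrow> x * y \<in> A" using A by (simp add: is_subring_def)
lemma is_subring_0: "0 \<in> A" using is_subring_diff[OF is_subring_1 is_subring_1] by simp
lemma is_subring_uminus: "x \<in> A \<Longrightarrow> - x \<in> A" using is_subring_diff[OF is_subring_0] by simp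
lemma is_subring_add: "x \<in> A \<Longrightarrow> y \<in> A \<Longrightarrow> x + y \<in> A"
  using is_subring_diff[of x "- y"] is_subring_uminus[of y] by simp
lemma is_subring_power: "x \<in> A \<Longrightarrow> x ^ k \<in> A"
  by (induction k) (auto intro: is_subring_1 is_subring_mult)
lemma is_subring_sum: "(\<And>i. i \<in> I \<Longrightarrow> f i \<in> A) \<Longrightarrow> sum f I \<in> A"
  by (induction I rule: infinite_finite_induct) (auto intro: is_subring_0 is_subring_add)
lemma is_subring_of_nat: "of_nat k \<in> A"
  by (induction k) (auto intro: is_subring_0 is_subring_1 is_subring_add)
lemma is_subring_sum_list: "set xs \<subseteq> A \<Longrightarrow> sum_list xs \<in> A"
  by (induction xs) (auto intro: is_subring_0 is_subring_add)
lemma is_subring_prod_list: "set xs \<subseteq> A \<Longrightarrow> prod_list xs \<in> A"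
  by (induction xs) (auto intro: is_subring_1 is_subring_mult)

end

lemmas is_subring_closed = is_subring_0 is_subring_1 is_subring_diff is_subring_uminus is_subring_add is_subring_mult
  is_subring_power is_subring_sum is_subring_of_nat

lemma is_subring_poly_ring: "is_subring (poly_ring n :: 'a::comm_ring_1 mpoly set)"
  unfolding is_subring_def poly_ring_def mem_Collect_eq
proof (intro conjI ballI)
  fix p q :: "'a mpoly" assume "p \<in> {p. vars p \<subseteq> {1..n}}" "q \<in> {p. vars p \<subseteq> {1..n}}"
  then have "vars p \<union> vars q \<subseteq> {1..n}" by simp
  then show "vars (p - q) \<subseteq> {1..n}" "vars (p * q) \<subseteq> {1..n}"
    using vars_diff[of p q] vars_mult[of p q] by (meson order_trans)+
qed simp

definition polys_over :: "'b::zero set \<Rightarrow> 'b poly set" where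
  "polys_over A = {U. \<forall>k. coeff U k \<in> A}"

lemma is_subring_polys_over:
  assumes "is_subring A"
  shows "is_subring (polys_over A)"
  unfolding is_subring_def polys_over_def
  by (auto simp: coeff_mult coeff_1 intro!: is_subring_closed[OF assms])

lemma monom_polys_over: "0 \<in> A \<Longrightarrow> c \<in> A \<Longrightarrow> Polynomial.monom c k \<in> polys_over A"
  by (simp add: polys_over_def)

lemma const_polys_over: "0 \<in> A \<Longrightarrow> c \<in> A \<Longrightarrow> [:c:] \<in> polys_over A"
  by (auto simp: polys_over_def coeff_pCons split: nat.splits)

lemma smult_polys_over: "is_subring A \<Longrightarrow> c \<in> A \<Longrightarrow> U \<in> polys_over A \<Longrightarrow> smult c U \<in> polys_over A"
  by (simp add: polys_over_def is_subring_mult)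

lemma pderiv_polys_over: "is_subring A \<Longrightarrow> U \<in> polys_over A \<Longrightarrow> pderiv U \<in> polys_over A"
  by (simp add: polys_over_def coeff_pderiv is_subring_closed)

lemma polys_over_poly:
  assumes "is_subring A" "U \<in> polys_over A" "x \<in> A"
  shows "poly U x \<in> A"
  unfolding poly_altdef using assms
  by (intro is_subring_sum is_subring_mult is_subring_power) (auto simp: polys_over_def)

section \<open>Multivariate polynomials as univariate polynomials\<close>

definition var :: "nat \<Rightarrow> 'a::zero_neq_one mpoly" where
  "var i = single (single i 1) 1"

lemma var_power: "var x ^ k = (single (single x k) 1 :: 'a::comm_ring_1 mpoly)"
  by (induction k) (simp_all add: var_def mult_single flip: single_add)

lemma vars_var [simp]: "vars (var i :: 'a::zero_neq_one mpoly) = {i}"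
  by (auto simp: vars_def var_def)

lemma eval_at_var [simp]: "eval_at a (var i) = a i"
  by (simp add: var_def eval_at_single eval_monom_def)

text \<open>This form makes linearity of \<open>coeff_in\<close> evident; the set of monomials summed over in the
  definition depends on \<open>p\<close>.\<close>

lemma lookup_coeff_in:
  "lookup (coeff_in x k p) m =
     (if lookup m x = 0 then lookup p (m + single x k) else 0)"
proof -
  let ?K = "{m \<in> keys p. lookup m x = k}"
  have upd: "update x 0 m' = m \<longleftrightarrow>
      lookup m x = 0 \<and> m' = m + single x k"
    if "lookup m' x = k" for m'
    using that
    by (auto simp: poly_mapping_eq_iff fun_eq_iff lookup_update lookup_add lookup_single when_def
        split: if_splits)
  have "lookup (coeff_in x k p) m =
      (\<Sum>m'\<in>?K. lookup p m' when update x 0 m' = m)"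
    by (simp add: coeff_in_def lookup_sum lookup_single)
  also have "\<dots> = (\<Sum>m'\<in>?K. if lookup m x = 0 \<and> m' = m + single x k
       then lookup p m' else 0)"
    by (rule sum.cong) (auto simp: when_def upd)
  also have "\<dots> = (if lookup m x = 0 then lookup p (m + single x k) else 0)"
  proof (cases "lookup m x = 0")
    case True
    then have "(\<Sum>m'\<in>?K. if lookup m x = 0 \<and> m' = m + single x k
       then lookup p m' else 0) =
      (\<Sum>m'\<in>?K. if m' = m + single x k then lookup p m' else 0)"
      by simp
    also have "\<dots> = (if m + single x k \<in> ?K
        then lookup p (m + single x k) else 0)"
      by (rule sum.delta) simp
    also have "\<dots> = lookup p (m + single x k)"
      using True by (simp add: in_keys_iff lookup_add)
    finally show ?thesis using True by simp
  qed simp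
  finally show ?thesis .
qed

lemma coeff_in_add: "coeff_in x k (p + q) = coeff_in x k p + coeff_in x k q"
  by (rule poly_mapping_eqI) (simp add: lookup_coeff_in lookup_add)

lemma coeff_in_0 [simp]: "coeff_in x k 0 = 0"
  by (rule poly_mapping_eqI) (simp add: lookup_coeff_in)

lemma vars_coeff_in: "vars (coeff_in x k p) \<subseteq> vars p - {x}"
  by (auto simp: vars_def in_keys_iff lookup_coeff_in lookup_add split: if_splits)

lemma coeff_in_eq_0:
  assumes "k > degree_in x p"
  shows "coeff_in x k p = 0"
proof -
  have "lookup m x \<le> degree_in x p" if "m \<in> keys p" for m
    unfolding degree_in_def using that by (intro Max_ge) auto
  then have "lookup p (m + single x k) = 0" for m
    using assms by (metis in_keys_iff leD le_add2 lookup_add lookup_single_eq order_less_le_trans)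
  then show ?thesis
    by (intro poly_mapping_eqI) (simp add: lookup_coeff_in)
qed

text \<open>The polynomial \<open>p\<close> as a polynomial in \<open>x\<close> over the ring in the other variables. Substituting
  \<open>var x\<close> takes it back to \<open>p\<close>, and evaluation of its coefficients gives \<open>subst_below\<close>.\<close>

definition upoly :: "nat \<Rightarrow> 'a::comm_monoid_add mpoly \<Rightarrow> 'a mpoly poly" where
  "upoly x p = (\<Sum>k\<le>degree_in x p. Polynomial.monom (coeff_in x k p) k)"

lemma coeff_upoly [simp]: "coeff (upoly x p) k = coeff_in x k p"
proof -
  have "coeff (upoly x p) k = (if k \<le> degree_in x p then coeff_in x k p else 0)"
    unfolding upoly_def by (simp add: coeff_sum if_distrib[of "\<lambda>f. f _"] sum.delta)
  then show ?thesis by (simp add: coeff_in_eq_0)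
qed

lemma upoly_add: "upoly x (p + q) = upoly x p + upoly x q"
  by (rule poly_eqI) (simp add: coeff_in_add)

lemma upoly_0 [simp]: "upoly x 0 = 0"
  by (rule poly_eqI) simp

lemma upoly_single:
  "upoly x (single m c) =
     Polynomial.monom (single (update x 0 m) c) (lookup m x)"
proof (rule poly_eqI, rule poly_mapping_eqI)
  fix k m'
  have "m = m' + single x k \<longleftrightarrow> update x 0 m = m' \<and> lookup m x = k"
    if "lookup m' x = 0"
    using that
    by (auto simp: poly_mapping_eq_iff fun_eq_iff lookup_update lookup_add lookup_single when_def
        split: if_splits)
  moreover have "update x 0 m = m' \<Longrightarrow> lookup m' x = 0"
    by (auto simp: lookup_update)
  ultimately show "lookup (coeff (upoly x (single m c)) k) m' =
      lookup (coeff (Polynomial.monom (single (update x 0 m) c)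
        (lookup m x)) k) m'"
    by (auto simp: lookup_coeff_in lookup_single when_def)
qed

lemma poly_upoly: "poly (upoly x p) (var x) = p"
  for p :: "'a::comm_ring_1 mpoly"
proof (induction p rule: mpoly_induct_single)
  case (single m c)
  have "update x 0 m + single x (lookup m x) = m"
    by (rule poly_mapping_eqI) (auto simp: lookup_add lookup_update lookup_single when_def)
  then show ?case by (simp add: upoly_single poly_monom var_power mult_single)
qed (simp_all add: upoly_add)

lemma upoly_monom:
  fixes c :: "'a::comm_ring_1 mpoly"
  assumes "x \<notin> vars c"
  shows "upoly x (c * var x ^ k) = Polynomial.monom c k"
proof -
  have *: "upoly x (single m d * var x ^ k) = Polynomial.monom (single m d) k"
    if "lookup m x = 0" for m and d :: 'a
  proof -
    have "update x 0 (m + single x k) = m"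
      using that
      by (intro poly_mapping_eqI) (auto simp: lookup_add lookup_update lookup_single when_def)
    then show ?thesis
      using that by (simp add: var_power mult_single upoly_single lookup_add)
  qed
  have "upoly x ((\<Sum>m\<in>K. single m (lookup c m)) * var x ^ k) =
      Polynomial.monom (\<Sum>m\<in>K. single m (lookup c m)) k"
    if "finite K" "K \<subseteq> keys c" for K
    using that
  proof induction
    case (insert m K)
    then have "lookup m x = 0"
      using assms by (auto simp: vars_def in_keys_iff)
    then show ?case
      using insert by (simp add: distrib_right upoly_add * add_monom)
  qed simp
  from this[of "keys c"] show ?thesis
    by (simp flip: mpoly_as_sum)
qed

lemma upoly_poly:
  fixes U :: "'a::comm_ring_1 mpoly poly"
  assumes "\<And>k. x \<notin> vars (coeff U k)"
  shows "upoly x (poly U (var x)) = U"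
proof -
  have "upoly x (\<Sum>k\<in>K. coeff U k * var x ^ k) = (\<Sum>k\<in>K. Polynomial.monom (coeff U k) k)"
    if "finite K" for K
    using that by induction (simp_all add: upoly_add upoly_monom assms)
  then show ?thesis
    by (simp add: poly_altdef poly_as_sum_of_monoms)
qed


lemma eval_at_poly [simp]: "eval_at a (poly U x) = poly (map_poly (eval_at a) U) (eval_at a x)"
  by (induction U) (simp_all add: map_poly_pCons)

lemma map_poly_eval_add [simp]:
  "map_poly (eval_at a) (U + V) = map_poly (eval_at a) U + map_poly (eval_at a) V"
  by (rule poly_eqI) (simp add: coeff_map_poly)

lemma map_poly_eval_diff [simp]:
  "map_poly (eval_at a) (U - V) = map_poly (eval_at a) U - map_poly (eval_at a) V"
  by (rule poly_eqI) (simp add: coeff_map_poly)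

lemma map_poly_eval_smult [simp]:
  "map_poly (eval_at a) (smult c V) = smult (eval_at a c) (map_poly (eval_at a) V)"
  by (rule poly_eqI) (simp add: coeff_map_poly)

lemma eval_at_sum: "eval_at a (sum f A) = (\<Sum>x\<in>A. eval_at a (f x))"
  by (induction A rule: infinite_finite_induct) auto

lemma map_poly_eval_mult [simp]:
  "map_poly (eval_at a) (U * V) = map_poly (eval_at a) U * map_poly (eval_at a) V"
  by (rule poly_eqI) (simp add: coeff_map_poly coeff_mult eval_at_sum)

lemma map_poly_eval_pderiv [simp]:
  "map_poly (eval_at a) (pderiv U) = pderiv (map_poly (eval_at a) U)"
  by (rule poly_eqI) (simp add: coeff_map_poly coeff_pderiv)

lemma subst_below_eq: "subst_below x a p = map_poly (eval_at a) (upoly x p)"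
proof (rule poly_eqI)
  fix k
  have "coeff (subst_below x a p) k = (if k \<le> degree_in x p then eval_at a (coeff_in x k p) else 0)"
    unfolding subst_below_def by (simp add: coeff_sum if_distrib[of "\<lambda>f. f _"] sum.delta)
  then show "coeff (subst_below x a p) k = coeff (map_poly (eval_at a) (upoly x p)) k"
    by (simp add: coeff_map_poly coeff_in_eq_0)
qed

lemma eval_at_fiber: "eval_at (a(x := z)) p = poly (subst_below x a p) z"
proof -
  have "eval_at (a(x := z)) p = eval_at (a(x := z)) (poly (upoly x p) (var x))"
    by (simp only: poly_upoly)
  also have "\<dots> = poly (map_poly (eval_at (a(x := z))) (upoly x p)) z"
    by simp
  also have "map_poly (eval_at (a(x := z))) (upoly x p) = map_poly (eval_at a) (upoly x p)"
    using vars_coeff_in by (intro poly_eqI) (fastforce simp: coeff_map_poly intro!: eval_at_cong)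
  finally show ?thesis unfolding subst_below_eq .
qed

lemma degree_upoly: "degree (upoly x p) = degree_in x p"
proof (cases "degree_in x p = 0")
  case True
  then show ?thesis using coeff_in_eq_0[of x p] by (metis coeff_upoly le_0_eq degree_le)
next
  case False
  have "degree_in x p \<in> insert 0 ((\<lambda>m. lookup m x) ` keys p)"
    unfolding degree_in_def by (rule Max_in) auto
  then obtain m where m: "m \<in> keys p" "degree_in x p = lookup m x"
    using False by auto
  have "lookup (coeff_in x (degree_in x p) p) (update x 0 m) \<noteq> 0"
  proof -
    have "update x 0 m + single x (lookup m x) = m"
      by (rule poly_mapping_eqI) (auto simp: lookup_add lookup_update lookup_single when_def)
    then show ?thesis using m by (simp add: lookup_coeff_in lookup_update in_keys_iff)
  qed
  then have "coeff (upoly x p) (degree_in x p) \<noteq> 0" by auto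
  then have "degree_in x p \<le> degree (upoly x p)" by (rule le_degree)
  moreover have "degree (upoly x p) \<le> degree_in x p"
    by (rule degree_le) (simp add: coeff_in_eq_0)
  ultimately show ?thesis by simp
qed

lemma init_eq: "init p = lead_coeff (upoly (ld p) p)"
  by (simp add: init_def rank_def degree_upoly)

lemma degree_in_pos_iff: "degree_in x p > 0 \<longleftrightarrow> x \<in> vars p"
proof -
  have "degree_in x p > 0 \<longleftrightarrow> (\<exists>d\<in>insert 0 ((\<lambda>m. lookup m x) ` keys p). d > 0)"
    unfolding degree_in_def by (rule Max_gr_iff) auto
  then show ?thesis by (auto simp: vars_def in_keys_iff)
qed

lemma poly_var_poly_ring:
  fixes U :: "'a::comm_ring_1 mpoly poly"
  assumes "U \<in> polys_over (poly_ring n)"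
  shows "upoly (Suc n) (poly U (var (Suc n))) = U" "poly U (var (Suc n)) \<in> poly_ring (Suc n)"
    "degree U > 0 \<Longrightarrow> ld (poly U (var (Suc n))) = Suc n"
proof -
  let ?p = "poly U (var (Suc n))"
  show upoly: "upoly (Suc n) ?p = U"
    using assms by (intro upoly_poly) (fastforce simp: polys_over_def poly_ring_def)
  have "U \<in> polys_over (poly_ring (Suc n))"
    using assms unfolding polys_over_def poly_ring_def by fastforce
  then show p: "?p \<in> poly_ring (Suc n)"
    by (intro polys_over_poly[OF is_subring_poly_ring]) (auto simp: poly_ring_def)
  show "ld ?p = Suc n" if "degree U > 0"
  proof -
    have "Suc n \<in> vars ?p"
      using that by (simp add: upoly degree_in_pos_iff[symmetric] degree_upoly[symmetric])
    then show ?thesis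
      using p unfolding ld_def poly_ring_def by (auto intro!: Max_eqI)
  qed
qed

lemma upoly_polys_over: "p \<in> poly_ring (Suc n) \<Longrightarrow> upoly (Suc n) p \<in> polys_over (poly_ring n)"
  using vars_coeff_in[of "Suc n" _ p] by (force simp: polys_over_def poly_ring_def)

section \<open>Hilbert's Nullstellensatz over the algebraic closure\<close>

text \<open>Multiplication by the leading coefficient of the divisor replaces its inversion, so the
  division takes place over any ring of coefficients.\<close>

lemma pseudo_division:
  fixes f h :: "'b::comm_ring_1 poly"
  assumes A: "is_subring A" and h: "h \<in> polys_over A" "h \<noteq> 0"
  shows "f \<in> polys_over A \<Longrightarrow> \<exists>k s r. s \<in> polys_over A \<and> r \<in> polys_over A \<and>
           smult (lead_coeff h ^ k) f = s * h + r \<and> (r = 0 \<or> degree r < degree h)"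
proof (induction "if f = 0 then 0 else Suc (degree f)" arbitrary: f rule: less_induct)
  case less
  note PA = is_subring_closed[OF is_subring_polys_over[OF A]]
  let ?l = "lead_coeff h"
  have l: "?l \<in> A" using h by (simp add: polys_over_def)
  show ?case
  proof (cases "f = 0 \<or> degree f < degree h")
    case True
    then show ?thesis
      using less.prems PA(1) by (intro exI[of _ 0] exI[of _ 0] exI[of _ f]) auto
  next
    case False
    define m where "m = Polynomial.monom (lead_coeff f) (degree f - degree h)"
    define f1 where "f1 = smult ?l f - m * h"
    have m: "m \<in> polys_over A"
      unfolding m_def using less.prems
      by (intro monom_polys_over) (auto simp: polys_over_def intro: is_subring_0[OF A])
    then have f1: "f1 \<in> polys_over A"
      unfolding f1_def by (intro PA smult_polys_over A l less.prems h)
    have "degree (m * h) \<le> degree f"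
      using degree_mult_le[of m h] degree_monom_le[of "lead_coeff f" "degree f - degree h"] False
      unfolding m_def by linarith
    then have "degree f1 \<le> degree f"
      unfolding f1_def by (intro degree_diff_le) (auto simp: degree_smult_le)
    moreover have "coeff f1 (degree f) = 0"
      using False unfolding f1_def m_def by (simp add: coeff_monom_mult)
    ultimately have "f1 = 0 \<or> degree f1 < degree f"
      by (rule eq_zero_or_degree_less)
    then have "(if f1 = 0 then 0 else Suc (degree f1)) < (if f = 0 then 0 else Suc (degree f))"
      using False by auto
    from less.hyps[OF this f1] obtain k s r where *: "s \<in> polys_over A" "r \<in> polys_over A"
        "smult (?l ^ k) f1 = s * h + r" "r = 0 \<or> degree r < degree h"
      by blast
    have "smult (?l ^ Suc k) f = smult (?l ^ k) f1 + smult (?l ^ k) m * h"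
      unfolding f1_def by (simp add: smult_diff_right mult.commute)
    also have "\<dots> = (s + smult (?l ^ k) m) * h + r"
      by (simp add: * distrib_right add_ac)
    finally show ?thesis
      using * by (intro exI[of _ "Suc k"] exI[of _ "s + smult (?l ^ k) m"] exI[of _ r])
        (auto intro!: PA smult_polys_over A m is_subring_power[OF A] l)
  qed
qed

definition ideal_in :: "'b::comm_ring_1 set \<Rightarrow> 'b set \<Rightarrow> bool" where
  "ideal_in B J \<longleftrightarrow> J \<subseteq> B \<and> 0 \<in> J \<and> (\<forall>x\<in>J. \<forall>y\<in>J. x + y \<in> J) \<and> (\<forall>b\<in>B. \<forall>x\<in>J. b * x \<in> J)"

definition prime_in :: "'b::comm_ring_1 set \<Rightarrow> 'b set \<Rightarrow> bool" where
  "prime_in B P \<longleftrightarrow> ideal_in B P \<and> 1 \<notin> P \<and> (\<forall>x\<in>B. \<forall>y\<in>B. x * y \<in> P \<longrightarrow> x \<in> P \<or> y \<in> P)"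

lemma ideal_inD:
  assumes "ideal_in B J"
  shows "J \<subseteq> B" "0 \<in> J" "\<And>x y. x \<in> J \<Longrightarrow> y \<in> J \<Longrightarrow> x + y \<in> J" "\<And>b x. b \<in> B \<Longrightarrow> x \<in> J \<Longrightarrow> b * x \<in> J"
  using assms unfolding ideal_in_def by blast+

lemma ideal_in_diff:
  assumes "ideal_in B J" "is_subring B" "x \<in> J" "y \<in> J"
  shows "x - y \<in> J"
  using ideal_inD(3)[OF assms(1,3) ideal_inD(4)[OF assms(1) _ assms(4), of "-1"]]
    is_subring_uminus[OF assms(2) is_subring_1[OF assms(2)]] by simp

lemma polys_over_ideal_subset:
  assumes A: "is_subring A" and J: "ideal_in (polys_over A) J"
    and "U \<in> polys_over {c \<in> A. [:c:] \<in> J}"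
  shows "U \<in> J"
proof -
  have "(\<Sum>i\<in>K. Polynomial.monom (coeff U i) i) \<in> J" if "finite K" for K
    using that
  proof induction
    case (insert i K)
    have "Polynomial.monom 1 i * [:coeff U i:] \<in> J"
      using assms(3) by (intro ideal_inD(4)[OF J] monom_polys_over is_subring_closed[OF A])
        (auto simp: polys_over_def)
    then show ?case
      using insert by (auto simp: mult.commute[of _ "[:_:]"] smult_monom intro: ideal_inD(3)[OF J])
  qed (auto simp: ideal_inD(2)[OF J])
  from this[of "{..degree U}"] show ?thesis by (simp add: poly_as_sum_of_monoms)
qed

text \<open>Terms with coefficients in \<open>N\<close> lie in the ideal. Dropping those at the top leaves a member
  of the ideal whose degree is its degree modulo \<open>N\<close>.\<close>

lemma ideal_truncate:
  fixes U :: "'b::comm_ring_1 poly"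
  assumes A: "is_subring A" and J: "ideal_in (polys_over A) J"
    and N: "N \<subseteq> {c \<in> A. [:c:] \<in> J}" "0 \<in> N"
  shows "U \<in> J \<Longrightarrow> U \<notin> polys_over N \<Longrightarrow>
    \<exists>V\<in>J. lead_coeff V \<notin> N \<and> degree V \<le> degree U"
proof (induction "degree U" arbitrary: U rule: less_induct)
  case less
  show ?case
  proof (cases "lead_coeff U \<in> N")
    case True
    define V where "V = U - Polynomial.monom (lead_coeff U) (degree U)"
    have "Polynomial.monom (lead_coeff U) (degree U) \<in> J"
      using True N by (intro polys_over_ideal_subset[OF A J] monom_polys_over)
        (auto simp: is_subring_0[OF A] ideal_inD(2)[OF J])
    then have "V \<in> J"
      unfolding V_def using ideal_in_diff[OF J is_subring_polys_over[OF A]] less.prems by blast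
    moreover have V: "V \<notin> polys_over N"
    proof
      assume *: "V \<in> polys_over N"
      have "coeff U i \<in> N" for i
      proof (cases "i = degree U")
        case False
        then have "coeff V i = coeff U i" by (simp add: V_def)
        with * show ?thesis unfolding polys_over_def by (metis mem_Collect_eq)
      qed (use True in simp)
      then show False using less.prems by (simp add: polys_over_def)
    qed
    moreover have "degree V \<le> degree U" "coeff V (degree U) = 0"
      unfolding V_def by (auto intro!: degree_diff_le degree_monom_le)
    then have "V = 0 \<or> degree V < degree U" by (rule eq_zero_or_degree_less)
    moreover have "V \<noteq> 0"
      using V N(2) by (auto simp: polys_over_def)
    ultimately show ?thesis using less.hyps[of V] by (meson order_trans less_imp_le)
  qed (use less in blast)
qed

lemma poly_nonroot_exists: "q \<noteq> 0 \<Longrightarrow> \<exists>z. poly q z \<noteq> 0"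
  for q :: "'b::{idom,ring_char_0} poly"
  using poly_all_0_iff_0 by blast

text \<open>The zeros of the elimination ideal \<open>N\<close> of a prime ideal \<open>P\<close>, except on a proper closed subset,
  extend to zeros of \<open>P\<close> at which a given \<open>f\<close> outside \<open>P\<close> does not vanish. If all coefficients of all members of
  \<open>P\<close> lie in \<open>N\<close>, then any value of the new variable that is no root of \<open>f\<close> will do. Otherwise a
  member \<open>p\<close> of \<open>P\<close> of least degree modulo \<open>N\<close> generates \<open>P\<close> up to powers of its leading
  coefficient and modulo \<open>N\<close>, so every root of the specialised \<open>p\<close> is a zero of \<open>P\<close>. In the ideal
  generated by \<open>P\<close> and \<open>f\<close> a polynomial \<open>h\<close> of least degree modulo \<open>N\<close> is constant, as otherwise it
  would be a proper common divisor of \<open>p\<close> and \<open>f\<close>; where neither this constant nor the leading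
  coefficient of \<open>p\<close> vanishes, there is a root of \<open>p\<close>, and it is no root of \<open>f\<close>.\<close>

lemma prime_extension:
  fixes A :: "'a::field_char_0 mpoly set"
  assumes A: "is_subring A" and P: "prime_in (polys_over A) P"
    and f: "f \<in> polys_over A" "f \<notin> P"
  defines "N \<equiv> {c \<in> A. [:c:] \<in> P}"
  shows "\<exists>g\<in>A - N. \<forall>a. (\<forall>c\<in>N. eval_at a c = 0) \<and> eval_at a g \<noteq> 0 \<longrightarrow>
           (\<exists>z. (\<forall>q\<in>P. poly (map_poly (eval_at a) q) z = 0) \<and> poly (map_poly (eval_at a) f) z \<noteq> 0)"
proof -
  note B = is_subring_polys_over[OF A]
  note PA = is_subring_closed[OF B]
  have I: "ideal_in (polys_over A) P" and one: "1 \<notin> P"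
    and prime: "\<And>x y. x \<in> polys_over A \<Longrightarrow> y \<in> polys_over A \<Longrightarrow> x * y \<in> P \<Longrightarrow> x \<in> P \<or> y \<in> P"
    using P unfolding prime_in_def by blast+
  have PB: "P \<subseteq> polys_over A" by (rule ideal_inD(1)[OF I])
  have N0: "0 \<in> N" using ideal_inD(2)[OF I] is_subring_0[OF A] by (simp add: N_def)
  have Nmult: "x \<in> N \<or> y \<in> N" if "x \<in> A" "y \<in> A" "x * y \<in> N" for x y
    using that prime[of "[:x:]" "[:y:]"] const_polys_over[of A] is_subring_0[OF A]
    by (auto simp: N_def mult.commute)
  have Nmult': "x * y \<in> N" if "x \<in> A" "y \<in> N" for x y
    using that ideal_inD(4)[OF I const_polys_over[OF is_subring_0[OF A] that(1)], of "[:y:]"]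
      is_subring_mult[OF A] by (auto simp: N_def mult.commute[of y])
  have Nadd: "x + y \<in> N" if "x \<in> N" "y \<in> N" for x y
    using that ideal_inD(3)[OF I, of "[:x:]" "[:y:]"] is_subring_add[OF A] by (auto simp: N_def)
  have N1: "1 \<notin> N" using one by (auto simp: N_def one_pCons)
  have Npow: "x ^ k \<notin> N" if "x \<in> A" "x \<notin> N" for x k
  proof (induction k)
    case (Suc k)
    then show ?case using Nmult[OF that(1) is_subring_power[OF A that(1)], of k] that by auto
  qed (simp add: N1)
  have Nsum: "sum F K \<in> N" if "\<And>i. i \<in> K \<Longrightarrow> F i \<in> N" for F and K :: "nat set"
    using that by (induction K rule: infinite_finite_induct) (auto intro: N0 Nadd)
  have small: "U \<in> P" if "U \<in> polys_over N" for U
    using polys_over_ideal_subset[OF A I] that by (simp add: N_def)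
  have small_mult: "U * V \<in> polys_over N" if "U \<in> polys_over A" "V \<in> polys_over N" for U V
    using that by (auto simp: polys_over_def coeff_mult intro!: Nsum Nmult')
  have small_add: "U + V \<in> polys_over N" if "U \<in> polys_over N" "V \<in> polys_over N" for U V
    using that by (auto simp: polys_over_def intro!: Nadd)
  have Ndiff: "x - y \<in> N" if "x \<in> N" "y \<in> N" for x y
    using Nadd[OF that(1) Nmult'[OF _ that(2)], of "-1"] is_subring_closed[OF A] by simp
  have vanish: "map_poly (eval_at a) U = 0" if "U \<in> polys_over N" "\<forall>c\<in>N. eval_at a c = 0" for U a
    using that by (intro poly_eqI) (auto simp: coeff_map_poly polys_over_def)
  show ?thesis
  proof (cases "\<exists>U\<in>P. U \<notin> polys_over N")
    case False
    have "f \<notin> polys_over N" using f small by blast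
    then obtain i where i: "coeff f i \<notin> N" by (auto simp: polys_over_def)
    show ?thesis
    proof (intro bexI[of _ "coeff f i"] allI impI)
      show "coeff f i \<in> A - N" using i f by (simp add: polys_over_def)
      fix a assume a: "(\<forall>c\<in>N. eval_at a c = 0) \<and> eval_at a (coeff f i) \<noteq> 0"
      then have "map_poly (eval_at a) f \<noteq> 0"
        by (metis coeff_0 coeff_map_poly eval_at_0)
      then obtain z where "poly (map_poly (eval_at a) f) z \<noteq> 0"
        using poly_nonroot_exists by blast
      moreover have "map_poly (eval_at a) q = 0" if "q \<in> P" for q
        using False that a vanish by blast
      ultimately show "\<exists>z. (\<forall>q\<in>P. poly (map_poly (eval_at a) q) z = 0) \<and> poly (map_poly (eval_at a) f) z \<noteq> 0"
        by auto
    qed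
  next
    case True
    have minimal: "\<exists>p\<in>J. lead_coeff p \<notin> N \<and> (\<forall>U\<in>J. U \<notin> polys_over N \<longrightarrow> degree p \<le> degree U)"
      if J: "ideal_in (polys_over A) J" "P \<subseteq> J" for J
    proof -
      obtain U0 where U0: "U0 \<in> J" "U0 \<notin> polys_over N" using True J by blast
      define d where "d = (LEAST d. \<exists>U\<in>J. U \<notin> polys_over N \<and> degree U = d)"
      have "\<exists>U\<in>J. U \<notin> polys_over N \<and> degree U = d"
        unfolding d_def by (rule LeastI[of _ "degree U0"]) (use U0 in blast)
      then obtain U where U: "U \<in> J" "U \<notin> polys_over N" "degree U = d" by blast
      obtain p where p: "p \<in> J" "lead_coeff p \<notin> N" "degree p \<le> degree U"
        using ideal_truncate[OF A J(1) _ N0 U(1,2)] J(2) by (auto simp: N_def)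
      have "degree p \<le> degree V" if "V \<in> J" "V \<notin> polys_over N" for V
        using p(3) U(3) that Least_le[of "\<lambda>d. \<exists>U\<in>J. U \<notin> polys_over N \<and> degree U = d" "degree V"]
        unfolding d_def by force
      with p show ?thesis by blast
    qed
    have nz: "p \<noteq> 0" if "lead_coeff p \<notin> N" for p using that N0 by auto
    have reduce: "\<exists>k s r. s \<in> polys_over A \<and> r \<in> J \<and> r \<in> polys_over N \<and> smult (lead_coeff p ^ k) q = s * p + r"
      if J: "ideal_in (polys_over A) J" and p: "p \<in> J" "lead_coeff p \<notin> N"
        and min: "\<forall>U\<in>J. U \<notin> polys_over N \<longrightarrow> degree p \<le> degree U" and q: "q \<in> J" for J p q
    proof -
      have pA: "p \<in> polys_over A" using ideal_inD(1)[OF J] p by blast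
      obtain k s r where *: "s \<in> polys_over A" "r \<in> polys_over A"
          "smult (lead_coeff p ^ k) q = s * p + r" "r = 0 \<or> degree r < degree p"
        using pseudo_division[OF A pA nz[OF p(2)], of q] ideal_inD(1)[OF J] q by blast
      have "lead_coeff p \<in> A" using pA by (simp add: polys_over_def)
      then have "[:lead_coeff p ^ k:] * q \<in> J"
        by (intro ideal_inD(4)[OF J] const_polys_over q is_subring_closed[OF A])
      moreover have "s * p \<in> J" using * ideal_inD(4)[OF J] p by blast
      ultimately have "smult (lead_coeff p ^ k) q - s * p \<in> J"
        using ideal_in_diff[OF J B] by simp
      then have "r \<in> J" using * by simp
      moreover have "r \<in> polys_over N"
        using * min \<open>r \<in> J\<close> N0 by (force simp: polys_over_def)
      ultimately show ?thesis using * by blast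
    qed
    obtain p where p: "p \<in> P" "lead_coeff p \<notin> N"
        and pmin: "\<forall>U\<in>P. U \<notin> polys_over N \<longrightarrow> degree p \<le> degree U"
      using minimal[OF I order_refl] by blast
    have pA: "p \<in> polys_over A" "lead_coeff p \<in> A" using p PB by (auto simp: polys_over_def)
    define J where "J = {u + s * f | u s. u \<in> P \<and> s \<in> polys_over A}"
    have J: "ideal_in (polys_over A) J"
      unfolding ideal_in_def
    proof (intro conjI ballI subsetI)
      show "x \<in> polys_over A" if "x \<in> J" for x
        using that PB f(1) unfolding J_def by (auto intro!: PA(5,6))
      show "0 \<in> J"
        using ideal_inD(2)[OF I] PA(1) unfolding J_def by force
      fix x y assume "x \<in> J" "y \<in> J"
      then obtain u s v t where "x = u + s * f" "y = v + t * f" "u \<in> P" "v \<in> P"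
          "s \<in> polys_over A" "t \<in> polys_over A"
        unfolding J_def by blast
      then show "x + y \<in> J"
        unfolding J_def using ideal_inD(3)[OF I] PA(5)
        by (intro CollectI exI[of _ "u + v"] exI[of _ "s + t"]) (auto simp: algebra_simps)
    next
      fix b x assume "b \<in> polys_over A" "x \<in> J"
      then obtain u s where "x = u + s * f" "u \<in> P" "s \<in> polys_over A"
        unfolding J_def by blast
      then show "b * x \<in> J"
        unfolding J_def using ideal_inD(4)[OF I] PA(6) \<open>b \<in> polys_over A\<close>
        by (intro CollectI exI[of _ "b * u"] exI[of _ "b * s"]) (auto simp: algebra_simps)
    qed
    have PJ: "P \<subseteq> J"
      unfolding J_def using PA(1) by (force intro: exI[of _ 0])
    have fJ: "f \<in> J"
      unfolding J_def using PA(2) ideal_inD(2)[OF I] by (intro CollectI exI[of _ 0] exI[of _ 1]) auto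
    obtain h where h: "h \<in> J" "lead_coeff h \<notin> N"
        and hmin: "\<forall>U\<in>J. U \<notin> polys_over N \<longrightarrow> degree h \<le> degree U"
      using minimal[OF J PJ] by blast
    have hA: "h \<in> polys_over A" "lead_coeff h \<in> A"
      using h ideal_inD(1)[OF J] by (auto simp: polys_over_def)
    have cP: "[:c:] \<in> polys_over A" if "c \<in> A" for c
      using const_polys_over[OF is_subring_0[OF A] that] .
    have degp: "degree p > 0"
    proof (rule ccontr)
      assume "\<not> degree p > 0"
      then obtain c where "p = [:c:]" by (metis degree_eq_zeroE neq0_conv)
      then show False using p pA by (simp add: N_def)
    qed
    have degh: "degree h = 0"
    proof (rule ccontr)
      assume deg: "degree h \<noteq> 0"
      obtain k s r where *: "s \<in> polys_over A" "r \<in> polys_over N"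
          "smult (lead_coeff h ^ k) p = s * h + r"
        using reduce[OF J h hmin, of p] PJ p by blast
      have "s * h = [:lead_coeff h ^ k:] * p - r" using * by simp
      then have "s * h \<in> P"
        using ideal_in_diff[OF I B ideal_inD(4)[OF I cP p(1)] small[OF *(2)]]
          is_subring_power[OF A hA(2)] by simp
      then consider "h \<in> P" | "s \<in> P" using prime *(1) hA(1) by blast
      then show False
      proof cases
        case 1
        obtain k' s' r' where **: "s' \<in> polys_over A" "r' \<in> polys_over N"
            "smult (lead_coeff h ^ k') f = s' * h + r'"
          using reduce[OF J h hmin fJ] by blast
        then have "[:lead_coeff h ^ k':] * f \<in> P"
          using ideal_inD(3)[OF I ideal_inD(4)[OF I **(1) 1] small[OF **(2)]] by simp
        then have "[:lead_coeff h ^ k':] \<in> P"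
          using prime[OF cP f(1)] f(2) is_subring_power[OF A hA(2)] by blast
        then show False
          using Npow[OF hA(2) h(2), of k'] is_subring_power[OF A hA(2), of k'] by (simp add: N_def)
      next
        case 2
        \<comment> \<open>Then \<open>s\<close> vanishes modulo \<open>N\<close>: it lies in \<open>P\<close>, so its degree modulo \<open>N\<close> would be at least
          that of \<open>p\<close>, and the product \<open>s * h\<close> would have a larger degree than \<open>p\<close>.\<close>
        have lpow: "lead_coeff h ^ k * lead_coeff p \<notin> N"
          using Nmult[OF is_subring_power[OF A hA(2)] pA(2)] Npow[OF hA(2) h(2)] p(2) by blast
        have "s \<in> polys_over N"
        proof (rule ccontr)
          assume ns: "s \<notin> polys_over N"
          define t where "t = Max {i. coeff s i \<notin> N}"
          have fin: "finite {i. coeff s i \<notin> N}"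
          proof (rule finite_subset)
            show "{i. coeff s i \<notin> N} \<subseteq> {..degree s}"
              using N0 by (metis (mono_tags, lifting) atMost_iff le_degree mem_Collect_eq subsetI)
          qed simp
          have ne: "{i. coeff s i \<notin> N} \<noteq> {}" using ns by (auto simp: polys_over_def)
          have t: "coeff s t \<notin> N" "\<And>i. i > t \<Longrightarrow> coeff s i \<in> N"
            using Max_in[OF fin ne] Max_ge[OF fin] unfolding t_def by (auto simp: not_le[symmetric])
          define V where "V = Poly (map (coeff s) [0..<Suc t])"
          have coeff_V: "coeff V i = (if i \<le> t then coeff s i else 0)" for i
            by (simp add: V_def coeff_Poly_eq nth_default_def del: upt_Suc)
          have "s - V \<in> polys_over N"
            using t(2) N0 by (auto simp: polys_over_def coeff_V)
          then have "s - (s - V) \<in> P"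
            using ideal_in_diff[OF I B 2 small] by blast
          moreover have "coeff V t \<notin> N" using t(1) coeff_V[of t] by simp
          then have "V \<notin> polys_over N" unfolding polys_over_def by blast
          ultimately have "degree p \<le> degree V" using pmin by simp
          also have "degree V \<le> t"
            by (rule degree_le) (simp add: coeff_V)
          finally have "coeff (smult (lead_coeff h ^ k) p) (t + degree h) = 0"
            using deg by (simp add: coeff_eq_0)
          moreover have "coeff (s * h) (t + degree h) =
              coeff s t * lead_coeff h + (\<Sum>i\<in>{..t + degree h} - {t}. coeff s i * coeff h (t + degree h - i))"
            unfolding coeff_mult by (subst sum.remove[of _ t]) auto
          ultimately have "coeff s t * lead_coeff h = 0 - coeff r (t + degree h)
              - (\<Sum>i\<in>{..t + degree h} - {t}. coeff s i * coeff h (t + degree h - i))"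
            unfolding * coeff_add by (simp add: algebra_simps eq_neg_iff_add_eq_0)
          also have "\<dots> \<in> N"
          proof (intro Ndiff N0 Nsum)
            show "coeff r (t + degree h) \<in> N" using *(2) by (simp add: polys_over_def)
            fix i assume i: "i \<in> {..t + degree h} - {t}"
            show "coeff s i * coeff h (t + degree h - i) \<in> N"
            proof (cases "i > t")
              case True
              then show ?thesis
                using Nmult'[of "coeff h (t + degree h - i)" "coeff s i"] t(2)[of i] hA(1)
                by (simp add: polys_over_def mult.commute)
            next
              case False
              then have "coeff h (t + degree h - i) = 0" using i by (intro coeff_eq_0) auto
              then show ?thesis using N0 by simp
            qed
          qed
          finally show False
            using Nmult[of "coeff s t" "lead_coeff h"] t(1) h(2) hA(2) *(1)
            by (simp add: polys_over_def)
        qed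
        then have "smult (lead_coeff h ^ k) p \<in> polys_over N"
          unfolding *(3) using small_add[OF small_mult[OF hA(1)] *(2)] unfolding mult.commute[of h] by blast
        then have "coeff (smult (lead_coeff h ^ k) p) (degree p) \<in> N"
          unfolding polys_over_def by blast
        with lpow show False by simp
      qed
    qed
    obtain c where hc: "h = [:c:]" using degh by (metis degree_eq_zeroE)
    have c: "c \<in> A" "c \<notin> N" using h hA hc by auto
    obtain u s where us: "h = u + s * f" "u \<in> P" "s \<in> polys_over A"
      using h(1) unfolding J_def by blast
    show ?thesis
    proof (intro bexI[of _ "lead_coeff p * c"] allI impI)
      show "lead_coeff p * c \<in> A - N"
        using Nmult[OF pA(2) c(1)] p(2) c is_subring_mult[OF A pA(2) c(1)] by blast
      fix a assume a: "(\<forall>c\<in>N. eval_at a c = 0) \<and> eval_at a (lead_coeff p * c) \<noteq> 0"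
      let ?e = "map_poly (eval_at a)"
      have "degree (?e p) = degree p"
        using a by (intro antisym map_poly_degree_leq le_degree) (simp_all add: coeff_map_poly)
      then obtain z where z: "poly (?e p) z = 0"
        using degp alg_closed_imp_poly_has_root[of "?e p"] by auto
      have zero: "poly (?e q) z = 0" if q: "q \<in> P" for q
      proof -
        obtain k s r where *: "r \<in> polys_over N" "smult (lead_coeff p ^ k) q = s * p + r"
          using reduce[OF I p pmin q] by blast
        have "?e (smult (lead_coeff p ^ k) q) = ?e s * ?e p"
          unfolding * using vanish[OF *(1)] a by simp
        then have "poly (?e (smult (lead_coeff p ^ k) q)) z = poly (?e s * ?e p) z"
          by (rule arg_cong)
        then have "eval_at a (lead_coeff p) ^ k * poly (?e q) z = 0"
          using z by simp
        then show ?thesis using a by simp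
      qed
      have "poly (?e h) z = poly (?e (u + s * f)) z" by (simp only: us(1))
      then have "eval_at a c = poly (?e u) z + poly (?e s) z * poly (?e f) z"
        by (simp add: hc map_poly_pCons)
      then have "poly (?e f) z \<noteq> 0"
        using a zero[OF us(2)] by auto
      then show "\<exists>z. (\<forall>q\<in>P. poly (?e q) z = 0) \<and> poly (?e f) z \<noteq> 0"
        using zero by blast
    qed
  qed
qed


text \<open>Induction on the number of variables: the element \<open>g\<close> from the extension lemma is the
  polynomial that the zero of the elimination ideal has to avoid. Over no variables at all a prime
  ideal of a field is zero.\<close>

lemma prime_zero:
  fixes P :: "'a::field_char_0 mpoly set"
  assumes "prime_in (poly_ring n) P" "f \<in> poly_ring n" "f \<notin> P"
  shows "\<exists>a. (\<forall>p\<in>P. eval_at a p = 0) \<and> eval_at a f \<noteq> 0"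
  using assms
proof (induction n arbitrary: P f)
  case 0
  have I: "ideal_in (poly_ring 0) P" and one: "1 \<notin> P"
    using 0 by (auto simp: prime_in_def)
  have const: "\<exists>c. p = single 0 c" if "p \<in> poly_ring 0" for p :: "'a mpoly"
    using that vars_empty_iff[of p] by (auto simp: poly_ring_def)
  have zero: "eval_at a p = 0" if p: "p \<in> P" for a p
  proof (rule ccontr)
    assume "eval_at a p \<noteq> 0"
    then have "p \<noteq> 0" by auto
    obtain c where c: "p = single 0 c"
      using const ideal_inD(1)[OF I] p by blast
    have "single 0 (inverse c) * p \<in> P"
      using ideal_inD(4)[OF I _ p] by (simp add: poly_ring_def)
    moreover have "c \<noteq> 0" using c \<open>p \<noteq> 0\<close> by auto
    ultimately show False using one c by (simp add: mult_single)
  qed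
  obtain c where c: "f = single 0 c" using const 0 by blast
  moreover have "c \<noteq> 0" using c 0 ideal_inD(2)[OF I] by auto
  ultimately have "eval_at a f \<noteq> 0" for a by (simp add: eval_at_const)
  with zero show ?case by blast
next
  case (Suc n)
  let ?x = "var (Suc n) :: 'a mpoly"
  let ?A = "poly_ring n :: 'a mpoly set"
  let ?B = "poly_ring (Suc n) :: 'a mpoly set"
  note A = is_subring_poly_ring[of n, where 'a='a]
  note B = is_subring_poly_ring[of "Suc n", where 'a='a]
  have I: "ideal_in ?B P" and one: "1 \<notin> P"
    and prime: "\<And>x y. x \<in> ?B \<Longrightarrow> y \<in> ?B \<Longrightarrow> x * y \<in> P \<Longrightarrow> x \<in> P \<or> y \<in> P"
    using Suc.prems(1) unfolding prime_in_def by blast+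
  define Q where "Q = {U \<in> polys_over ?A. poly U ?x \<in> P}"
  note PA = is_subring_closed[OF is_subring_polys_over[OF A]]
  have Q: "prime_in (polys_over ?A) Q"
    unfolding prime_in_def ideal_in_def Q_def
    by (auto simp: one PA poly_var_poly_ring ideal_inD[OF I] intro: prime dest: prime[rotated 2])
  define N where "N = {c \<in> ?A. [:c:] \<in> Q}"
  have N: "N = P \<inter> ?A"
    by (auto simp: N_def Q_def intro!: const_polys_over is_subring_0[OF A])
  have AB: "?A \<subseteq> ?B" by (auto simp: poly_ring_def)
  have primeN: "prime_in ?A N"
    unfolding prime_in_def ideal_in_def N
    using AB by (auto simp: one is_subring_closed[OF A] ideal_inD[OF I] dest: prime[rotated 2])
  have up: "upoly (Suc n) q \<in> Q" if "q \<in> P" for q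
    using that ideal_inD(1)[OF I] upoly_polys_over[of q n] by (auto simp: Q_def poly_upoly)
  have "upoly (Suc n) f \<in> polys_over ?A" "upoly (Suc n) f \<notin> Q"
    using Suc.prems upoly_polys_over[of f n] by (auto simp: Q_def poly_upoly)
  from prime_extension[OF A Q this] obtain g where g: "g \<in> ?A" "g \<notin> N" and
    ext: "\<And>a. (\<forall>c\<in>N. eval_at a c = 0) \<and> eval_at a g \<noteq> 0 \<Longrightarrow>
       \<exists>z. (\<forall>q\<in>Q. poly (map_poly (eval_at a) q) z = 0) \<and> poly (map_poly (eval_at a) (upoly (Suc n) f)) z \<noteq> 0"
    unfolding N_def by blast
  obtain a where "(\<forall>c\<in>N. eval_at a c = 0) \<and> eval_at a g \<noteq> 0"
    using Suc.IH[OF primeN g] by blast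
  from ext[OF this] obtain z where
    "\<forall>q\<in>Q. poly (map_poly (eval_at a) q) z = 0" "poly (map_poly (eval_at a) (upoly (Suc n) f)) z \<noteq> 0"
    by blast
  then have "(\<forall>q\<in>P. eval_at (a(Suc n := z)) q = 0) \<and> eval_at (a(Suc n := z)) f \<noteq> 0"
    using up unfolding eval_at_fiber subst_below_eq by blast
  then show ?case by blast
qed

text \<open>An ideal that is maximal among those that avoid a multiplicative set is prime.\<close>

lemma prime_avoiding:
  fixes B :: "'b::comm_ring_1 set"
  assumes B: "is_subring B" and J: "ideal_in B J" "J \<inter> M = {}"
    and M: "M \<subseteq> B" "1 \<in> M" "\<And>x y. x \<in> M \<Longrightarrow> y \<in> M \<Longrightarrow> x * y \<in> M"
  shows "\<exists>P. prime_in B P \<and> J \<subseteq> P \<and> P \<inter> M = {}"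
proof -
  define Fam where "Fam = {I. ideal_in B I \<and> J \<subseteq> I \<and> I \<inter> M = {}}"
  have "\<exists>P\<in>Fam. \<forall>W\<in>Fam. P \<subseteq> W \<longrightarrow> W = P"
  proof (rule subset_Zorn_nonempty)
    show "Fam \<noteq> {}" using J by (auto simp: Fam_def)
    fix C assume C: "C \<noteq> {}" "subset.chain Fam C"
    have CF: "C \<subseteq> Fam" and total: "\<And>W Y. W \<in> C \<Longrightarrow> Y \<in> C \<Longrightarrow> W \<subseteq> Y \<or> Y \<subseteq> W"
      using C(2) by (auto simp: subset.chain_def)
    have "ideal_in B (\<Union>C)"
      unfolding ideal_in_def
    proof (intro conjI ballI)
      show "\<Union>C \<subseteq> B" using CF ideal_inD(1) unfolding Fam_def by blast
      show "0 \<in> \<Union>C" using CF C(1) ideal_inD(2) unfolding Fam_def by blast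
      fix x y assume "x \<in> \<Union>C" "y \<in> \<Union>C"
      then obtain W where "W \<in> C" "x \<in> W" "y \<in> W" using total by blast
      then show "x + y \<in> \<Union>C" using CF ideal_inD(3) unfolding Fam_def by blast
    next
      fix b x assume "b \<in> B" "x \<in> \<Union>C"
      then show "b * x \<in> \<Union>C" using CF ideal_inD(4) unfolding Fam_def by blast
    qed
    then show "\<Union>C \<in> Fam" using CF C(1) unfolding Fam_def by blast
  qed
  then obtain P where P: "ideal_in B P" "J \<subseteq> P" "P \<inter> M = {}"
    and max: "\<And>W. ideal_in B W \<Longrightarrow> W \<inter> M = {} \<Longrightarrow> P \<subseteq> W \<Longrightarrow> W = P"
    unfolding Fam_def by (smt (verit) mem_Collect_eq order_trans)
  note BC = is_subring_closed[OF B]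
  have meets: "\<exists>p\<in>P. \<exists>b\<in>B. p + b * x \<in> M" if x: "x \<in> B" "x \<notin> P" for x
  proof (rule ccontr)
    assume no: "\<not> ?thesis"
    define W where "W = {p + b * x | p b. p \<in> P \<and> b \<in> B}"
    have "ideal_in B W"
      unfolding ideal_in_def
    proof (intro conjI ballI subsetI)
      show "y \<in> B" if "y \<in> W" for y
        using that x ideal_inD(1)[OF P(1)] unfolding W_def by (auto intro!: BC(5,6))
      show "0 \<in> W"
        using ideal_inD(2)[OF P(1)] BC(1) unfolding W_def by force
      fix y z assume "y \<in> W" "z \<in> W"
      then obtain p q b c where "y = p + b * x" "z = q + c * x" "p \<in> P" "q \<in> P" "b \<in> B" "c \<in> B"
        unfolding W_def by blast
      then show "y + z \<in> W"
        unfolding W_def using ideal_inD(3)[OF P(1)] BC(5)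
        by (intro CollectI exI[of _ "p + q"] exI[of _ "b + c"]) (auto simp: algebra_simps)
    next
      fix c y assume "c \<in> B" "y \<in> W"
      then obtain p b where "y = p + b * x" "p \<in> P" "b \<in> B"
        unfolding W_def by blast
      then show "c * y \<in> W"
        unfolding W_def using ideal_inD(4)[OF P(1)] BC(6) \<open>c \<in> B\<close>
        by (intro CollectI exI[of _ "c * p"] exI[of _ "c * b"]) (auto simp: algebra_simps)
    qed
    moreover have "P \<subseteq> W"
      unfolding W_def using BC(1) by (force intro: exI[of _ 0])
    moreover have "W \<inter> M = {}" using no unfolding W_def by blast
    ultimately have "W = P" using max by blast
    moreover have "x \<in> W"
      unfolding W_def using BC(2) ideal_inD(2)[OF P(1)] by (intro CollectI exI[of _ 0] exI[of _ 1]) auto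
    ultimately show False using x by simp
  qed
  have "x \<in> P \<or> y \<in> P" if xy: "x \<in> B" "y \<in> B" "x * y \<in> P" for x y
  proof (rule ccontr)
    assume "\<not> ?thesis"
    then obtain p b q c where *: "p \<in> P" "b \<in> B" "p + b * x \<in> M" "q \<in> P" "c \<in> B" "q + c * y \<in> M"
      using meets xy by meson
    have "(p + b * x) * (q + c * y) = (q + c * y) * p + (b * x) * q + (b * c) * (x * y)"
      by (simp add: algebra_simps)
    also have "\<dots> \<in> P"
    proof (intro ideal_inD(3)[OF P(1)])
      show "(q + c * y) * p \<in> P" using ideal_inD(4)[OF P(1) _ *(1)] M(1) *(6) by blast
      show "b * x * q \<in> P" by (rule ideal_inD(4)[OF P(1) BC(6)[OF *(2) xy(1)] *(4)])
      show "b * c * (x * y) \<in> P" by (rule ideal_inD(4)[OF P(1) BC(6)[OF *(2,5)] xy(3)])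
    qed
    finally show False using M(3)[OF *(3,6)] P(3) by blast
  qed
  then show ?thesis using P M(2) unfolding prime_in_def by blast
qed

text \<open>Otherwise the ideal generated by \<open>E\<close> avoids the products of elements of \<open>N\<close>, hence is
  contained in a prime ideal that avoids them, and a zero of that prime ideal at which the product of
  all of \<open>N\<close> does not vanish solves the system. The identity in the conclusion has coefficients in \<open>F\<close>
  and can be checked by computation.\<close>

theorem nullstellensatz:
  fixes E N :: "'a::field_char_0 mpoly set"
  assumes E: "E \<subseteq> poly_ring n" and N: "N \<subseteq> poly_ring n" "finite N"
    and unsolvable: "\<nexists>a. (\<forall>p\<in>E. eval_at a p = 0) \<and> (\<forall>p\<in>N. eval_at a p \<noteq> 0)"
  shows "\<exists>gs L. set gs \<subseteq> N \<and> set L \<subseteq> poly_ring n \<times> E \<and> prod_list gs = (\<Sum>(q, p)\<leftarrow>L. q * p)"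
proof (rule ccontr)
  assume no: "\<not> ?thesis"
  let ?B = "poly_ring n :: 'a mpoly set"
  note B = is_subring_poly_ring[of n, where 'a='a]
  define M where "M = {prod_list gs | gs. set gs \<subseteq> N}"
  define J where "J = {\<Sum>(q, p)\<leftarrow>L. q * p | L. set L \<subseteq> ?B \<times> E}"
  have "J \<inter> M = {}"
  proof (rule equals0I)
    fix x assume "x \<in> J \<inter> M"
    then have "x \<in> J" "x \<in> M" by simp_all
    obtain L where "x = (\<Sum>(q, p)\<leftarrow>L. q * p)" "set L \<subseteq> ?B \<times> E"
      using \<open>x \<in> J\<close> unfolding J_def by blast
    moreover obtain gs where "x = prod_list gs" "set gs \<subseteq> N"
      using \<open>x \<in> M\<close> unfolding M_def by blast
    ultimately show False using no by metis
  qed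
  moreover have "ideal_in ?B J"
    unfolding ideal_in_def
  proof (intro conjI ballI subsetI)
    fix x assume "x \<in> J"
    then obtain L where L: "x = (\<Sum>(q, p)\<leftarrow>L. q * p)" "set L \<subseteq> ?B \<times> E" unfolding J_def by blast
    show "x \<in> ?B"
      unfolding L(1) using L(2) E
      by (intro is_subring_sum_list[OF B]) (auto intro!: is_subring_mult[OF B])
  next
    show "0 \<in> J" unfolding J_def by (rule CollectI, rule exI[of _ "[]"]) simp
  next
    fix x y assume "x \<in> J" "y \<in> J"
    then obtain L L' where "x = (\<Sum>(q, p)\<leftarrow>L. q * p)" "set L \<subseteq> ?B \<times> E"
      "y = (\<Sum>(q, p)\<leftarrow>L'. q * p)" "set L' \<subseteq> ?B \<times> E" unfolding J_def by blast
    then show "x + y \<in> J" unfolding J_def by (intro CollectI exI[of _ "L @ L'"]) auto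
  next
    fix b x assume b: "b \<in> ?B" and "x \<in> J"
    then obtain L where L: "x = (\<Sum>(q, p)\<leftarrow>L. q * p)" "set L \<subseteq> ?B \<times> E" unfolding J_def by blast
    have "b * x = (\<Sum>(q, p)\<leftarrow>map (\<lambda>(q, p). (b * q, p)) L. q * p)"
      unfolding L by (induction L) (auto simp: distrib_left mult.assoc)
    moreover have "set (map (\<lambda>(q, p). (b * q, p)) L) \<subseteq> ?B \<times> E"
      using L b by (auto intro!: is_subring_mult[OF B])
    ultimately show "b * x \<in> J" unfolding J_def by blast
  qed
  moreover have "M \<subseteq> ?B"
    unfolding M_def using N by (auto intro!: is_subring_prod_list[OF B])
  moreover have "1 \<in> M" unfolding M_def by (rule CollectI, rule exI[of _ "[]"]) simp
  moreover have "x * y \<in> M" if "x \<in> M" "y \<in> M" for x y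
  proof -
    obtain gs hs where "x = prod_list gs" "y = prod_list hs" "set gs \<subseteq> N" "set hs \<subseteq> N"
      using \<open>x \<in> M\<close> \<open>y \<in> M\<close> unfolding M_def by blast
    then show ?thesis unfolding M_def by (intro CollectI exI[of _ "gs @ hs"]) auto
  qed
  ultimately obtain P where P: "prime_in ?B P" "J \<subseteq> P" "P \<inter> M = {}"
    using prime_avoiding[OF B, of J M] by blast
  obtain ns where ns: "set ns = N" using N finite_list by blast
  have "prod_list ns \<in> M" unfolding M_def using ns by blast
  then have "prod_list ns \<in> ?B" "prod_list ns \<notin> P" using P(3) \<open>M \<subseteq> ?B\<close> by blast+
  from prime_zero[OF P(1) this] obtain a where
    a: "\<forall>p\<in>P. eval_at a p = 0" "eval_at a (prod_list ns) \<noteq> 0" by blast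
  have "p \<in> J" if "p \<in> E" for p
  proof -
    have "p = (\<Sum>(q, p)\<leftarrow>[(1, p)]. q * p)" "set [(1, p)] \<subseteq> ?B \<times> E"
      using that is_subring_1[OF B] by simp_all
    then show ?thesis unfolding J_def by blast
  qed
  then have "\<forall>p\<in>E. eval_at a p = 0" using a P(2) by blast
  moreover have "\<forall>p\<in>N. eval_at a p \<noteq> 0"
    using a(2) ns by (auto simp: prod_list_zero_iff)
  ultimately show False using unsolvable by blast
qed

section \<open>Square-free parts of univariate polynomials\<close>

lemma squarefree_iff_no_common_root:
  fixes p :: "'b::alg_closed_field poly"
  shows "squarefree p \<longleftrightarrow> (\<nexists>z. poly p z = 0 \<and> poly (pderiv p) z = 0)"
proof
  assume sq: "squarefree p"
  show "\<nexists>z. poly p z = 0 \<and> poly (pderiv p) z = 0"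
  proof
    assume "\<exists>z. poly p z = 0 \<and> poly (pderiv p) z = 0"
    then obtain z where z: "poly p z = 0" "poly (pderiv p) z = 0" by blast
    then obtain q where q: "p = [:- z, 1:] * q" by (auto simp: poly_eq_0_iff_dvd)
    have "pderiv p = [:- z, 1:] * pderiv q + q * pderiv [:- z, 1:]"
      unfolding q by (rule pderiv_mult)
    with z(2) have "poly q z = 0" by (simp add: pderiv_pCons)
    then obtain r where "q = [:- z, 1:] * r" by (auto simp: poly_eq_0_iff_dvd)
    then have "p = [:- z, 1:] ^ 2 * r" unfolding q power2_eq_square by (simp only: mult.assoc)
    then have "[:- z, 1:] ^ 2 dvd p" by (rule dvdI)
    then have "is_unit [:- z, 1:]" using sq by (auto simp: squarefree_def)
    then show False by (auto simp: is_unit_poly_iff)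
  qed
next
  assume no: "\<nexists>z. poly p z = 0 \<and> poly (pderiv p) z = 0"
  show "squarefree p"
  proof (rule squarefreeI)
    fix d assume "d ^ 2 dvd p"
    then obtain q where "p = d ^ 2 * q" ..
    then have q: "p = d * (d * q)" by (simp only: power2_eq_square mult.assoc)
    show "is_unit d"
    proof (rule ccontr)
      assume nu: "\<not> is_unit d"
      have "d \<noteq> 0" using no q by auto
      then have "degree d > 0"
        using nu by (metis degree_eq_zeroE gr0I is_unit_const_poly_iff dvd_field_iff pCons_0_0)
      then obtain z where "poly d z = 0" using alg_closed_imp_poly_has_root by blast
      then have "poly p z = 0" "poly (pderiv p) z = 0"
        by (simp_all add: q pderiv_mult)
      then show False using no by blast
    qed
  qed
qed

lemma squarefree_dvd_smult:
  fixes p s :: "'b::field poly"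
  assumes "squarefree p" "s dvd smult c p" "c \<noteq> 0"
  shows "squarefree s"
  using assms by (meson dvd_smult_cancel dvd_trans squarefree_def)

text \<open>A relation in place of the normalised \<open>gcd\<close>: pseudo-division determines a greatest common
  divisor only up to a unit that depends on the point, and what the proofs use is the Bezout
  identity.\<close>

definition is_gcd_poly :: "'b::comm_ring_1 poly \<Rightarrow> 'b poly \<Rightarrow> 'b poly \<Rightarrow> bool" where
  "is_gcd_poly g p q \<longleftrightarrow> g dvd p \<and> g dvd q \<and> (\<exists>u v. g = u * p + v * q)"

lemma is_gcd_poly_0: "is_gcd_poly p p 0"
  unfolding is_gcd_poly_def by (auto intro: exI[of _ 1])

lemma is_gcd_poly_step:
  fixes p q r s g :: "'b::field poly"
  assumes "smult c p = s * q + r" "c \<noteq> 0" "is_gcd_poly g q r"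
  shows "is_gcd_poly g p q"
proof -
  obtain u v where g: "g = u * q + v * r" and "g dvd q" "g dvd r"
    using assms(3) unfolding is_gcd_poly_def by blast
  then have "g dvd smult c p" unfolding assms(1) by simp
  then have "g dvd p" using assms(2) by (rule dvd_smult_cancel)
  moreover have "smult c v * p = v * (s * q + r)" unfolding assms(1)[symmetric] by simp
  then have "g = smult c v * p + (u - v * s) * q"
    unfolding g by (simp add: algebra_simps)
  ultimately show ?thesis using \<open>g dvd q\<close> unfolding is_gcd_poly_def by blast
qed

lemma is_gcd_poly_root:
  assumes "is_gcd_poly g p q"
  shows "poly g z = 0 \<longleftrightarrow> poly p z = 0 \<and> poly q z = 0"
proof -
  obtain u v where "g = u * p + v * q" "g dvd p" "g dvd q"
    using assms unfolding is_gcd_poly_def by blast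
  then show ?thesis
    using poly_eq_0_iff_dvd by (metis add.right_neutral dvd_trans mult_zero_right poly_add poly_mult)
qed

lemma squarefree_part:
  fixes p g s :: "'b::{alg_closed_field,field_char_0} poly"
  assumes p: "p \<noteq> 0" and g: "is_gcd_poly g p (pderiv p)" and s: "s * g = smult c p" "c \<noteq> 0"
  shows "squarefree s" "poly s z = 0 \<longleftrightarrow> poly p z = 0"
proof -
  have "squarefree s \<and> (\<forall>z. poly s z = 0 \<longleftrightarrow> poly p z = 0)"
  proof (cases "pderiv p = 0")
    case True
    then obtain h where h: "p = [:h:]" using pderiv_iszero by blast
    then have "degree (s * g) = 0" "s * g \<noteq> 0" using p s by auto
    then have "degree s = 0" "s \<noteq> 0" by (auto simp: degree_mult_eq)
    then obtain k where "s = [:k:]" "k \<noteq> 0" by (metis degree_eq_zeroE pCons_0_0)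
    then show ?thesis using h p by (simp add: squarefree_iff_no_common_root)
  next
    case False
    obtain u v e where u: "g = u * p + v * pderiv p" and e: "pderiv p = g * e"
      using g unfolding is_gcd_poly_def by blast
    have "rsquarefree s \<and> (\<forall>z. poly s z = 0 \<longleftrightarrow> poly (smult c p) z = 0)"
    proof (rule poly_squarefree_decomp)
      show "pderiv (smult c p) \<noteq> 0" using False s(2) by (simp add: pderiv_smult)
      show "smult c p = s * g" using s(1) by simp
      show "pderiv (smult c p) = smult c e * g" by (simp add: pderiv_smult e mult.commute)
      show "g = smult (inverse c) u * smult c p + smult (inverse c) v * pderiv (smult c p)"
        using s(2) by (subst u) (simp add: pderiv_smult)
    qed
    then show ?thesis
      using s(2) by (simp add: rsquarefree_roots squarefree_iff_no_common_root)
  qed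
  then show "squarefree s" "poly s z = 0 \<longleftrightarrow> poly p z = 0" by blast+
qed

lemma remove_roots:
  fixes p g s h :: "'b::alg_closed_field poly"
  assumes p: "squarefree p" and g: "is_gcd_poly g p h" and s: "s * g = smult c p" "c \<noteq> 0"
  shows "squarefree s" "poly s z = 0 \<longleftrightarrow> poly p z = 0 \<and> poly h z \<noteq> 0"
proof -
  show "squarefree s"
    using p s by (intro squarefree_dvd_smult[OF p _ s(2)]) (metis dvd_triv_left)
  have sg: "poly s z * poly g z = c * poly p z"
    using s(1) by (metis poly_mult poly_smult)
  have "\<not> (poly s z = 0 \<and> poly g z = 0)"
  proof
    assume "poly s z = 0 \<and> poly g z = 0"
    then have "[:- z, 1:] ^ 2 dvd smult c p"
      unfolding s(1)[symmetric] power2_eq_square by (intro mult_dvd_mono) (auto simp: poly_eq_0_iff_dvd)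
    then have "is_unit [:- z, 1:]"
      using p dvd_smult_cancel[OF _ s(2)] unfolding squarefree_def by blast
    then show False by (auto simp: is_unit_poly_iff)
  qed
  then show "poly s z = 0 \<longleftrightarrow> poly p z = 0 \<and> poly h z \<noteq> 0"
    using sg is_gcd_poly_root[OF g, of z] s(2) by auto
qed

section \<open>Case distinctions over parameters\<close>

text \<open>Finitely many tests whether a polynomial of \<open>A\<close> vanishes divide the points of \<open>G\<close> into cases,
  in each of which one object \<open>u\<close> satisfies \<open>Q a u\<close> for all points \<open>a\<close> of the case. The case
  distinctions form a monad: once \<open>u\<close> is fixed, further tests may depend on it.\<close>

inductive by_cases ::
    "'a::field mpoly set \<Rightarrow> 'u set \<Rightarrow> ('a point \<Rightarrow> 'u \<Rightarrow> bool) \<Rightarrow> 'a point set \<Rightarrow> bool"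
  for A U Q where
  leaf: "u \<in> U \<Longrightarrow> (\<And>a. a \<in> G \<Longrightarrow> Q a u) \<Longrightarrow> by_cases A U Q G"
| split: "p \<in> A \<Longrightarrow> by_cases A U Q (G \<inter> {a. eval_at a p = 0}) \<Longrightarrow>
    by_cases A U Q (G \<inter> {a. eval_at a p \<noteq> 0}) \<Longrightarrow> by_cases A U Q G"

lemma by_cases_bind:
  assumes "by_cases A U Q G"
    and "\<And>u H. u \<in> U \<Longrightarrow> H \<subseteq> G \<Longrightarrow> (\<And>a. a \<in> H \<Longrightarrow> Q a u) \<Longrightarrow> by_cases A U' Q' H"
  shows "by_cases A U' Q' G"
  using assms
proof induction
  case (leaf u G)
  show ?case using leaf.hyps by (intro leaf.prems) auto
next
  case (split p G)
  show ?case
  proof (rule by_cases.split[OF split.hyps(1)])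
    show "by_cases A U' Q' (G \<inter> {a. eval_at a p = 0})"
      by (rule split.IH(1), rule split.prems) auto
    show "by_cases A U' Q' (G \<inter> {a. eval_at a p \<noteq> 0})"
      by (rule split.IH(2), rule split.prems) auto
  qed
qed

abbreviation spec :: "'a point \<Rightarrow> 'a::field mpoly poly \<Rightarrow> 'a alg_closure poly" where
  "spec a \<equiv> map_poly (eval_at a)"

text \<open>For a regular polynomial specialisation preserves the degree and the test for zero.\<close>

definition regular :: "'a point \<Rightarrow> 'a::field mpoly poly \<Rightarrow> bool" where
  "regular a V \<longleftrightarrow> V = 0 \<or> eval_at a (lead_coeff V) \<noteq> 0"

definition poly_size :: "'b::zero poly \<Rightarrow> nat" where
  "poly_size U = (if U = 0 then 0 else Suc (degree U))"

lemma regular_degree: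
  assumes "regular a V"
  shows "degree (spec a V) = degree V"
proof (cases "V = 0")
  case False
  then show ?thesis
    using assms unfolding regular_def
    by (intro antisym map_poly_degree_leq le_degree) (simp_all add: coeff_map_poly)
qed (simp only: map_poly_0 degree_0)

lemma regular_eq_0_iff:
  assumes "regular a V"
  shows "spec a V = 0 \<longleftrightarrow> V = 0"
proof
  assume "spec a V = 0"
  then have "eval_at a (lead_coeff V) = 0" by (metis coeff_0 coeff_map_poly eval_at_0)
  then show "V = 0" using assms by (simp add: regular_def)
next
  assume "V = 0"
  then show "spec a V = 0" by (simp only: map_poly_0)
qed

context
  fixes A :: "'a::field_char_0 mpoly set"
  assumes A: "is_subring A"
begin

abbreviation poly_cases :: "('a point \<Rightarrow> 'a mpoly poly \<Rightarrow> bool) \<Rightarrow> 'a point set \<Rightarrow> bool" where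
  "poly_cases \<equiv> by_cases A (polys_over A)"

text \<open>A leading coefficient that vanishes is dropped, and the next one is tested.\<close>

lemma by_cases_regular:
  "U \<in> polys_over A \<Longrightarrow>
     poly_cases (\<lambda>a V. poly_size V \<le> poly_size U \<and> spec a V = spec a U \<and> regular a V) G"
proof (induction "poly_size U" arbitrary: U G rule: less_induct)
  case (less U G)
  show ?case
  proof (cases "U = 0")
    case True
    then show ?thesis
      using less.prems by (intro by_cases.leaf[of U]) (simp_all add: regular_def)
  next
    case False
    define V where "V = U - Polynomial.monom (lead_coeff U) (degree U)"
    have V: "V \<in> polys_over A"
      unfolding V_def using less.prems is_subring_0[OF A]
      by (intro is_subring_diff[OF is_subring_polys_over[OF A]] monom_polys_over) (auto simp: polys_over_def)
    have "degree V \<le> degree U" "coeff V (degree U) = 0"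
      unfolding V_def by (auto intro!: degree_diff_le degree_monom_le)
    then have "V = 0 \<or> degree V < degree U" by (rule eq_zero_or_degree_less)
    then have lt: "poly_size V < poly_size U" using False by (auto simp: poly_size_def)
    let ?Q = "\<lambda>a V. poly_size V \<le> poly_size U \<and> spec a V = spec a U \<and> regular a V"
    have eq: "spec a V = spec a U" if "eval_at a (lead_coeff U) = 0" for a
      using that by (simp add: V_def map_poly_monom)
    have "poly_cases ?Q (G \<inter> {a. eval_at a (lead_coeff U) = 0})"
    proof (rule by_cases_bind[OF less.hyps[OF lt V]])
      fix W H assume "W \<in> polys_over A" and H: "H \<subseteq> G \<inter> {a. eval_at a (lead_coeff U) = 0}"
        and W: "\<And>a. a \<in> H \<Longrightarrow> poly_size W \<le> poly_size V \<and> spec a W = spec a V \<and> regular a W"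
      show "poly_cases ?Q H"
      proof (rule by_cases.leaf[OF \<open>W \<in> polys_over A\<close>])
        fix a assume "a \<in> H"
        then show "?Q a W" using W[of a] H eq[of a] lt by auto
      qed
    qed
    moreover have "poly_cases ?Q (G \<inter> {a. eval_at a (lead_coeff U) \<noteq> 0})"
      using less.prems by (intro by_cases.leaf[of U]) (auto simp: regular_def)
    moreover have "lead_coeff U \<in> A" using less.prems by (simp add: polys_over_def)
    ultimately show ?thesis by (rule by_cases.split[rotated])
  qed
qed

text \<open>The Euclidean algorithm with pseudo-division. All leading coefficients that are divided by
  are nonzero on the respective case.\<close>

lemma by_cases_gcd:
  "p \<in> polys_over A \<Longrightarrow> q \<in> polys_over A \<Longrightarrow>
     poly_cases (\<lambda>a V. is_gcd_poly (spec a V) (spec a p) (spec a q)) G"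
proof (induction "poly_size q" arbitrary: p q G rule: less_induct)
  case (less q p G)
  let ?Q = "\<lambda>a V. is_gcd_poly (spec a V) (spec a p) (spec a q)"
  show ?case
  proof (rule by_cases_bind[OF by_cases_regular[OF less.prems(2)]])
    fix V H assume V: "V \<in> polys_over A"
      and *: "\<And>a. a \<in> H \<Longrightarrow> poly_size V \<le> poly_size q \<and> spec a V = spec a q \<and> regular a V"
    show "poly_cases ?Q H"
      \<comment> \<open>On an empty case nothing is known about the size of \<open>V\<close>, and any polynomial will do.\<close>
    proof (cases "V = 0 \<or> H = {}")
      case True
      then have "spec a q = 0" if "a \<in> H" for a using *[OF that] that by auto
      then show ?thesis
        using less.prems by (intro by_cases.leaf[of p]) (simp_all add: is_gcd_poly_0)
    next
      case False
      obtain k s r where r: "r \<in> polys_over A" "smult (lead_coeff V ^ k) p = s * V + r"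
          "r = 0 \<or> degree r < degree V"
        using pseudo_division[OF A V _ less.prems(1)] False by metis
      obtain a\<^sub>0 where "a\<^sub>0 \<in> H" using False by auto
      then have "poly_size V \<le> poly_size q" using * by blast
      then have "poly_size r < poly_size q"
        using False r(3) by (auto simp: poly_size_def split: if_splits)
      from less.hyps[OF this V r(1)] show ?thesis
      proof (rule by_cases_bind)
        fix W K assume "W \<in> polys_over A" and K: "K \<subseteq> H"
          and W: "\<And>a. a \<in> K \<Longrightarrow> is_gcd_poly (spec a W) (spec a V) (spec a r)"
        show "poly_cases ?Q K"
        proof (rule by_cases.leaf[OF \<open>W \<in> polys_over A\<close>])
          fix a assume a: "a \<in> K"
          have "spec a (smult (lead_coeff V ^ k) p) = spec a (s * V + r)" using r(2) by simp
          then have "smult (eval_at a (lead_coeff V) ^ k) (spec a p) = spec a s * spec a V + spec a r"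
            by simp
          moreover have "eval_at a (lead_coeff V) ^ k \<noteq> 0"
            using * a K False by (auto simp: regular_def)
          ultimately have "is_gcd_poly (spec a W) (spec a p) (spec a V)"
            using W[OF a] by (rule is_gcd_poly_step)
          moreover have "spec a V = spec a q" using * a K by blast
          ultimately show "?Q a W" by simp
        qed
      qed
    qed
  qed
qed

text \<open>The remainder of the pseudo-division vanishes on all points of the case, since its degree is
  below that of the specialised divisor, which divides it.\<close>

lemma by_cases_quotient:
  assumes "p \<in> polys_over A" "g \<in> polys_over A" "\<And>a. a \<in> G \<Longrightarrow> spec a g dvd spec a p"
  shows "poly_cases (\<lambda>a s. spec a g \<noteq> 0 \<longrightarrow>
           (\<exists>c. c \<noteq> 0 \<and> spec a s * spec a g = smult c (spec a p))) G"
    (is "poly_cases ?Q G")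
proof (rule by_cases_bind[OF by_cases_regular[OF assms(2)]])
  fix V H assume V: "V \<in> polys_over A" and H: "H \<subseteq> G"
    and *: "\<And>a. a \<in> H \<Longrightarrow> poly_size V \<le> poly_size g \<and> spec a V = spec a g \<and> regular a V"
  show "poly_cases ?Q H"
  proof (cases "V = 0")
    case True
    then have "spec a g = 0" if "a \<in> H" for a using *[OF that] by simp
    then show ?thesis by (intro by_cases.leaf[OF V]) auto
  next
    case False
    obtain k s r where r: "s \<in> polys_over A" "smult (lead_coeff V ^ k) p = s * V + r"
        "r = 0 \<or> degree r < degree V"
      using pseudo_division[OF A V False assms(1)] by blast
    have "\<exists>c. c \<noteq> 0 \<and> spec a s * spec a g = smult c (spec a p)" if a: "a \<in> H" for a
    proof (intro exI[of _ "eval_at a (lead_coeff V) ^ k"] conjI)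
      show "eval_at a (lead_coeff V) ^ k \<noteq> 0"
        using *[OF a] False by (auto simp: regular_def)
      have "spec a (smult (lead_coeff V ^ k) p) = spec a (s * V + r)" using r(2) by simp
      then have eq: "smult (eval_at a (lead_coeff V) ^ k) (spec a p) = spec a s * spec a V + spec a r"
        by simp
      moreover have dvd: "spec a V dvd spec a p" using * a H assms(3) by auto
      ultimately have "spec a V dvd spec a r"
        by (metis dvd_add_right_iff dvd_smult dvd_triv_right)
      moreover have "spec a r = 0 \<or> degree (spec a r) < degree (spec a V)"
      proof (cases "r = 0")
        case False
        then have "degree (spec a r) < degree V"
          using r(3) map_poly_degree_leq[of "eval_at a" r] by simp
        then show ?thesis using *[OF a] regular_degree[of a V] by simp
      qed simp
      ultimately have "spec a r = 0" using dvd_imp_degree_le by (metis leD)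
      then show "spec a s * spec a g = smult (eval_at a (lead_coeff V) ^ k) (spec a p)"
        using eq * a by simp
    qed
    then show ?thesis by (intro by_cases.leaf[OF r(1)]) blast
  qed
qed

lemma by_cases_gcd_quotient:
  assumes "p \<in> polys_over A" "q \<in> polys_over A"
  shows "poly_cases (\<lambda>a s. spec a p \<noteq> 0 \<longrightarrow> (\<exists>g c. is_gcd_poly g (spec a p) (spec a q) \<and>
           c \<noteq> 0 \<and> spec a s * g = smult c (spec a p))) G"
    (is "poly_cases ?Q G")
proof (rule by_cases_bind[OF by_cases_gcd[OF assms]])
  fix g H assume gA: "g \<in> polys_over A"
    and g: "\<And>a. a \<in> H \<Longrightarrow> is_gcd_poly (spec a g) (spec a p) (spec a q)"
  show "poly_cases ?Q H"
  proof (rule by_cases_bind[OF by_cases_quotient[OF assms(1) gA]])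
    show "spec a g dvd spec a p" if "a \<in> H" for a using g[OF that] by (simp add: is_gcd_poly_def)
    fix s K assume "s \<in> polys_over A" and K: "K \<subseteq> H" and s: "\<And>a. a \<in> K \<Longrightarrow> spec a g \<noteq> 0 \<longrightarrow>
      (\<exists>c. c \<noteq> 0 \<and> spec a s * spec a g = smult c (spec a p))"
    show "poly_cases ?Q K"
    proof (rule by_cases.leaf[OF \<open>s \<in> polys_over A\<close>], rule impI)
      fix a assume a: "a \<in> K" and "spec a p \<noteq> 0"
      then have gcd: "is_gcd_poly (spec a g) (spec a p) (spec a q)" using g K by blast
      then have "spec a g \<noteq> 0" using \<open>spec a p \<noteq> 0\<close> by (auto simp: is_gcd_poly_def)
      then show "\<exists>g c. is_gcd_poly g (spec a p) (spec a q) \<and> c \<noteq> 0 \<and> spec a s * g = smult c (spec a p)"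
        using s[OF a] gcd by blast
    qed
  qed
qed

lemma by_cases_squarefree:
  assumes "p \<in> polys_over A"
  shows "poly_cases (\<lambda>a s. spec a p \<noteq> 0 \<longrightarrow>
           squarefree (spec a s) \<and> (\<forall>z. poly (spec a s) z = 0 \<longleftrightarrow> poly (spec a p) z = 0)) G"
    (is "poly_cases ?Q G")
proof (rule by_cases_bind[OF by_cases_gcd_quotient[OF assms pderiv_polys_over[OF A assms]]])
  fix s H assume "s \<in> polys_over A" and s: "\<And>a. a \<in> H \<Longrightarrow> spec a p \<noteq> 0 \<longrightarrow>
    (\<exists>g c. is_gcd_poly g (spec a p) (spec a (pderiv p)) \<and> c \<noteq> 0 \<and> spec a s * g = smult c (spec a p))"
  show "poly_cases ?Q H"
  proof (rule by_cases.leaf[OF \<open>s \<in> polys_over A\<close>], rule impI)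
    fix a assume "a \<in> H" and nz: "spec a p \<noteq> 0"
    then obtain g c where "is_gcd_poly g (spec a p) (pderiv (spec a p))" "c \<noteq> 0"
      "spec a s * g = smult c (spec a p)"
      using s[OF \<open>a \<in> H\<close>] unfolding map_poly_eval_pderiv by blast
    then show "squarefree (spec a s) \<and> (\<forall>z. poly (spec a s) z = 0 \<longleftrightarrow> poly (spec a p) z = 0)"
      using squarefree_part[OF nz] by blast
  qed
qed

lemma by_cases_remove_roots:
  assumes "p \<in> polys_over A" "h \<in> polys_over A" "\<And>a. a \<in> G \<Longrightarrow> spec a p \<noteq> 0 \<Longrightarrow> squarefree (spec a p)"
  shows "poly_cases (\<lambda>a s. spec a p \<noteq> 0 \<longrightarrow> squarefree (spec a s) \<and>
           (\<forall>z. poly (spec a s) z = 0 \<longleftrightarrow> poly (spec a p) z = 0 \<and> poly (spec a h) z \<noteq> 0)) G"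
    (is "poly_cases ?Q G")
proof (rule by_cases_bind[OF by_cases_gcd_quotient[OF assms(1,2)]])
  fix s H assume "s \<in> polys_over A" and H: "H \<subseteq> G" and s: "\<And>a. a \<in> H \<Longrightarrow> spec a p \<noteq> 0 \<longrightarrow>
    (\<exists>g c. is_gcd_poly g (spec a p) (spec a h) \<and> c \<noteq> 0 \<and> spec a s * g = smult c (spec a p))"
  show "poly_cases ?Q H"
  proof (rule by_cases.leaf[OF \<open>s \<in> polys_over A\<close>], rule impI)
    fix a assume a: "a \<in> H" and nz: "spec a p \<noteq> 0"
    then have "squarefree (spec a p)" using assms(3) H by blast
    then show "squarefree (spec a s) \<and>
        (\<forall>z. poly (spec a s) z = 0 \<longleftrightarrow> poly (spec a p) z = 0 \<and> poly (spec a h) z \<noteq> 0)"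
      using s[OF a] nz remove_roots by blast
  qed
qed

lemma by_cases_common_roots:
  "set ps \<subseteq> polys_over A \<Longrightarrow>
     poly_cases (\<lambda>a V. \<forall>z. poly (spec a V) z = 0 \<longleftrightarrow> (\<forall>p\<in>set ps. poly (spec a p) z = 0)) G"
proof (induction ps arbitrary: G)
  case Nil
  then show ?case
    using is_subring_0[OF is_subring_polys_over[OF A]] by (intro by_cases.leaf[of 0]) auto
next
  case (Cons p ps)
  let ?Q = "\<lambda>a V. \<forall>z. poly (spec a V) z = 0 \<longleftrightarrow> (\<forall>p\<in>set (p # ps). poly (spec a p) z = 0)"
  from Cons have p: "p \<in> polys_over A" "set ps \<subseteq> polys_over A" by auto
  show ?case
  proof (rule by_cases_bind[OF Cons.IH[OF p(2)]])
    fix V H assume VA: "V \<in> polys_over A"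
      and V: "\<And>a. a \<in> H \<Longrightarrow> \<forall>z. poly (spec a V) z = 0 \<longleftrightarrow> (\<forall>p\<in>set ps. poly (spec a p) z = 0)"
    show "poly_cases ?Q H"
    proof (rule by_cases_bind[OF by_cases_gcd[OF p(1) VA]])
      fix W K assume "W \<in> polys_over A" and K: "K \<subseteq> H"
        and W: "\<And>a. a \<in> K \<Longrightarrow> is_gcd_poly (spec a W) (spec a p) (spec a V)"
      show "poly_cases ?Q K"
      proof (rule by_cases.leaf[OF \<open>W \<in> polys_over A\<close>])
        fix a assume a: "a \<in> K"
        then show "?Q a W" using is_gcd_poly_root[OF W[OF a]] V[of a] K by auto
      qed
    qed
  qed
qed

text \<open>The fiber of an algebraic system above a point is given by a single equation or a single
  inequation in the last variable, which is square-free. The equations have the same common roots as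
  their greatest common divisor \<open>e\<close>. If \<open>e\<close> is nonzero, the roots of the product \<open>h\<close> of the left-hand
  sides of the inequations are divided out of its square-free part; otherwise the fiber consists of
  the nonroots of the square-free part of \<open>h\<close>. The tag \<open>b\<close> distinguishes the two forms.\<close>

lemma by_cases_fiber:
  assumes "set es \<subseteq> polys_over A" "h \<in> polys_over A"
  shows "by_cases A (UNIV \<times> polys_over A) (\<lambda>a (b, V). regular a V \<and> (V \<noteq> 0 \<longrightarrow> squarefree (spec a V)) \<and>
     (\<forall>z. (\<forall>p\<in>set es. poly (spec a p) z = 0) \<and> poly (spec a h) z \<noteq> 0 \<longleftrightarrow> (poly (spec a V) z = 0 \<longleftrightarrow> b))) G"
    (is "by_cases A ?U ?Q G")
proof -
  have finish: "by_cases A ?U ?Q H"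
    if "V \<in> polys_over A" and "\<And>a. a \<in> H \<Longrightarrow> (spec a V \<noteq> 0 \<longrightarrow> squarefree (spec a V)) \<and>
     (\<forall>z. (\<forall>p\<in>set es. poly (spec a p) z = 0) \<and> poly (spec a h) z \<noteq> 0 \<longleftrightarrow> (poly (spec a V) z = 0 \<longleftrightarrow> b))"
    for V b H
  proof (rule by_cases_bind[OF by_cases_regular[OF that(1)]])
    fix W K assume WA: "W \<in> polys_over A" and K: "K \<subseteq> H"
      and W: "\<And>a. a \<in> K \<Longrightarrow> poly_size W \<le> poly_size V \<and> spec a W = spec a V \<and> regular a W"
    show "by_cases A ?U ?Q K"
    proof (rule by_cases.leaf[of "(b, W)"])
      fix a assume a: "a \<in> K"
      then have "W \<noteq> 0 \<longrightarrow> spec a V \<noteq> 0" using W[OF a] regular_eq_0_iff[of a W] by simp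
      then show "?Q a (b, W)" using W[OF a] that(2)[of a] a K by auto
    qed (use WA in simp)
  qed
  show ?thesis
  proof (rule by_cases_bind[OF by_cases_common_roots[OF assms(1)]])
    fix e0 H0 assume e0A: "e0 \<in> polys_over A"
      and e0: "\<And>a. a \<in> H0 \<Longrightarrow> \<forall>z. poly (spec a e0) z = 0 \<longleftrightarrow> (\<forall>p\<in>set es. poly (spec a p) z = 0)"
    show "by_cases A ?U ?Q H0"
    proof (rule by_cases_bind[OF by_cases_regular[OF e0A]])
      fix e H assume eA: "e \<in> polys_over A" and H: "H \<subseteq> H0"
        and e': "\<And>a. a \<in> H \<Longrightarrow> poly_size e \<le> poly_size e0 \<and> spec a e = spec a e0 \<and> regular a e"
      have e: "(\<forall>p\<in>set es. poly (spec a p) z = 0) \<longleftrightarrow> poly (spec a e) z = 0" if "a \<in> H" for a z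
        using e'[OF that] e0[of a] H that by auto
      show "by_cases A ?U ?Q H"
      proof (cases "e = 0")
        case True
        then have e0: "\<forall>p\<in>set es. poly (spec a p) z = 0" if "a \<in> H" for a z
          using e[OF that] by simp
        show ?thesis
        proof (rule by_cases_bind[OF by_cases_regular[OF assms(2)]])
          fix k K assume kA: "k \<in> polys_over A" and K: "K \<subseteq> H"
            and k: "\<And>a. a \<in> K \<Longrightarrow> poly_size k \<le> poly_size h \<and> spec a k = spec a h \<and> regular a k"
          show "by_cases A ?U ?Q K"
          proof (cases "k = 0")
            case True
            then have "spec a h = 0" if "a \<in> K" for a using k[OF that] by simp
            \<comment> \<open>The fiber is empty, like the zero set of the constant \<open>1\<close>.\<close>
            then show ?thesis
              using is_subring_1[OF is_subring_polys_over[OF A]] by (intro finish[of 1 _ True]) auto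
          next
            case False
            then have nz: "spec a k \<noteq> 0" if "a \<in> K" for a
              using k[OF that] regular_eq_0_iff by blast
            show ?thesis
            proof (rule by_cases_bind[OF by_cases_squarefree[OF kA]])
              fix s L assume sA: "s \<in> polys_over A" and L: "L \<subseteq> K"
                and s: "\<And>a. a \<in> L \<Longrightarrow> spec a k \<noteq> 0 \<longrightarrow> squarefree (spec a s) \<and>
                  (\<forall>z. poly (spec a s) z = 0 \<longleftrightarrow> poly (spec a k) z = 0)"
              show "by_cases A ?U ?Q L"
              proof (rule finish[OF sA, of _ False])
                fix a assume a: "a \<in> L"
                then have "a \<in> K" "a \<in> H" using L K by blast+
                then show "(spec a s \<noteq> 0 \<longrightarrow> squarefree (spec a s)) \<and>
                  (\<forall>z. (\<forall>p\<in>set es. poly (spec a p) z = 0) \<and> poly (spec a h) z \<noteq> 0 \<longleftrightarrow>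
                     (poly (spec a s) z = 0 \<longleftrightarrow> False))"
                  using s[OF a] nz k e0 by auto
              qed
            qed
          qed
        qed
      next
        case False
        then have nz: "spec a e \<noteq> 0" if "a \<in> H" for a
          using e'[OF that] regular_eq_0_iff by blast
        show ?thesis
        proof (rule by_cases_bind[OF by_cases_squarefree[OF eA]])
          fix s K assume sA: "s \<in> polys_over A" and K: "K \<subseteq> H"
            and s: "\<And>a. a \<in> K \<Longrightarrow> spec a e \<noteq> 0 \<longrightarrow> squarefree (spec a s) \<and>
              (\<forall>z. poly (spec a s) z = 0 \<longleftrightarrow> poly (spec a e) z = 0)"
          have sq: "squarefree (spec a s)" if "a \<in> K" for a
            using s[OF that] nz[of a] K that by blast
          show "by_cases A ?U ?Q K"
          proof (rule by_cases_bind[OF by_cases_remove_roots[OF sA assms(2) sq]])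
            fix t L assume tA: "t \<in> polys_over A" and L: "L \<subseteq> K"
              and t: "\<And>a. a \<in> L \<Longrightarrow> spec a s \<noteq> 0 \<longrightarrow> squarefree (spec a t) \<and>
                (\<forall>z. poly (spec a t) z = 0 \<longleftrightarrow> poly (spec a s) z = 0 \<and> poly (spec a h) z \<noteq> 0)"
            show "by_cases A ?U ?Q L"
            proof (rule finish[OF tA, of _ True])
              fix a assume a: "a \<in> L"
              then have "a \<in> K" "a \<in> H" using L K by blast+
              have "spec a s \<noteq> 0" using sq[OF \<open>a \<in> K\<close>] by auto
              then show "(spec a t \<noteq> 0 \<longrightarrow> squarefree (spec a t)) \<and>
                (\<forall>z. (\<forall>p\<in>set es. poly (spec a p) z = 0) \<and> poly (spec a h) z \<noteq> 0 \<longleftrightarrow>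
                   (poly (spec a t) z = 0 \<longleftrightarrow> True))"
                using t[OF a] s[OF \<open>a \<in> K\<close>] nz[OF \<open>a \<in> H\<close>] e[OF \<open>a \<in> H\<close>] by auto
            qed
          qed
        qed
      qed
    qed
  qed
qed

end

section \<open>Existence of Thomas decompositions\<close>

text \<open>Points assign values to all variables, so that the same point can be used for a system and
  for its subsystems in fewer variables.\<close>

definition holds :: "'a point \<Rightarrow> 'a::field system \<Rightarrow> bool" where
  "holds a S \<longleftrightarrow> (\<forall>p. Eqn p \<in> S \<longrightarrow> eval_at a p = 0) \<and> (\<forall>p. Ineqn p \<in> S \<longrightarrow> eval_at a p \<noteq> 0)"

lemma Sol_eq: "Sol V S = {a \<in> V \<rightarrow>\<^sub>E UNIV. holds a S}"
  by (auto simp: Sol_def holds_def)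

lemma holds_empty [simp]: "holds a {}"
  by (simp add: holds_def)

lemma holds_insert [simp]:
  "holds a (insert (Eqn p) S) \<longleftrightarrow> eval_at a p = 0 \<and> holds a S"
  "holds a (insert (Ineqn p) S) \<longleftrightarrow> eval_at a p \<noteq> 0 \<and> holds a S"
  by (auto simp: holds_def)

lemma holds_Un [simp]: "holds a (S \<union> T) \<longleftrightarrow> holds a S \<and> holds a T"
  by (auto simp: holds_def)

lemma holds_subset: "holds a T \<Longrightarrow> S \<subseteq> T \<Longrightarrow> holds a S"
  by (auto simp: holds_def)

definition disjoint_systems :: "'a::field system \<Rightarrow> 'a system \<Rightarrow> bool" where
  "disjoint_systems S T \<longleftrightarrow> (\<forall>a. \<not> (holds a S \<and> holds a T))"

text \<open>Each case is the solution set of a system: the tests on the way to it are added as an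
  equation or as an inequation.\<close>

lemma by_cases_leaves:
  assumes "by_cases (poly_ring n) U Q G"
  shows "alg_system n T \<Longrightarrow> G = {a. holds a T} \<Longrightarrow>
    \<exists>L. (\<forall>(T', u)\<in>set L. u \<in> U \<and> alg_system n T' \<and> (\<forall>a. holds a T' \<longrightarrow> Q a u)) \<and>
      (\<forall>a. holds a T \<longleftrightarrow> (\<exists>(T', u)\<in>set L. holds a T')) \<and>
      sorted_wrt (\<lambda>x y. disjoint_systems (fst x) (fst y)) L"
  using assms
proof (induction arbitrary: T rule: by_cases.induct)
  case (leaf u G T)
  then show ?case by (intro exI[of _ "[(T, u)]"]) auto
next
  case (split p G T)
  have "alg_system n (insert (Eqn p) T)" "G \<inter> {a. eval_at a p = 0} = {a. holds a (insert (Eqn p) T)}"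
    using split.hyps(1) split.prems by (auto simp: alg_system_def)
  from split.IH(1)[OF this] obtain L1 where
    L1: "\<forall>(T', u)\<in>set L1. u \<in> U \<and> alg_system n T' \<and> (\<forall>a. holds a T' \<longrightarrow> Q a u)"
      "\<And>a. holds a (insert (Eqn p) T) \<longleftrightarrow> (\<exists>(T', u)\<in>set L1. holds a T')"
      "sorted_wrt (\<lambda>x y. disjoint_systems (fst x) (fst y)) L1"
    by blast
  have "alg_system n (insert (Ineqn p) T)" "G \<inter> {a. eval_at a p \<noteq> 0} = {a. holds a (insert (Ineqn p) T)}"
    using split.hyps(1) split.prems by (auto simp: alg_system_def)
  from split.IH(2)[OF this] obtain L2 where
    L2: "\<forall>(T', u)\<in>set L2. u \<in> U \<and> alg_system n T' \<and> (\<forall>a. holds a T' \<longrightarrow> Q a u)"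
      "\<And>a. holds a (insert (Ineqn p) T) \<longleftrightarrow> (\<exists>(T', u)\<in>set L2. holds a T')"
      "sorted_wrt (\<lambda>x y. disjoint_systems (fst x) (fst y)) L2"
    by blast
  have "disjoint_systems (fst x) (fst y)" if x: "x \<in> set L1" and y: "y \<in> set L2" for x y
    unfolding disjoint_systems_def
  proof (intro allI notI)
    fix a assume *: "holds a (fst x) \<and> holds a (fst y)"
    have "holds a (insert (Eqn p) T)" unfolding L1(2) using * x by (auto simp: case_prod_beta)
    moreover have "holds a (insert (Ineqn p) T)" unfolding L2(2) using * y by (auto simp: case_prod_beta)
    ultimately show False by simp
  qed
  then have "sorted_wrt (\<lambda>x y. disjoint_systems (fst x) (fst y)) (L1 @ L2)"
    using L1(3) L2(3) by (auto simp: sorted_wrt_append)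
  moreover have "holds a T \<longleftrightarrow> (\<exists>(T', u)\<in>set (L1 @ L2). holds a T')" for a
  proof -
    have "holds a T \<longleftrightarrow> holds a (insert (Eqn p) T) \<or> holds a (insert (Ineqn p) T)" by auto
    then show ?thesis unfolding L1(2) L2(2) by auto
  qed
  moreover have "\<forall>(T', u)\<in>set (L1 @ L2). u \<in> U \<and> alg_system n T' \<and> (\<forall>a. holds a T' \<longrightarrow> Q a u)"
    using L1(1) L2(1) by auto
  ultimately show ?case by blast
qed

text \<open>A Thomas decomposition in terms of points; \<open>sorted_wrt\<close> expresses disjointness in a form that
  is compatible with the concatenation of lists.\<close>

definition decomposition :: "nat \<Rightarrow> 'a::field system \<Rightarrow> 'a system list \<Rightarrow> bool" where
  "decomposition n S Ss \<longleftrightarrow> (\<forall>T\<in>set Ss. simple_system n T) \<and>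
     (\<forall>a. holds a S \<longleftrightarrow> (\<exists>T\<in>set Ss. holds a T)) \<and> sorted_wrt disjoint_systems Ss"

lemma decomposition_imp_thomas:
  assumes "decomposition n S Ss"
  shows "thomas_decomposition n S Ss"
  unfolding thomas_decomposition_def
proof (intro conjI allI impI)
  show "\<forall>T\<in>set Ss. simple_system n T" "Sol {1..n} S = (\<Union>T\<in>set Ss. Sol {1..n} T)"
    using assms by (auto simp: decomposition_def Sol_eq)
  fix i j assume ij: "i < length Ss" "j < length Ss" "i \<noteq> j"
  have less: "disjoint_systems (Ss ! i) (Ss ! j)" if "i < j" "j < length Ss" for i j
    using assms that by (auto simp: decomposition_def sorted_wrt_iff_nth_less)
  show "Sol {1..n} (Ss ! i) \<inter> Sol {1..n} (Ss ! j) = {}"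
    using less[of i j] less[of j i] ij by (auto simp: disjoint_systems_def Sol_eq neq_iff)
qed

lemma alg_system_ld:
  assumes "alg_system n S" "c \<in> S"
  shows "ld (lhs c) \<le> n"
proof -
  have "vars (lhs c) \<subseteq> {1..n}" using assms by (auto simp: alg_system_def poly_ring_def)
  then show ?thesis by (auto simp: ld_def)
qed

lemma ld_const [simp]: "ld (single 0 c) = 0"
  by (simp add: ld_def)

lemma simple_system_mono:
  assumes "simple_system n T" "n \<le> m"
  shows "simple_system m T"
proof -
  have T: "alg_system n T" using assms by (simp add: simple_system_def)
  then have "alg_system m T"
    using assms(2) by (force simp: alg_system_def poly_ring_def)
  moreover have empty: "sys_at T i = {}" if "i > n" for i
    using alg_system_ld[OF T] that by (fastforce simp: sys_at_def)
  moreover have "card (sys_at T i) \<le> 1" if "i \<in> {1..m}" for i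
    using assms that empty[of i] by (cases "i \<le> n") (auto simp: simple_system_def)
  moreover have "i \<in> {1..n}" if "i \<in> {1..m}" "c \<in> sys_at T i" for i c
    using that empty[of i] by (cases "i \<le> n") auto
  ultimately show ?thesis
    using assms(1) unfolding simple_system_def by blast
qed

lemma simple_system_insert:
  fixes T :: "'a::field_char_0 system"
  assumes T: "simple_system n T" and V: "V \<in> polys_over (poly_ring n)" "degree V > 0"
    and reg: "\<And>a. holds a T \<Longrightarrow> eval_at a (lead_coeff V) \<noteq> 0 \<and> squarefree (spec a V)"
    and c: "c = Eqn (poly V (var (Suc n))) \<or> c = Ineqn (poly V (var (Suc n)))"
  shows "simple_system (Suc n) (insert c T)"
proof -
  let ?p = "poly V (var (Suc n))"
  note p = poly_var_poly_ring[OF V(1)]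
  have lc: "lhs c = ?p" using c by auto
  then have ldc: "ld (lhs c) = Suc n" using p(3)[OF V(2)] by simp
  have algT: "alg_system n T" using T by (simp add: simple_system_def)
  have T': "simple_system (Suc n) T" using simple_system_mono[OF T] by simp
  have "alg_system (Suc n) (insert c T)"
    using T' p(2) lc by (auto simp: simple_system_def alg_system_def)
  moreover have ldT: "ld (lhs d) \<le> n" if "d \<in> T" for d
    using alg_system_ld[OF algT that] .
  have at: "sys_at (insert c T) (Suc n) = {c}" "i \<le> n \<Longrightarrow> sys_at (insert c T) i = sys_at T i" for i
    using ldT ldc by (auto simp: sys_at_def) (metis not_less_eq_eq order_refl)+
  have below: "i \<le> Suc n \<Longrightarrow> sys_below (insert c T) i = sys_below T i" for i
    using ldc by (auto simp: sys_below_def)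
  have belowT: "sys_below T (Suc n) = T"
    using ldT by (auto simp: sys_below_def less_Suc_eq_le)
  have "card (sys_at (insert c T) i) \<le> 1" if "i \<in> {1..Suc n}" for i
    using that at T by (cases "i = Suc n") (auto simp: simple_system_def)
  moreover have "Eqn (single 0 k) \<notin> insert c T \<and> Ineqn (single 0 k) \<notin> insert c T" for k
    using T ldc by (auto simp: simple_system_def)
  moreover have "eval_at a (init (lhs d)) \<noteq> 0 \<and> squarefree (subst_below i a (lhs d))"
    if i: "i \<in> {1..Suc n}" and d: "d \<in> sys_at (insert c T) i"
      and a: "a \<in> Sol {1..<i} (sys_below (insert c T) i)" for i d a
  proof (cases "i = Suc n")
    case True
    then have "d = c" using d at by simp
    have "holds a T" using a below[of i] True belowT by (simp add: Sol_eq)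
    then show ?thesis
      unfolding \<open>d = c\<close> init_eq subst_below_eq ldc True unfolding lc p(1) using reg by blast
  next
    case False
    then have "i \<in> {1..n}" "i \<le> n" using i by auto
    moreover have "d \<in> sys_at T i" "a \<in> Sol {1..<i} (sys_below T i)"
      using d a at(2)[of i] below[of i] \<open>i \<le> n\<close> by auto
    ultimately show ?thesis
      using T unfolding simple_system_def by blast
  qed
  ultimately show ?thesis unfolding simple_system_def by blast
qed


lemma sorted_wrt_concat_map:
  assumes "sorted_wrt R xs" "\<And>x. x \<in> set xs \<Longrightarrow> sorted_wrt R' (f x)"
    and "\<And>x y u v. x \<in> set xs \<Longrightarrow> y \<in> set xs \<Longrightarrow> R x y \<Longrightarrow> u \<in> set (f x) \<Longrightarrow> v \<in> set (f y) \<Longrightarrow> R' u v"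
  shows "sorted_wrt R' (concat (map f xs))"
  using assms
proof (induction xs)
  case (Cons x xs)
  have "sorted_wrt R' (concat (map f xs))"
  proof (rule Cons.IH)
    show "sorted_wrt R xs" using Cons.prems(1) by simp
    show "sorted_wrt R' (f y)" if "y \<in> set xs" for y using Cons.prems(2) that by simp
    show "R' u v" if "y \<in> set xs" "z \<in> set xs" "R y z" "u \<in> set (f y)" "v \<in> set (f z)" for y z u v
      using Cons.prems(3)[of y z u v] that by simp
  qed
  moreover have "R' u v" if "u \<in> set (f x)" "v \<in> set (concat (map f xs))" for u v
  proof -
    obtain y where y: "y \<in> set xs" "v \<in> set (f y)" using \<open>v \<in> _\<close> by auto
    then show ?thesis using Cons.prems(1) Cons.prems(3)[of x y u v] that(1) by simp
  qed
  ultimately show ?case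
    using Cons.prems(2)[of x] by (simp add: sorted_wrt_append)
qed simp

lemma poly_spec_prod_list: "poly (spec a (prod_list us)) z = (\<Prod>u\<leftarrow>us. poly (spec a u) z)"
  by (induction us) (simp_all add: map_poly_1)

lemma simple_system_empty: "simple_system n {}"
  by (simp add: simple_system_def alg_system_def sys_at_def)

text \<open>Induction on the number of variables. The case distinction on the fibers gives finitely many
  systems \<open>T\<close> in the smaller variables, each with one constraint for the last variable, and each \<open>T\<close>
  has a decomposition by induction. A constraint whose polynomial has degree \<open>0\<close> is true or false
  throughout the case; in the first case it is dropped, in the second case the systems below it are.\<close>

theorem decomposition_exists:
  fixes S :: "'a::field_char_0 system"
  shows "alg_system n S \<Longrightarrow> \<exists>Ss. decomposition n S Ss"
proof (induction n arbitrary: S)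
  case 0
  have "eval_at a p = eval_at b p" if "Eqn p \<in> S \<or> Ineqn p \<in> S" for a b p
  proof -
    have "vars p \<subseteq> {1..0}"
      using that 0 by (force simp: alg_system_def poly_ring_def)
    then show ?thesis by (intro eval_at_cong) auto
  qed
  then have const: "holds a S \<longleftrightarrow> holds b S" for a b
    unfolding holds_def by metis
  show ?case
  proof (cases "holds undefined S")
    case True
    then show ?thesis
      using const[of _ undefined]
      by (intro exI[of _ "[{}]"]) (simp add: decomposition_def simple_system_empty)
  next
    case False
    then show ?thesis
      using const[of _ undefined] by (intro exI[of _ "[]"]) (simp add: decomposition_def)
  qed
next
  case (Suc n)
  let ?A = "poly_ring n :: 'a mpoly set"
  let ?x = "var (Suc n) :: 'a mpoly"
  note A = is_subring_poly_ring[of n, where 'a='a]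
  have fin: "finite S" and S: "\<And>c. c \<in> S \<Longrightarrow> lhs c \<in> poly_ring (Suc n)"
    using Suc.prems by (auto simp: alg_system_def)
  have "finite (lhs ` S)" using fin by simp
  then have "finite {p. Eqn p \<in> S}" "finite {p. Ineqn p \<in> S}"
    by (rule finite_subset[rotated]; force)+
  then obtain ps qs where ps: "set ps = {p. Eqn p \<in> S}" and qs: "set qs = {p. Ineqn p \<in> S}"
    using finite_list by metis
  define es where "es = map (upoly (Suc n)) ps"
  define h where "h = prod_list (map (upoly (Suc n)) qs)"
  have es: "set es \<subseteq> polys_over ?A"
    using S ps by (force simp: es_def intro!: upoly_polys_over)
  have h: "h \<in> polys_over ?A"
    unfolding h_def using S qs
    by (intro is_subring_prod_list[OF is_subring_polys_over[OF A]]) (force intro!: upoly_polys_over)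
  have holds_S: "holds (a(Suc n := z)) S \<longleftrightarrow>
      (\<forall>p\<in>set es. poly (spec a p) z = 0) \<and> poly (spec a h) z \<noteq> 0" for a z
    using ps qs unfolding holds_def eval_at_fiber subst_below_eq es_def h_def poly_spec_prod_list
    by (auto simp: prod_list_zero_iff)
  have "alg_system n ({} :: 'a system)" by (simp add: alg_system_def)
  from by_cases_leaves[OF by_cases_fiber[OF A es h] this] obtain L where
    L: "\<And>T b V. (T, b, V) \<in> set L \<Longrightarrow> alg_system n T"
      "\<And>T b V a. (T, b, V) \<in> set L \<Longrightarrow> holds a T \<Longrightarrow> regular a V \<and>
         (V \<noteq> 0 \<longrightarrow> squarefree (spec a V)) \<and>
         (\<forall>z. (\<forall>p\<in>set es. poly (spec a p) z = 0) \<and> poly (spec a h) z \<noteq> 0 \<longleftrightarrow> (poly (spec a V) z = 0 \<longleftrightarrow> b))"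
    and LV: "\<And>T b V. (T, b, V) \<in> set L \<Longrightarrow> V \<in> polys_over ?A"
    and L_ex: "\<And>a. \<exists>x\<in>set L. holds a (fst x)"
    and L_disj: "sorted_wrt (\<lambda>x y. disjoint_systems (fst x) (fst y)) L"
    by (fastforce simp: case_prod_beta)
  have "\<exists>Ss. decomposition n (fst x) Ss" if "x \<in> set L" for x
    using L(1) that Suc.IH by (metis prod.collapse)
  then obtain D where D: "\<And>x. x \<in> set L \<Longrightarrow> decomposition n (fst x) (D x)" by metis
  define f where "f x = (let b = fst (snd x); V = snd (snd x) in
     if degree V = 0 then (if V = 0 \<longleftrightarrow> b then D x else [])
     else map (insert ((if b then Eqn else Ineqn) (poly V ?x))) (D x))" for x
  have sub: "\<exists>U\<in>set (D x). U \<subseteq> W" if "W \<in> set (f x)" for x W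
    using that by (auto simp: f_def Let_def split: if_splits)
  have holds_T: "holds a (fst x)" if "x \<in> set L" "W \<in> set (f x)" "holds a W" for x W a
    using sub[OF that(2)] D[OF that(1)] holds_subset[OF that(3)] unfolding decomposition_def by blast
  have simple: "simple_system (Suc n) W" if x: "x \<in> set L" and W: "W \<in> set (f x)" for x W
  proof -
    obtain T b V where [simp]: "x = (T, b, V)" by (cases x)
    have sD: "simple_system n U" if "U \<in> set (D x)" for U
      using D[OF x] that by (simp add: decomposition_def)
    show ?thesis
    proof (cases "degree V = 0")
      case True
      then have "W \<in> set (D x)" using W by (auto simp: f_def split: if_splits)
      then show ?thesis using sD simple_system_mono[of n W "Suc n"] by simp
    next
      case False
      then obtain U where U: "U \<in> set (D x)" "W = insert ((if b then Eqn else Ineqn) (poly V ?x)) U"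
        using W by (auto simp: f_def)
      have UT: "holds a T" if "holds a U" for a
        using D[OF x] U(1) that by (auto simp: decomposition_def)
      have "V \<in> polys_over ?A" using LV x by simp
      moreover have "eval_at a (lead_coeff V) \<noteq> 0 \<and> squarefree (spec a V)" if "holds a U" for a
        using L(2)[of T b V a] UT[OF that] x False by (auto simp: regular_def)
      ultimately show ?thesis
        unfolding U(2) using False by (intro simple_system_insert[OF sD[OF U(1)], of V]) auto
    qed
  qed
  have cover: "(\<exists>W\<in>set (f x). holds a W) \<longleftrightarrow> holds a S" if x: "x \<in> set L" "holds a (fst x)" for x a
  proof -
    obtain T b V where [simp]: "x = (T, b, V)" by (cases x)
    have "holds a S \<longleftrightarrow> holds (a(Suc n := a (Suc n))) S" by (simp only: fun_upd_triv)
    also have "\<dots> \<longleftrightarrow> (poly (spec a V) (a (Suc n)) = 0 \<longleftrightarrow> b)"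
      unfolding holds_S using L(2)[of T b V a] x by simp
    finally have S: "holds a S \<longleftrightarrow> (poly (spec a V) (a (Suc n)) = 0 \<longleftrightarrow> b)" .
    have DT: "\<exists>U\<in>set (D x). holds a U" using D[OF x(1)] x(2) by (simp add: decomposition_def)
    show ?thesis
    proof (cases "degree V = 0")
      case True
      then obtain v where v: "V = [:v:]" by (metis degree_eq_zeroE)
      have "poly (spec a V) (a (Suc n)) = 0 \<longleftrightarrow> V = 0"
        using L(2)[of T b V a] x v by (auto simp: regular_def map_poly_pCons)
      then show ?thesis using S DT True by (auto simp: f_def)
    next
      case False
      have "eval_at a (poly V ?x) = poly (spec a V) (a (Suc n))" by simp
      then show ?thesis
        using S DT False unfolding f_def by (cases b) (auto simp del: eval_at_poly)
    qed
  qed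
  have disj: "sorted_wrt disjoint_systems (f x)" if x: "x \<in> set L" for x
  proof -
    have sD: "sorted_wrt disjoint_systems (D x)" using D[OF x] by (simp add: decomposition_def)
    have "sorted_wrt (\<lambda>U U'. disjoint_systems (insert c U) (insert c U')) (D x)" for c
      by (rule sorted_wrt_mono_rel[OF _ sD])
         (meson disjoint_systems_def holds_subset subset_insertI)
    then show ?thesis using sD by (auto simp: f_def Let_def sorted_wrt_map)
  qed
  have "sorted_wrt disjoint_systems (concat (map f L))"
  proof (rule sorted_wrt_concat_map[OF L_disj disj])
    fix x y U W
    assume "x \<in> set L" "y \<in> set L" "disjoint_systems (fst x) (fst y)" "U \<in> set (f x)" "W \<in> set (f y)"
    then show "disjoint_systems U W" using holds_T unfolding disjoint_systems_def by blast
  qed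
  moreover have "holds a S \<longleftrightarrow> (\<exists>W\<in>set (concat (map f L)). holds a W)" for a
  proof -
    obtain x where x: "x \<in> set L" "holds a (fst x)" using L_ex by blast
    have "(\<exists>W\<in>set (concat (map f L)). holds a W) \<longleftrightarrow> (\<exists>y\<in>set L. holds a (fst y) \<and> (\<exists>W\<in>set (f y). holds a W))"
      using holds_T by (auto; blast)
    also have "\<dots> \<longleftrightarrow> holds a S" using cover x by blast
    finally show ?thesis by simp
  qed
  ultimately have "decomposition (Suc n) S (concat (map f L))"
    using simple unfolding decomposition_def by auto
  then show ?case by blast
qed

section \<open>Polynomials as lists of terms\<close>

text \<open>A polynomial is computed with as a list of terms, each a coefficient with the exponents of
  \<open>x\<^sub>1,\<dots>,x\<^sub>n\<close>; position \<open>i\<close> of the exponents belongs to the variable of index \<open>Suc i\<close>. In a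
  constraint the tag \<open>True\<close> stands for an inequation.\<close>

type_synonym 'a tpoly = "('a \<times> nat list) list"
type_synonym 'a tsystem = "(bool \<times> 'a tpoly) list"

definition exponents :: "nat list \<Rightarrow> monom" where
  "exponents es = Poly_Mapping.nth (0 # es)"

definition poly_of :: "'a::comm_monoid_add tpoly \<Rightarrow> 'a mpoly" where
  "poly_of ts = (\<Sum>t\<leftarrow>ts. single (exponents (snd t)) (fst t))"

definition wf_poly :: "nat \<Rightarrow> 'a tpoly \<Rightarrow> bool" where
  "wf_poly n ts \<longleftrightarrow> (\<forall>t\<in>set ts. length (snd t) = n)"

definition constr_of :: "bool \<times> 'a::comm_monoid_add tpoly \<Rightarrow> 'a mpoly constr" where
  "constr_of c = (if fst c then Ineqn else Eqn) (poly_of (snd c))"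

abbreviation sys_of :: "'a::comm_monoid_add tsystem \<Rightarrow> 'a system" where
  "sys_of T \<equiv> constr_of ` set T"

definition wf_sys :: "nat \<Rightarrow> 'a tsystem \<Rightarrow> bool" where
  "wf_sys n T \<longleftrightarrow> (\<forall>c\<in>set T. wf_poly n (snd c))"

definition expo :: "nat \<Rightarrow> 'a \<times> nat list \<Rightarrow> nat" where
  "expo i t = nth_default 0 (snd t) i"

definition coeff_sum :: "'a::comm_monoid_add tpoly \<Rightarrow> nat list \<Rightarrow> 'a" where
  "coeff_sum p es = fold (\<lambda>t acc. if snd t = es then fst t + acc else acc) p 0"

definition same_poly :: "'a::comm_monoid_add tpoly \<Rightarrow> 'a tpoly \<Rightarrow> bool" where
  "same_poly p q \<longleftrightarrow> (\<forall>t\<in>set (p @ q). coeff_sum p (snd t) = coeff_sum q (snd t))"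

definition mult_term :: "nat \<Rightarrow> 'a::times \<times> nat list \<Rightarrow> 'a \<times> nat list \<Rightarrow> 'a \<times> nat list" where
  "mult_term n s t = (fst s * fst t, map (\<lambda>j. expo j s + expo j t) [0..<n])"

definition mult_tpoly :: "nat \<Rightarrow> 'a::times tpoly \<Rightarrow> 'a tpoly \<Rightarrow> 'a tpoly" where
  "mult_tpoly n p q = concat (map (\<lambda>s. map (\<lambda>t. mult_term n s t) q) p)"

definition one_tpoly :: "nat \<Rightarrow> 'a::one tpoly" where
  "one_tpoly n = [(1, map (\<lambda>_. 0) [0..<n])]"

definition prod_tpolys :: "nat \<Rightarrow> 'a::{times,one} tpoly list \<Rightarrow> 'a tpoly" where
  "prod_tpolys n ps = fold (\<lambda>p acc. mult_tpoly n p acc) ps (one_tpoly n)"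

text \<open>Exponents act on coefficients by repeated addition, since a computable field comes with
  programs for its operations only.\<close>

definition scale_nat :: "nat \<Rightarrow> 'a::comm_monoid_add \<Rightarrow> 'a" where
  "scale_nat k a = rec_nat 0 (\<lambda>_ v. v + a) k"

definition deriv_tpoly :: "nat \<Rightarrow> nat \<Rightarrow> 'a::comm_monoid_add tpoly \<Rightarrow> 'a tpoly" where
  "deriv_tpoly n i p = map (\<lambda>t. (scale_nat (expo i t) (fst t),
     map (\<lambda>j. if j = i then expo j t - 1 else expo j t) [0..<n])) p"

definition coeff_tpoly :: "nat \<Rightarrow> nat \<Rightarrow> nat \<Rightarrow> 'a tpoly \<Rightarrow> 'a tpoly" where
  "coeff_tpoly n i k p = map (\<lambda>t. (fst t, map (\<lambda>j. if j = i then 0 else expo j t) [0..<n]))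
     (filter (\<lambda>t. expo i t = k) p)"

lemma lookup_exponents_0 [simp]: "lookup (exponents es) 0 = 0"
  by (simp add: exponents_def nth_default_def)

lemma lookup_exponents_Suc [simp]: "lookup (exponents es) (Suc j) = nth_default 0 es j"
  by (simp add: exponents_def)

lemma monom_eqI_Suc:
  fixes m m' :: monom
  assumes "lookup m 0 = lookup m' 0"
    "\<And>j. lookup m (Suc j) = lookup m' (Suc j)"
  shows "m = m'"
proof (rule poly_mapping_eqI)
  fix k show "lookup m k = lookup m' k"
    using assms by (cases k) auto
qed

lemma exponents_inj:
  assumes "exponents es = exponents fs" "length es = length fs"
  shows "es = fs"
proof (rule nth_equalityI)
  fix i assume "i < length es"
  moreover have "nth_default 0 es i = nth_default 0 fs i"
    using arg_cong[OF assms(1), of "\<lambda>m. lookup m (Suc i)"] by simp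
  ultimately show "es ! i = fs ! i" using assms(2) by (simp add: nth_default_def)
qed (rule assms)

lemma nth_default_map_upt: "nth_default 0 (map f [0..<n]) j = (if j < n then f j else 0)"
  by (simp add: nth_default_def)

lemma expo_ge: "length (snd t) = n \<Longrightarrow> j \<ge> n \<Longrightarrow> expo j t = 0"
  by (simp add: expo_def nth_default_def)

lemma lookup_exponents_expo: "lookup (exponents (snd t)) (Suc j) = expo j t"
  by (simp add: expo_def)

lemma poly_of_Nil [simp]: "poly_of [] = 0"
  by (simp add: poly_of_def)

lemma poly_of_Cons [simp]:
  "poly_of (t # p) = single (exponents (snd t)) (fst t) + poly_of p"
  by (simp add: poly_of_def)

lemma poly_of_append [simp]: "poly_of (p @ q) = poly_of p + poly_of q"
  by (simp add: poly_of_def)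

lemma wf_poly_simps [simp]:
  "wf_poly n []" "wf_poly n (t # p) \<longleftrightarrow> length (snd t) = n \<and> wf_poly n p"
  "wf_poly n (p @ q) \<longleftrightarrow> wf_poly n p \<and> wf_poly n q"
  by (auto simp: wf_poly_def)

lemma wf_sys_simps [simp]:
  "wf_sys n []" "wf_sys n (c # T) \<longleftrightarrow> wf_poly n (snd c) \<and> wf_sys n T"
  "wf_sys n (S @ T) \<longleftrightarrow> wf_sys n S \<and> wf_sys n T"
  by (auto simp: wf_sys_def)

lemma vars_poly_of: "vars (poly_of p) \<subseteq> {Suc j | j. \<exists>t\<in>set p. expo j t > 0}"
proof (induction p)
  case (Cons t p)
  have "vars (single (exponents (snd t)) (fst t)) \<subseteq> {Suc j | j. expo j t > 0}"
  proof
    fix x assume "x \<in> vars (single (exponents (snd t)) (fst t))"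
    then have "lookup (exponents (snd t)) x \<noteq> 0"
      using vars_single[of "exponents (snd t)" "fst t"] by (auto simp: in_keys_iff)
    then show "x \<in> {Suc j | j. expo j t > 0}"
      by (cases x) (auto simp: expo_def)
  qed
  then show ?case
    using Cons vars_add[of "single (exponents (snd t)) (fst t)" "poly_of p"] by fastforce
qed simp

lemma vars_poly_of_le:
  assumes "\<And>t j. t \<in> set p \<Longrightarrow> expo j t > 0 \<Longrightarrow> j < m"
  shows "vars (poly_of p) \<subseteq> {1..m}"
proof
  fix x assume "x \<in> vars (poly_of p)"
  then obtain j t where "x = Suc j" "t \<in> set p" "expo j t > 0"
    using vars_poly_of[of p] by blast
  then show "x \<in> {1..m}" using assms[of t j] by simp
qed

lemma poly_of_poly_ring:
  assumes "wf_poly n p"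
  shows "poly_of p \<in> poly_ring n"
proof -
  have "j < n" if "t \<in> set p" "expo j t > 0" for t j
    using assms that expo_ge[of t n j] unfolding wf_poly_def by (metis not_gr_zero not_less)
  then show ?thesis unfolding poly_ring_def using vars_poly_of_le by blast
qed

lemma coeff_sum_eq: "coeff_sum p es = (\<Sum>t\<leftarrow>p. if snd t = es then fst t else 0)"
proof -
  have "fold (\<lambda>t acc. if snd t = es then fst t + acc else acc) p b = (\<Sum>t\<leftarrow>p. if snd t = es then fst t else 0) + b"
    for b
    by (induction p arbitrary: b) (auto simp: add_ac)
  then show ?thesis by (simp add: coeff_sum_def)
qed

lemma lookup_poly_of:
  "lookup (poly_of p) m = (\<Sum>t\<leftarrow>p. if exponents (snd t) = m then fst t else 0)"
  by (induction p) (auto simp: lookup_add lookup_single when_def)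

lemma lookup_poly_of_exponents:
  assumes "wf_poly n p" "length es = n"
  shows "lookup (poly_of p) (exponents es) = coeff_sum p es"
  unfolding lookup_poly_of coeff_sum_eq using assms exponents_inj
  by (intro arg_cong[of _ _ sum_list] map_cong refl if_cong) (auto simp: wf_poly_def)

text \<open>A monomial that occurs in neither list has the coefficient \<open>0\<close> on both sides, so finitely
  many comparisons decide equality.\<close>

lemma same_poly_iff:
  assumes "wf_poly n p" "wf_poly n q"
  shows "same_poly p q \<longleftrightarrow> poly_of p = poly_of q"
proof
  assume same: "same_poly p q"
  show "poly_of p = poly_of q"
  proof (rule poly_mapping_eqI)
    fix m
    show "lookup (poly_of p) m = lookup (poly_of q) m"
    proof (cases "\<exists>t\<in>set (p @ q). exponents (snd t) = m")
      case True
      then obtain t where t: "t \<in> set (p @ q)" "exponents (snd t) = m" by blast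
      then have "length (snd t) = n" using assms by (auto simp: wf_poly_def)
      then show ?thesis
        using same t assms lookup_poly_of_exponents unfolding same_poly_def by metis
    next
      case False
      have "(\<Sum>t\<leftarrow>r. if exponents (snd t) = m then fst t else 0) = 0" if "set r \<subseteq> set (p @ q)" for r
        using that False by (induction r) auto
      then show ?thesis unfolding lookup_poly_of by simp
    qed
  qed
next
  assume "poly_of p = poly_of q"
  then show "same_poly p q"
    using assms lookup_poly_of_exponents unfolding same_poly_def
    by (metis (no_types, lifting) set_append UnE wf_poly_def)
qed

lemma poly_of_mult_term:
  assumes "length (snd s) = n" "length (snd t) = n"
  shows "exponents (snd (mult_term n s t)) = exponents (snd s) + exponents (snd t)"
  using expo_ge[OF assms(1)] expo_ge[OF assms(2)]
  by (intro monom_eqI_Suc)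
     (auto simp: mult_term_def lookup_add nth_default_map_upt expo_def not_less)

lemma wf_mult_tpoly [simp]: "wf_poly n (mult_tpoly n p q)"
  by (auto simp: wf_poly_def mult_tpoly_def mult_term_def)

lemma poly_of_mult_tpoly:
  fixes p q :: "'a::comm_semiring_1 tpoly"
  assumes "wf_poly n p" "wf_poly n q"
  shows "poly_of (mult_tpoly n p q) = poly_of p * poly_of q"
proof -
  have *: "poly_of (map (\<lambda>t. mult_term n s t) q) = single (exponents (snd s)) (fst s) * poly_of q"
    if "length (snd s) = n" for s
    using assms(2)
  proof (induction q)
    case (Cons t q)
    then show ?case
      using that poly_of_mult_term[of s n t]
      by (simp add: distrib_left mult_single) (simp add: mult_term_def)
  qed simp
  show ?thesis
    using assms(1)
  proof (induction p)
    case (Cons s p)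
    then show ?case using * by (simp add: mult_tpoly_def distrib_right)
  qed (simp add: mult_tpoly_def)
qed

lemma wf_one_tpoly [simp]: "wf_poly n (one_tpoly n)"
  by (simp add: one_tpoly_def)

lemma poly_of_one_tpoly [simp]: "poly_of (one_tpoly n :: 'a::comm_semiring_1 tpoly) = 1"
proof -
  have "exponents (map (\<lambda>_. 0) [0..<n]) = 0"
    by (rule monom_eqI_Suc) (simp_all add: nth_default_map_upt)
  then show ?thesis by (simp add: one_tpoly_def)
qed

lemma prod_tpolys:
  fixes ps :: "'a::comm_semiring_1 tpoly list"
  assumes "\<forall>p\<in>set ps. wf_poly n p"
  shows "wf_poly n (prod_tpolys n ps)" "poly_of (prod_tpolys n ps) = prod_list (map poly_of ps)"
proof -
  have "wf_poly n r \<Longrightarrow> wf_poly n (fold (\<lambda>p acc. mult_tpoly n p acc) ps r) \<and>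
      poly_of (fold (\<lambda>p acc. mult_tpoly n p acc) ps r) = prod_list (map poly_of ps) * poly_of r" for r
    using assms by (induction ps arbitrary: r) (auto simp: poly_of_mult_tpoly mult_ac)
  then show "wf_poly n (prod_tpolys n ps)" "poly_of (prod_tpolys n ps) = prod_list (map poly_of ps)"
    by (simp_all add: prod_tpolys_def)
qed

lemma scale_nat_eq: "scale_nat k a = of_nat k * a"
  for a :: "'a::comm_semiring_1"
  by (induction k) (auto simp: scale_nat_def algebra_simps)

lemma of_nat_mult_single:
  "of_nat k * single m a = single m (of_nat k * a)"
  for a :: "'a::comm_semiring_1"
  by (induction k) (auto simp: distrib_right single_add)

definition deriv_in :: "nat \<Rightarrow> 'a::idom mpoly \<Rightarrow> 'a mpoly" where
  "deriv_in x p = poly (pderiv (upoly x p)) (var x)"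

lemma wf_deriv_tpoly [simp]: "wf_poly n (deriv_tpoly n i p)"
  by (auto simp: wf_poly_def deriv_tpoly_def)

lemma poly_of_deriv_tpoly:
  fixes p :: "'a::idom tpoly"
  assumes "wf_poly n p" "i < n"
  shows "poly_of (deriv_tpoly n i p) = deriv_in (Suc i) (poly_of p)"
  using assms(1)
proof (induction p)
  case Nil
  then show ?case by (simp add: deriv_tpoly_def deriv_in_def)
next
  case (Cons t p)
  let ?m = "exponents (snd t)"
  have m: "exponents (map (\<lambda>j. if j = i then expo j t - 1 else expo j t) [0..<n]) =
      update (Suc i) 0 ?m + single (Suc i) (expo i t - 1)"
    using assms(2) Cons.prems expo_ge[of t n]
    by (intro monom_eqI_Suc)
       (auto simp: lookup_add lookup_update lookup_single when_def nth_default_map_upt expo_def not_less)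
  have "deriv_in (Suc i) (single ?m (fst t)) =
      single (update (Suc i) 0 ?m + single (Suc i) (expo i t - 1))
        (of_nat (expo i t) * fst t)"
    by (simp add: deriv_in_def upoly_single pderiv_monom poly_monom var_power of_nat_mult_single mult_single
        expo_def)
  then show ?case
    using Cons m
    by (simp add: deriv_tpoly_def scale_nat_eq deriv_in_def upoly_add pderiv_add)
qed

lemma wf_coeff_tpoly [simp]: "wf_poly n (coeff_tpoly n i k p)"
  by (auto simp: wf_poly_def coeff_tpoly_def)

lemma poly_of_coeff_tpoly:
  fixes p :: "'a::idom tpoly"
  assumes "wf_poly n p" "i < n"
  shows "poly_of (coeff_tpoly n i k p) = coeff_in (Suc i) k (poly_of p)"
  using assms(1)
proof (induction p)
  case Nil
  then show ?case by (simp add: coeff_tpoly_def)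
next
  case (Cons t p)
  let ?m = "exponents (snd t)"
  have m: "exponents (map (\<lambda>j. if j = i then 0 else expo j t) [0..<n]) = update (Suc i) 0 ?m"
    using assms(2) Cons.prems expo_ge[of t n]
    by (intro monom_eqI_Suc) (auto simp: lookup_update nth_default_map_upt expo_def not_less)
  have "coeff_in (Suc i) k (single ?m (fst t)) =
      (if expo i t = k then single (update (Suc i) 0 ?m) (fst t) else 0)"
    unfolding coeff_upoly[symmetric] upoly_single by (simp add: expo_def)
  then show ?case
    using Cons m by (simp add: coeff_tpoly_def coeff_in_add)
qed

text \<open>A list without spurious terms: the variables that occur in it are those of the polynomial.\<close>

definition terms_of :: "nat \<Rightarrow> 'a::zero mpoly \<Rightarrow> 'a tpoly" where
  "terms_of n p = map (\<lambda>m. (lookup p m, map (\<lambda>j. lookup m (Suc j)) [0..<n]))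
     (SOME ms. set ms = keys p \<and> distinct ms)"

lemma terms_of:
  fixes p :: "'a::comm_monoid_add mpoly"
  assumes "p \<in> poly_ring n"
  shows "wf_poly n (terms_of n p)" "poly_of (terms_of n p) = p"
    "(\<lambda>t. exponents (snd t)) ` set (terms_of n p) = keys p"
proof -
  define ms where "ms = (SOME ms. set ms = keys p \<and> distinct ms)"
  have ms: "set ms = keys p \<and> distinct ms"
    unfolding ms_def by (rule someI_ex) (rule finite_distinct_list[OF finite_keys])
  have eq: "terms_of n p = map (\<lambda>m. (lookup p m, map (\<lambda>j. lookup m (Suc j)) [0..<n])) ms"
    by (simp add: terms_of_def ms_def)
  have ex: "exponents (map (\<lambda>j. lookup m (Suc j)) [0..<n]) = m" if "m \<in> keys p" for m
  proof (rule monom_eqI_Suc)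
    have sub: "keys m \<subseteq> {1..n}"
      using assms that by (auto simp: poly_ring_def vars_def)
    then have "lookup m k = 0" if "k \<notin> {1..n}" for k
      using that by (meson in_keys_iff subsetD)
    then show "lookup (exponents (map (\<lambda>j. lookup m (Suc j)) [0..<n])) 0 = lookup m 0"
      "lookup (exponents (map (\<lambda>j. lookup m (Suc j)) [0..<n])) (Suc j) = lookup m (Suc j)" for j
      by (auto simp: nth_default_map_upt)
  qed
  show "wf_poly n (terms_of n p)" by (auto simp: eq wf_poly_def)
  have "poly_of (terms_of n p) = (\<Sum>m\<leftarrow>ms. single m (lookup p m))"
    unfolding eq poly_of_def using ex ms by (auto simp: comp_def intro!: arg_cong[of _ _ sum_list])
  also have "\<dots> = (\<Sum>m\<in>keys p. single m (lookup p m))"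
    using ms by (simp add: sum_list_distinct_conv_sum_set)
  finally show "poly_of (terms_of n p) = p" using mpoly_as_sum[of p] by simp
  show "(\<lambda>t. exponents (snd t)) ` set (terms_of n p) = keys p"
    using ex ms by (auto simp: eq image_image intro: rev_image_eqI)
qed

lemma expo_terms_of:
  fixes p :: "'a::comm_monoid_add mpoly"
  assumes "p \<in> poly_ring n" "t \<in> set (terms_of n p)"
  shows "exponents (snd t) \<in> keys p" "expo j t \<noteq> 0 \<Longrightarrow> Suc j \<in> vars p"
proof -
  show key: "exponents (snd t) \<in> keys p"
    unfolding terms_of(3)[OF assms(1), symmetric] using assms(2) by (rule imageI)
  show "Suc j \<in> vars p" if "expo j t \<noteq> 0"
    unfolding vars_def using that
    by (intro UN_I[OF key]) (simp add: in_keys_iff lookup_exponents_expo del: lookup_exponents_Suc)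
qed

section \<open>Leaders of lists of terms\<close>

text \<open>Terms of a list may cancel. The last condition ensures that those of exponent \<open>k\<close> do not, so
  that \<open>k\<close> is the rank and not merely a bound for it.\<close>

definition leads :: "nat \<Rightarrow> nat \<Rightarrow> nat \<Rightarrow> 'a::comm_monoid_add tpoly \<Rightarrow> bool" where
  "leads n i k p \<longleftrightarrow> 1 \<le> k \<and>
     (\<forall>t\<in>set p. expo i t \<le> k \<and> (\<forall>j\<in>set [0..<n]. \<not> j \<le> i \<longrightarrow> expo j t = 0)) \<and>
     \<not> same_poly (coeff_tpoly n i k p) []"

definition has_leader :: "nat \<Rightarrow> nat \<Rightarrow> 'a::comm_monoid_add tpoly \<Rightarrow> bool" where
  "has_leader n i p \<longleftrightarrow> (\<exists>t\<in>set p. leads n i (expo i t) p)"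

text \<open>This is a test on the terms of the list. A variable may occur in terms that cancel, so the
  selected constraints are among those with smaller leader, and they are all of them for lists made by
  \<open>terms_of\<close>. Unsolvability of the smaller system implies unsolvability of the larger one, which is the
  direction that soundness needs.\<close>

definition below_tsys :: "nat \<Rightarrow> nat \<Rightarrow> 'a tsystem \<Rightarrow> 'a tsystem" where
  "below_tsys n i T = filter (\<lambda>c. \<forall>t\<in>set (snd c). \<forall>j\<in>set [0..<n]. i \<le> j \<longrightarrow> expo j t = 0) T"

lemma leads_sound:
  fixes p :: "'a::idom tpoly"
  assumes "leads n i k p" "wf_poly n p" "i < n"
  shows "ld (poly_of p) = Suc i" "init (poly_of p) = poly_of (coeff_tpoly n i k p)"
proof -
  let ?p = "poly_of p"
  have "j < Suc i" if "t \<in> set p" "expo j t > 0" for t j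
    using assms that expo_ge[of t n j] unfolding leads_def wf_poly_def
    by (metis atLeastLessThan_upt atLeast0LessThan lessThan_iff less_Suc_eq_le linorder_not_less not_gr_zero)
  then have vars: "vars ?p \<subseteq> {1..Suc i}" by (rule vars_poly_of_le)
  have co: "coeff_in (Suc i) k ?p \<noteq> 0"
    using assms poly_of_coeff_tpoly[OF assms(2,3), of k] same_poly_iff[of n "coeff_tpoly n i k p" "[]"]
    by (auto simp: leads_def)
  then have "degree_in (Suc i) ?p \<ge> k" using coeff_in_eq_0 by (metis not_le)
  moreover have "coeff_in (Suc i) l ?p = 0" if "l > k" for l
  proof -
    have "filter (\<lambda>t. expo i t = l) p = []"
      using assms(1) that by (auto simp: leads_def filter_empty_conv)
    then show ?thesis using poly_of_coeff_tpoly[OF assms(2,3), of l] by (simp add: coeff_tpoly_def)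
  qed
  then have "degree (upoly (Suc i) ?p) \<le> k" by (intro degree_le) simp
  ultimately have deg: "degree (upoly (Suc i) ?p) = k" by (simp add: degree_upoly)
  then have "Suc i \<in> vars ?p"
    using assms(1) by (simp add: degree_in_pos_iff[symmetric] degree_upoly[symmetric] leads_def)
  then show ld: "ld ?p = Suc i" using vars by (auto simp: ld_def intro!: Max_eqI)
  show "init ?p = poly_of (coeff_tpoly n i k p)"
    unfolding init_eq ld deg using poly_of_coeff_tpoly[OF assms(2,3), of k] by simp
qed

lemma has_leader_terms_of:
  fixes p :: "'a::idom mpoly"
  assumes "p \<in> poly_ring n" "vars p \<noteq> {}"
  shows "\<exists>i<n. has_leader n i (terms_of n p)"
proof -
  note t = terms_of[OF assms(1)]
  have ldmax: "ld p = Max (vars p)" using assms(2) by (simp add: ld_def)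
  then have "ld p \<in> vars p" using assms(2) by simp
  then have "ld p \<in> {1..n}" using assms(1) by (auto simp: poly_ring_def)
  then obtain i where i: "ld p = Suc i" "i < n" by (cases "ld p") auto
  define k where "k = degree_in (Suc i) p"
  have k: "k > 0" using \<open>ld p \<in> vars p\<close> i by (simp add: k_def degree_in_pos_iff)
  have "k \<in> insert 0 ((\<lambda>m. lookup m (Suc i)) ` keys p)"
    unfolding k_def degree_in_def by (rule Max_in) auto
  then obtain m where "m \<in> keys p" "lookup m (Suc i) = k" using k by auto
  then obtain s where s: "s \<in> set (terms_of n p)" "expo i s = k"
    unfolding t(3)[symmetric] by (auto simp: expo_def)
  have "expo i s' \<le> k" if "s' \<in> set (terms_of n p)" for s'
    unfolding k_def degree_in_def
    using imageI[OF expo_terms_of(1)[OF assms(1) that], of "\<lambda>m. lookup m (Suc i)"]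
    by (intro Max_ge) (auto simp: lookup_exponents_expo simp del: lookup_exponents_Suc)
  moreover have "expo j s' = 0" if "s' \<in> set (terms_of n p)" "\<not> j \<le> i" for s' j
  proof (rule ccontr)
    assume "expo j s' \<noteq> 0"
    then have "Suc j \<in> vars p" by (rule expo_terms_of(2)[OF assms(1) that(1)])
    then have "Suc j \<le> Suc i" using i(1) ldmax by (metis Max_ge finite_vars)
    then show False using that by simp
  qed
  moreover have "coeff_in (Suc i) k p \<noteq> 0"
  proof -
    have "upoly (Suc i) p \<noteq> 0" using k by (auto simp: k_def degree_upoly[symmetric])
    then have "lead_coeff (upoly (Suc i) p) \<noteq> 0" by (simp del: coeff_upoly)
    then show ?thesis unfolding coeff_upoly degree_upoly k_def .
  qed
  then have "\<not> same_poly (coeff_tpoly n i k (terms_of n p)) []"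
    using same_poly_iff[of n "coeff_tpoly n i k (terms_of n p)" "[]"]
      poly_of_coeff_tpoly[OF t(1) i(2), of k] t(2) by simp
  ultimately have "leads n i k (terms_of n p)"
    using k by (auto simp: leads_def)
  then show ?thesis using s i(2) unfolding has_leader_def by blast
qed

lemma below_tsys_subset:
  assumes "wf_sys n T"
  shows "sys_of (below_tsys n i T) \<subseteq> sys_below (sys_of T) (Suc i)"
proof
  fix C assume "C \<in> sys_of (below_tsys n i T)"
  then obtain c where c: "c \<in> set T" "C = constr_of c"
      "\<forall>t\<in>set (snd c). \<forall>j\<in>set [0..<n]. i \<le> j \<longrightarrow> expo j t = 0"
    by (auto simp: below_tsys_def)
  have "j < i" if "t \<in> set (snd c)" "expo j t > 0" for t j
    using that c assms expo_ge[of t n j] unfolding wf_sys_def wf_poly_def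
    by (metis atLeastLessThan_upt atLeast0LessThan lessThan_iff linorder_not_less not_gr_zero)
  then have "vars (poly_of (snd c)) \<subseteq> {1..i}" by (rule vars_poly_of_le)
  then have "ld (poly_of (snd c)) \<le> i" by (auto simp: ld_def)
  then show "C \<in> sys_below (sys_of T) (Suc i)"
    using c by (auto simp: sys_below_def constr_of_def)
qed

lemma below_tsys_terms_of:
  assumes "\<And>c. c \<in> set T \<Longrightarrow> \<exists>p\<in>poly_ring n. snd c = terms_of n p"
  shows "sys_below (sys_of T) (Suc i) \<subseteq> sys_of (below_tsys n i T)"
proof
  fix C assume "C \<in> sys_below (sys_of T) (Suc i)"
  then obtain c where c: "c \<in> set T" "C = constr_of c" "ld (poly_of (snd c)) \<le> i"
    by (auto simp: sys_below_def constr_of_def split: if_splits)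
  obtain p where p: "p \<in> poly_ring n" "snd c = terms_of n p" using assms c(1) by blast
  have "expo j t = 0" if "t \<in> set (snd c)" "i \<le> j" for t j
  proof (rule ccontr)
    assume "expo j t \<noteq> 0"
    then have "Suc j \<in> vars p" using expo_terms_of(2)[OF p(1)] that(1) p(2) by simp
    then have "Suc j \<le> ld p" by (auto simp: ld_def)
    then show False using c(3) p terms_of(2)[OF p(1)] that by simp
  qed
  then have "c \<in> set (below_tsys n i T)" using c(1) by (auto simp: below_tsys_def)
  then show "C \<in> sys_of (below_tsys n i T)" using c(2) by blast
qed

section \<open>Certificates of unsolvability\<close>

type_synonym 'a certificate = "'a tpoly list \<times> ('a tpoly \<times> 'a tpoly) list"

text \<open>The polynomial identities that the Nullstellensatz provides as certificates of
  unsolvability.\<close>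

definition refutes :: "nat \<Rightarrow> 'a::comm_semiring_1 tsystem \<Rightarrow> 'a certificate \<Rightarrow> bool" where
  "refutes n T w \<longleftrightarrow> (\<forall>g\<in>set (fst w). \<exists>c\<in>set T. c = (True, g)) \<and>
     (\<forall>l\<in>set (snd w). wf_poly n (fst l) \<and> (\<exists>c\<in>set T. c = (False, snd l))) \<and>
     same_poly (prod_tpolys n (fst w)) (concat (map (\<lambda>l. mult_tpoly n (fst l) (snd l)) (snd w)))"

lemma wf_sysD: "wf_sys n T \<Longrightarrow> c \<in> set T \<Longrightarrow> wf_poly n (snd c)"
  unfolding wf_sys_def by blast

lemma lhs_constr_of [simp]: "lhs (constr_of c) = poly_of (snd c)"
  by (simp add: constr_of_def)

lemma alg_system_sys_of: "wf_sys n T \<Longrightarrow> alg_system n (sys_of T)"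
  unfolding alg_system_def image_subset_iff ball_simps
  by (intro conjI ballI) (simp_all add: poly_of_poly_ring[OF wf_sysD])

definition unsat :: "'a::field tsystem \<Rightarrow> bool" where
  "unsat T \<longleftrightarrow> (\<forall>a. \<not> holds a (sys_of T))"

lemma holds_sys_of:
  "holds a (sys_of T) \<longleftrightarrow> (\<forall>c\<in>set T. eval_at a (poly_of (snd c)) = 0 \<longleftrightarrow> \<not> fst c)"
proof -
  have "holds a (sys_of T) \<longleftrightarrow> (\<forall>c\<in>set T. holds a {constr_of c})"
    by (auto simp: holds_def)
  moreover have "holds a {constr_of c} \<longleftrightarrow> (eval_at a (poly_of (snd c)) = 0 \<longleftrightarrow> \<not> fst c)" for c
    by (cases "fst c") (simp_all add: constr_of_def)
  ultimately show ?thesis by simp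
qed

lemma unsat_Cons:
  "unsat (c # T) \<longleftrightarrow>
     (\<nexists>a. (eval_at a (poly_of (snd c)) = 0 \<longleftrightarrow> \<not> fst c) \<and> holds a (sys_of T))"
  unfolding unsat_def holds_sys_of by simp

lemma holds_Cons:
  "holds a (sys_of (c # T)) \<longleftrightarrow> (eval_at a (poly_of (snd c)) = 0 \<longleftrightarrow> \<not> fst c) \<and> holds a (sys_of T)"
  unfolding holds_sys_of by simp

lemma refutes_certificate:
  fixes T :: "'a::field_char_0 tsystem"
  assumes "wf_sys n T"
    and "\<forall>g\<in>set (fst w). (True, g) \<in> set T"
    and "\<forall>l\<in>set (snd w). wf_poly n (fst l) \<and> (False, snd l) \<in> set T"
  shows "same_poly (prod_tpolys n (fst w)) (concat (map (\<lambda>l. mult_tpoly n (fst l) (snd l)) (snd w))) \<longleftrightarrow>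
    prod_list (map poly_of (fst w)) = (\<Sum>l\<leftarrow>snd w. poly_of (fst l) * poly_of (snd l))"
proof -
  have gs: "\<forall>g\<in>set (fst w). wf_poly n g"
    using assms(1,2) unfolding wf_sys_def by (metis snd_conv)
  have L: "\<forall>l\<in>set (snd w). wf_poly n (fst l) \<and> wf_poly n (snd l)"
    using assms(1,3) unfolding wf_sys_def by (metis snd_conv)
  have "wf_poly n (concat (map (\<lambda>l. mult_tpoly n (fst l) (snd l)) L)) \<and>
      poly_of (concat (map (\<lambda>l. mult_tpoly n (fst l) (snd l)) L)) = (\<Sum>l\<leftarrow>L. poly_of (fst l) * poly_of (snd l))"
    if "\<forall>l\<in>set L. wf_poly n (fst l) \<and> wf_poly n (snd l)" for L :: "('a tpoly \<times> 'a tpoly) list"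
    using that by (induction L) (auto simp: poly_of_mult_tpoly)
  note sum = this[OF L]
  show ?thesis
    unfolding same_poly_iff[OF prod_tpolys(1)[OF gs] conjunct1[OF sum]]
      prod_tpolys(2)[OF gs] conjunct2[OF sum] ..
qed

lemma refutes_sound:
  fixes T :: "'a::field_char_0 tsystem"
  assumes "wf_sys n T" "refutes n T w"
  shows "unsat T"
  unfolding unsat_def
proof (intro allI notI)
  fix a assume "holds a (sys_of T)"
  then have h: "\<And>c. c \<in> set T \<Longrightarrow> eval_at a (poly_of (snd c)) = 0 \<longleftrightarrow> \<not> fst c"
    by (simp add: holds_sys_of)
  have w: "\<forall>g\<in>set (fst w). (True, g) \<in> set T"
    "\<forall>l\<in>set (snd w). wf_poly n (fst l) \<and> (False, snd l) \<in> set T"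
    "same_poly (prod_tpolys n (fst w)) (concat (map (\<lambda>l. mult_tpoly n (fst l) (snd l)) (snd w)))"
    using assms(2) unfolding refutes_def by auto
  have eq: "eval_at a (prod_list (map poly_of (fst w))) =
      eval_at a (\<Sum>l\<leftarrow>snd w. poly_of (fst l) * poly_of (snd l))"
    using refutes_certificate[OF assms(1) w(1,2)] w(3) by simp
  have "eval_at a (prod_list (map poly_of (fst w))) \<noteq> 0"
    using w(1) h[of "(True, _)"] by (force simp: prod_list_zero_iff)
  moreover have "(\<Sum>l\<leftarrow>L. eval_at a (poly_of (fst l)) * eval_at a (poly_of (snd l))) = 0"
    if "set L \<subseteq> set (snd w)" for L
    using that
  proof (induction L)
    case (Cons l L)
    then have "(False, snd l) \<in> set T" using w(2) by auto
    then show ?case using Cons h[of "(False, snd l)"] by simp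
  qed simp
  ultimately show False using eq by (simp add: comp_def)
qed

lemma refutes_complete:
  fixes T :: "'a::field_char_0 tsystem"
  assumes wf: "wf_sys n T" and "unsat T"
  shows "\<exists>w. refutes n T w"
proof -
  define E where "E = {poly_of p | p. (False, p) \<in> set T}"
  define N where "N = {poly_of p | p. (True, p) \<in> set T}"
  have E: "E \<subseteq> poly_ring n" and N: "N \<subseteq> poly_ring n"
    using wf unfolding E_def N_def wf_sys_def by (force intro: poly_of_poly_ring)+
  have "N \<subseteq> (\<lambda>c. poly_of (snd c)) ` set T" unfolding N_def by force
  then have fin: "finite N" by (rule finite_subset) simp
  have "\<nexists>a. (\<forall>p\<in>E. eval_at a p = 0) \<and> (\<forall>p\<in>N. eval_at a p \<noteq> 0)"
  proof
    assume "\<exists>a. (\<forall>p\<in>E. eval_at a p = 0) \<and> (\<forall>p\<in>N. eval_at a p \<noteq> 0)"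
    then obtain a where a: "\<And>p. (False, p) \<in> set T \<Longrightarrow> eval_at a (poly_of p) = 0"
      "\<And>p. (True, p) \<in> set T \<Longrightarrow> eval_at a (poly_of p) \<noteq> 0"
      unfolding E_def N_def by blast
    have "eval_at a (poly_of (snd c)) = 0 \<longleftrightarrow> \<not> fst c" if "c \<in> set T" for c
      using a[of "snd c"] that by (cases c; cases "fst c") auto
    then show False using assms(2) unfolding unsat_def holds_sys_of by blast
  qed
  from nullstellensatz[OF E N fin this] obtain gs L where
    gs: "set gs \<subseteq> N" and L: "set L \<subseteq> poly_ring n \<times> E" and eq: "prod_list gs = (\<Sum>(q, p)\<leftarrow>L. q * p)"
    by blast
  have "\<exists>p. (True, p) \<in> set T \<and> poly_of p = g" if "g \<in> set gs" for g
    using that gs unfolding N_def by blast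
  then obtain f where f: "\<And>g. g \<in> set gs \<Longrightarrow> (True, f g) \<in> set T \<and> poly_of (f g) = g" by metis
  have "\<exists>p. (False, p) \<in> set T \<and> poly_of p = snd l" if "l \<in> set L" for l
    using that L unfolding E_def by fastforce
  then obtain h where h: "\<And>l. l \<in> set L \<Longrightarrow> (False, h l) \<in> set T \<and> poly_of (h l) = snd l" by metis
  define w where "w = (map f gs, map (\<lambda>l. (terms_of n (fst l), h l)) L)"
  have w1: "\<forall>g\<in>set (fst w). (True, g) \<in> set T"
    using f by (auto simp: w_def)
  have q: "fst l \<in> poly_ring n" if "l \<in> set L" for l using that L by auto
  have w2: "\<forall>l\<in>set (snd w). wf_poly n (fst l) \<and> (False, snd l) \<in> set T"
  proof
    fix l assume "l \<in> set (snd w)"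
    then have "l \<in> (\<lambda>l. (terms_of n (fst l), h l)) ` set L" by (simp add: w_def)
    then obtain l' where l': "l' \<in> set L" "l = (terms_of n (fst l'), h l')" by (rule imageE)
    then show "wf_poly n (fst l) \<and> (False, snd l) \<in> set T"
      using h[of l'] terms_of(1)[OF q] by simp
  qed
  have "map poly_of (fst w) = gs"
    using f by (auto simp: w_def intro!: map_idI)
  moreover have "(\<Sum>l\<leftarrow>snd w. poly_of (fst l) * poly_of (snd l)) = (\<Sum>(q, p)\<leftarrow>L. q * p)"
  proof -
    have "map (\<lambda>l. poly_of (fst l) * poly_of (snd l)) (snd w) =
        map (\<lambda>l. poly_of (terms_of n (fst l)) * poly_of (h l)) L"
      by (simp add: w_def)
    also have "\<dots> = map (\<lambda>l. fst l * snd l) L"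
      by (rule map_cong[OF refl]) (use h terms_of(2)[OF q] in metis)
    finally show ?thesis unfolding case_prod_beta by (rule arg_cong)
  qed
  ultimately have "refutes n T w"
    using refutes_certificate[OF wf w1 w2] eq w1 w2 unfolding refutes_def by simp
  then show ?thesis ..
qed

section \<open>Thomas decompositions by unsolvable systems\<close>

text \<open>The first system is unsolvable if the initial of \<open>c\<close> does not vanish on the solutions of the
  constraints below, the second one if \<open>c\<close> is square-free there. The rank is found among the exponents that occur in \<open>c\<close>.\<close>

definition leader_obligations ::
    "nat \<Rightarrow> 'a::comm_monoid_add tsystem \<Rightarrow> bool \<times> 'a tpoly \<Rightarrow> nat \<Rightarrow> 'a \<times> nat list \<Rightarrow> 'a tsystem list" where
  "leader_obligations n T c i t = (if leads n i (expo i t) (snd c)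
     then [(False, coeff_tpoly n i (expo i t) (snd c)) # below_tsys n i T,
           (False, snd c) # (False, deriv_tpoly n i (snd c)) # below_tsys n i T]
     else [])"

definition simple_obligations :: "nat \<Rightarrow> 'a::comm_monoid_add tsystem \<Rightarrow> 'a tsystem list" where
  "simple_obligations n T =
     concat (map (\<lambda>c. concat (map (\<lambda>i. concat (map (\<lambda>t. leader_obligations n T c i t) (snd c))) [0..<n])) T)"

definition negate :: "bool \<times> 'p \<Rightarrow> bool \<times> 'p" where
  "negate c = (\<not> fst c, snd c)"

text \<open>The complement of a union of solution sets, as a union again: one constraint of each system
  is negated.\<close>

definition negations :: "'a tsystem list \<Rightarrow> 'a tsystem list" where
  "negations Ss = fold (\<lambda>T acc. concat (map (\<lambda>R. map (\<lambda>c. negate c # R) T) acc)) Ss [[]]"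

definition overlaps :: "'a tsystem list \<Rightarrow> 'a tsystem list" where
  "overlaps Ss = snd (fold (\<lambda>T acc. (T # fst acc, map (\<lambda>T'. T' @ T) (fst acc) @ snd acc)) Ss ([], []))"

text \<open>The systems \<open>Ss\<close> decompose \<open>T\<^sub>0\<close> if all of these systems are unsolvable: those for simplicity,
  the unions of members at different positions of \<open>Ss\<close>, a member of \<open>Ss\<close> with a negated constraint of \<open>T\<^sub>0\<close>, and \<open>T\<^sub>0\<close>
  together with a negated constraint of each member.\<close>

definition obligations ::
    "nat \<Rightarrow> 'a::comm_monoid_add tsystem \<Rightarrow> 'a tsystem list \<Rightarrow> 'a tsystem list" where
  "obligations n T\<^sub>0 Ss = concat (map (\<lambda>T. simple_obligations n T) Ss) @ overlaps Ss @
     concat (map (\<lambda>T. map (\<lambda>c. negate c # T) T\<^sub>0) Ss) @ map (\<lambda>R. T\<^sub>0 @ R) (negations Ss)"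

definition triangular :: "nat \<Rightarrow> 'a::comm_monoid_add tsystem \<Rightarrow> bool" where
  "triangular n T \<longleftrightarrow> (\<forall>c\<in>set T. \<exists>i\<in>set [0..<n]. has_leader n i (snd c)) \<and>
     (\<forall>c\<in>set T. \<forall>d\<in>set T. \<forall>i\<in>set [0..<n].
        has_leader n i (snd c) \<and> has_leader n i (snd d) \<longrightarrow> c = d)"

lemma triangularI:
  assumes "\<And>c. c \<in> set T \<Longrightarrow> \<exists>i<n. has_leader n i (snd c)"
    and "\<And>c d i. c \<in> set T \<Longrightarrow> d \<in> set T \<Longrightarrow> i < n \<Longrightarrow>
      has_leader n i (snd c) \<Longrightarrow> has_leader n i (snd d) \<Longrightarrow> c = d"
  shows "triangular n T"
  unfolding triangular_def
proof (intro conjI ballI impI)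
  fix c assume "c \<in> set T"
  then obtain i where "i < n" "has_leader n i (snd c)" using assms(1) by blast
  then show "\<exists>i\<in>set [0..<n]. has_leader n i (snd c)" by (intro bexI[of _ i]) simp_all
next
  fix c d i assume "c \<in> set T" "d \<in> set T" "i \<in> set [0..<n]"
    "has_leader n i (snd c) \<and> has_leader n i (snd d)"
  then show "c = d" using assms(2)[of c d i] by simp
qed

lemma triangularD:
  assumes "triangular n T" "c \<in> set T" "d \<in> set T" "i < n" "has_leader n i (snd c)" "has_leader n i (snd d)"
  shows "c = d"
proof -
  have "i \<in> set [0..<n]" using assms(4) by simp
  then show ?thesis using assms unfolding triangular_def by blast
qed

lemma holds_negate: "holds a (sys_of (negate c # T)) \<longleftrightarrow> \<not> holds a (sys_of [c]) \<and> holds a (sys_of T)"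
  unfolding holds_sys_of negate_def by auto

lemma holds_negations:
  "(\<exists>R\<in>set (negations Ss). holds a (sys_of R)) \<longleftrightarrow> \<not> (\<exists>T\<in>set Ss. holds a (sys_of T))"
proof (induction Ss rule: rev_induct)
  case Nil
  then show ?case by (simp add: negations_def)
next
  case (snoc T Ss)
  have "(\<exists>R\<in>set (negations (Ss @ [T])). holds a (sys_of R)) \<longleftrightarrow>
      (\<exists>R\<in>set (negations Ss). \<exists>c\<in>set T. holds a (sys_of (negate c # R)))"
    by (simp add: negations_def)
  also have "\<dots> \<longleftrightarrow> (\<exists>R\<in>set (negations Ss). holds a (sys_of R)) \<and> \<not> holds a (sys_of T)"
    unfolding holds_negate unfolding holds_sys_of by auto
  finally show ?case using snoc by auto
qed

lemma unsat_append: "unsat (S @ T) \<longleftrightarrow> disjoint_systems (sys_of S) (sys_of T)"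
  by (simp add: unsat_def disjoint_systems_def image_Un)

lemma overlaps:
  "(\<forall>R\<in>set (overlaps Ss). unsat R) \<longleftrightarrow> sorted_wrt disjoint_systems (map sys_of Ss)"
proof (induction Ss rule: rev_induct)
  case Nil
  then show ?case by (simp add: overlaps_def)
next
  case (snoc T Ss)
  have "fst (fold (\<lambda>T acc. (T # fst acc, map (\<lambda>T'. T' @ T) (fst acc) @ snd acc)) Ss ([], [])) = rev Ss" for Ss :: "'a tsystem list"
    by (induction Ss rule: rev_induct) auto
  then have "overlaps (Ss @ [T]) = map (\<lambda>T'. T' @ T) (rev Ss) @ overlaps Ss"
    by (simp add: overlaps_def)
  then have "(\<forall>R\<in>set (overlaps (Ss @ [T])). unsat R) \<longleftrightarrow>
      (\<forall>T'\<in>set Ss. unsat (T' @ T)) \<and> (\<forall>R\<in>set (overlaps Ss). unsat R)"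
    by auto
  then show ?case
    unfolding snoc unsat_append by (simp add: sorted_wrt_append conj_commute)
qed

lemma set_overlaps: "R \<in> set (overlaps Ss) \<Longrightarrow> \<exists>T\<in>set Ss. \<exists>T'\<in>set Ss. R = T' @ T"
proof (induction Ss rule: rev_induct)
  case Nil
  then show ?case by (simp add: overlaps_def)
next
  case (snoc T Ss)
  have "fst (fold (\<lambda>T acc. (T # fst acc, map (\<lambda>T'. T' @ T) (fst acc) @ snd acc)) Ss ([], [])) = rev Ss" for Ss :: "'a tsystem list"
    by (induction Ss rule: rev_induct) auto
  then have "overlaps (Ss @ [T]) = map (\<lambda>T'. T' @ T) (rev Ss) @ overlaps Ss"
    by (simp add: overlaps_def)
  then show ?case using snoc by auto
qed

lemma wf_negations:
  assumes "\<forall>T\<in>set Ss. wf_sys n T"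
  shows "\<forall>R\<in>set (negations Ss). wf_sys n R"
  using assms
proof (induction Ss rule: rev_induct)
  case (snoc T Ss)
  then show ?case
    using wf_sysD[of n T] by (auto simp: negations_def negate_def simp del: split_paired_All)
qed (simp add: negations_def)

lemma wf_below_tsys: "wf_sys n T \<Longrightarrow> wf_sys n (below_tsys m i T)"
  by (auto simp: wf_sys_def below_tsys_def)

lemma set_simple_obligations:
  "R \<in> set (simple_obligations n T) \<longleftrightarrow>
     (\<exists>c\<in>set T. \<exists>i<n. \<exists>t\<in>set (snd c). leads n i (expo i t) (snd c) \<and>
        (R = (False, coeff_tpoly n i (expo i t) (snd c)) # below_tsys n i T \<or>
         R = (False, snd c) # (False, deriv_tpoly n i (snd c)) # below_tsys n i T))"
proof -
  have "R \<in> set (leader_obligations n T c i t) \<longleftrightarrow> leads n i (expo i t) (snd c) \<and>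
        (R = (False, coeff_tpoly n i (expo i t) (snd c)) # below_tsys n i T \<or>
         R = (False, snd c) # (False, deriv_tpoly n i (snd c)) # below_tsys n i T)" for c i t
    by (simp add: leader_obligations_def)
  then show ?thesis
    by (simp add: simple_obligations_def atLeast0LessThan Bex_def)
qed

lemma wf_obligations:
  assumes "wf_sys n T\<^sub>0" "\<forall>T\<in>set Ss. wf_sys n T" "R \<in> set (obligations n T\<^sub>0 Ss)"
  shows "wf_sys n R"
proof -
  have "R \<in> set (simple_obligations n T) \<Longrightarrow> wf_sys n R" if "T \<in> set Ss" for T
  proof -
    assume "R \<in> set (simple_obligations n T)"
    moreover have T: "wf_sys n T" using assms(2) that by blast
    ultimately show ?thesis
      unfolding set_simple_obligations
      by (elim bexE exE conjE disjE) (simp_all add: wf_below_tsys[OF T] wf_sysD[OF T])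
  qed
  moreover have "R \<in> set (overlaps Ss) \<Longrightarrow> wf_sys n R"
    using set_overlaps[of R Ss] assms(2) by auto
  moreover have "c \<in> set T\<^sub>0 \<Longrightarrow> T \<in> set Ss \<Longrightarrow> wf_sys n (negate c # T)" for c T
    using assms(2) wf_sysD[OF assms(1)] by (simp add: negate_def)
  moreover have "Q \<in> set (negations Ss) \<Longrightarrow> wf_sys n (T\<^sub>0 @ Q)" for Q
    using assms(1) wf_negations[OF assms(2)] by auto
  ultimately show ?thesis
    using assms(3) unfolding obligations_def by auto
qed

lemma eval_at_upoly: "eval_at a p = poly (spec a (upoly x p)) (a x)"
  using eval_at_poly[of a "upoly x p" "var x"] by (simp only: poly_upoly eval_at_var)

lemma eval_at_deriv_in: "eval_at a (deriv_in x p) = poly (pderiv (spec a (upoly x p))) (a x)"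
  by (simp add: deriv_in_def)

lemma spec_fun_upd: "spec (a(x := z)) (upoly x p) = spec a (upoly x p)"
  using vars_coeff_in by (intro poly_eqI) (fastforce simp: coeff_map_poly intro!: eval_at_cong)

text \<open>The conditions for simplicity speak of tuples over the smaller variables; they carry over to
  arbitrary points, since the polynomials involved contain no other variables.\<close>

lemma simple_systemD:
  fixes S :: "'a::field_char_0 system"
  assumes S: "simple_system n S" and C: "C \<in> S" "ld (lhs C) = Suc i" "i < n"
    and a: "holds a (sys_below S (Suc i))"
  shows "eval_at a (init (lhs C)) \<noteq> 0" "squarefree (spec a (upoly (Suc i) (lhs C)))"
proof -
  let ?V = "{1..<Suc i}"
  define b where "b = restrict a ?V"
  have p: "lhs C \<in> poly_ring n" and alg: "\<And>D. D \<in> S \<Longrightarrow> lhs D \<in> poly_ring n"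
    using S C(1) by (auto simp: simple_system_def alg_system_def)
  have varsV: "vars q \<subseteq> ?V" if "q \<in> poly_ring n" "ld q < Suc i" for q :: "'a mpoly"
  proof
    fix x assume x: "x \<in> vars q"
    then have "x \<le> ld q" by (auto simp: ld_def)
    moreover have "x \<ge> 1" using x that(1) by (auto simp: poly_ring_def)
    ultimately show "x \<in> ?V" using that(2) by simp
  qed
  have eq: "eval_at b q = eval_at a q" if "vars q \<subseteq> ?V" for q
    using that by (intro eval_at_cong) (auto simp: b_def)
  have "holds b (sys_below S (Suc i))"
  proof -
    have "eval_at b q = eval_at a q" if "Eqn q \<in> sys_below S (Suc i) \<or> Ineqn q \<in> sys_below S (Suc i)" for q
      using that alg varsV by (intro eq) (force simp: sys_below_def)
    then show ?thesis using a by (simp add: holds_def)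
  qed
  then have b: "b \<in> Sol {1..<Suc i} (sys_below S (Suc i))"
    by (simp add: Sol_eq b_def)
  have C': "C \<in> sys_at S (Suc i)" "Suc i \<in> {1..n}" using C by (auto simp: sys_at_def)
  have 1: "eval_at b (init (lhs C)) \<noteq> 0" "squarefree (subst_below (Suc i) b (lhs C))"
    using S C' b unfolding simple_system_def by blast+
  have "vars (lhs C) \<subseteq> {1..Suc i}"
  proof
    fix x assume x: "x \<in> vars (lhs C)"
    then have "x \<le> ld (lhs C)" by (auto simp: ld_def)
    moreover have "x \<ge> 1" using x p by (auto simp: poly_ring_def)
    ultimately show "x \<in> {1..Suc i}" using C(2) by simp
  qed
  then have co: "vars (coeff_in (Suc i) k (lhs C)) \<subseteq> ?V" for k
    using vars_coeff_in[of "Suc i" k "lhs C"] by fastforce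
  have "init (lhs C) = coeff_in (Suc i) (rank (lhs C)) (lhs C)" using C(2) by (simp add: init_def)
  then show "eval_at a (init (lhs C)) \<noteq> 0" using 1(1) eq[OF co] by simp
  have "spec b (upoly (Suc i) (lhs C)) = spec a (upoly (Suc i) (lhs C))"
    using eq[OF co] by (intro poly_eqI) (simp add: coeff_map_poly)
  then show "squarefree (spec a (upoly (Suc i) (lhs C)))" using 1(2) by (simp add: subst_below_eq)
qed

lemma simple_check_sound:
  fixes T :: "'a::field_char_0 tsystem"
  assumes wf: "wf_sys n T" and tri: "triangular n T"
    and obl: "\<forall>R\<in>set (simple_obligations n T). unsat R"
  shows "simple_system n (sys_of T)"
proof -
  have wfc: "wf_poly n (snd c)" if "c \<in> set T" for c using wf that by (auto simp: wf_sys_def)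
  have leader: "\<exists>i<n. has_leader n i (snd c)" if "c \<in> set T" for c
  proof -
    have "\<exists>i\<in>set [0..<n]. has_leader n i (snd c)" using tri that unfolding triangular_def by blast
    then show ?thesis by auto
  qed
  have ld: "ld (poly_of (snd c)) = Suc i" if "c \<in> set T" "i < n" "has_leader n i (snd c)" for c i
    using that leads_sound(1)[OF _ wfc] unfolding has_leader_def by blast
  have "alg_system n (sys_of T)" by (rule alg_system_sys_of[OF wf])
  moreover have "card (sys_at (sys_of T) i) \<le> 1" for i
  proof -
    have fin: "finite (sys_at (sys_of T) i)" by (simp add: sys_at_def)
    have "C = D" if CD: "C \<in> sys_at (sys_of T) i" "D \<in> sys_at (sys_of T) i" for C D
    proof -
      obtain c d where c: "c \<in> set T" "C = constr_of c" "ld (poly_of (snd c)) = i"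
        and d: "d \<in> set T" "D = constr_of d" "ld (poly_of (snd d)) = i"
        using CD by (auto simp: sys_at_def)
      obtain j k where j: "j < n" "has_leader n j (snd c)" and k: "k < n" "has_leader n k (snd d)"
        using leader c(1) d(1) by metis
      then have "j = k" using ld[OF c(1) j] ld[OF d(1) k] c(3) d(3) by simp
      then have "c = d" using triangularD[OF tri c(1) d(1) j(1)] j k by simp
      then show ?thesis using c d by simp
    qed
    then show ?thesis using fin by (simp add: card_le_Suc0_iff_eq)
  qed
  moreover have "Eqn (single 0 k) \<notin> sys_of T \<and> Ineqn (single 0 k) \<notin> sys_of T" for k
  proof -
    have "lhs C \<noteq> single 0 k" if "C \<in> sys_of T" for C
      using that leader ld by (metis imageE ld_const lhs_constr_of nat.distinct(1))
    then show ?thesis by (metis constr.sel)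
  qed
  moreover have "eval_at a (init (lhs C)) \<noteq> 0 \<and> squarefree (subst_below i a (lhs C))"
    if C: "C \<in> sys_at (sys_of T) i" and a: "a \<in> Sol {1..<i} (sys_below (sys_of T) i)" for i C a
  proof -
    obtain c where c: "c \<in> set T" "C = constr_of c" "ld (poly_of (snd c)) = i"
      using C by (auto simp: sys_at_def)
    obtain j where j: "j < n" "has_leader n j (snd c)" using leader c(1) by blast
    then have i: "i = Suc j" using ld c by auto
    obtain t where t: "t \<in> set (snd c)" "leads n j (expo j t) (snd c)"
      using j(2) by (auto simp: has_leader_def)
    have init: "init (poly_of (snd c)) = poly_of (coeff_tpoly n j (expo j t) (snd c))"
      by (rule leads_sound(2)[OF t(2) wfc[OF c(1)] j(1)])
    have unsat: "unsat ((False, coeff_tpoly n j (expo j t) (snd c)) # below_tsys n j T)"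
      "unsat ((False, snd c) # (False, deriv_tpoly n j (snd c)) # below_tsys n j T)"
      using obl set_simple_obligations[of _ n T] c(1) j(1) t by metis+
    have below: "holds b (sys_of (below_tsys n j T))" if "holds b (sys_below (sys_of T) i)" for b
      using holds_subset[OF that] below_tsys_subset[OF wf] i by blast
    have ha: "holds a (sys_below (sys_of T) i)" using a by (simp add: Sol_eq)
    have nz: "eval_at a (init (poly_of (snd c))) \<noteq> 0"
      using unsat(1) below[OF ha] unfolding init unsat_Cons by auto
    have "squarefree (spec a (upoly i (poly_of (snd c))))"
      unfolding squarefree_iff_no_common_root
    proof
      assume "\<exists>z. poly (spec a (upoly i (poly_of (snd c)))) z = 0 \<and>
        poly (pderiv (spec a (upoly i (poly_of (snd c))))) z = 0"
      then obtain z where z: "poly (spec a (upoly i (poly_of (snd c)))) z = 0"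
        "poly (pderiv (spec a (upoly i (poly_of (snd c))))) z = 0" by blast
      \<comment> \<open>The common root extends \<open>a\<close> to a solution of the second obligation of \<open>c\<close>.\<close>
      define b where "b = a(i := z)"
      have "b i = z" by (simp add: b_def)
      have sp: "spec b (upoly i p) = spec a (upoly i p)" for p
        unfolding b_def by (rule spec_fun_upd)
      have "eval_at b q = eval_at a q" if "q \<in> poly_ring n" "ld q < i" for q :: "'a mpoly"
      proof (rule eval_at_cong)
        fix x assume "x \<in> vars q"
        then have "x \<le> ld q" by (auto simp: ld_def)
        then show "b x = a x" using that(2) by (auto simp: b_def)
      qed
      moreover have "lhs D \<in> poly_ring n" if "D \<in> sys_of T" for D
        using that alg_system_sys_of[OF wf] by (auto simp: alg_system_def)
      ultimately have "holds b (sys_below (sys_of T) i)"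
        using ha unfolding holds_def sys_below_def by (metis (no_types, lifting) constr.sel mem_Collect_eq)
      moreover have "eval_at b (poly_of (snd c)) = 0" "eval_at b (deriv_in i (poly_of (snd c))) = 0"
        using z unfolding eval_at_upoly[of b _ i] eval_at_deriv_in sp \<open>b i = z\<close> by simp_all
      moreover have "poly_of (deriv_tpoly n j (snd c)) = deriv_in i (poly_of (snd c))"
        unfolding i by (rule poly_of_deriv_tpoly[OF wfc[OF c(1)] j(1)])
      ultimately show False
        using unsat(2) below[of b] unfolding unsat_def holds_Cons by auto
    qed
    then show ?thesis using nz c(2) by (simp add: subst_below_eq)
  qed
  ultimately show ?thesis unfolding simple_system_def by blast
qed

theorem obligations_sound:
  fixes T\<^sub>0 :: "'a::field_char_0 tsystem"
  assumes "\<forall>T\<in>set Ss. wf_sys n T \<and> triangular n T" and obl: "\<forall>R\<in>set (obligations n T\<^sub>0 Ss). unsat R"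
  shows "decomposition n (sys_of T\<^sub>0) (map sys_of Ss)"
proof -
  have "simple_system n (sys_of T)" if "T \<in> set Ss" for T
    using that assms by (intro simple_check_sound) (auto simp: obligations_def)
  moreover have "sorted_wrt disjoint_systems (map sys_of Ss)"
    using obl overlaps[of Ss] by (auto simp: obligations_def)
  moreover have "holds a (sys_of T\<^sub>0) \<longleftrightarrow> (\<exists>T\<in>set Ss. holds a (sys_of T))" for a
  proof
    assume T0: "holds a (sys_of T\<^sub>0)"
    have "\<not> holds a (sys_of R)" if "R \<in> set (negations Ss)" for R
    proof -
      have "unsat (T\<^sub>0 @ R)" using that obl by (auto simp: obligations_def)
      then show ?thesis using T0 by (auto simp: unsat_append disjoint_systems_def)
    qed
    then show "\<exists>T\<in>set Ss. holds a (sys_of T)" using holds_negations by blast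
  next
    assume "\<exists>T\<in>set Ss. holds a (sys_of T)"
    then obtain T where T: "T \<in> set Ss" "holds a (sys_of T)" by blast
    have "holds a (sys_of [c])" if "c \<in> set T\<^sub>0" for c
    proof -
      have "unsat (negate c # T)" using that T(1) obl by (auto simp: obligations_def)
      then show ?thesis using T(2) holds_negate unfolding unsat_def by blast
    qed
    then show "holds a (sys_of T\<^sub>0)" unfolding holds_sys_of by simp
  qed
  ultimately show ?thesis by (auto simp: decomposition_def)
qed

text \<open>The members of a decomposition are listed with \<open>terms_of\<close>, so that leaders and smaller
  constraints can be read off from the lists.\<close>

theorem obligations_complete:
  fixes T\<^sub>0 :: "'a::field_char_0 tsystem"
  assumes wf0: "wf_sys n T\<^sub>0"
  shows "\<exists>Ss. (\<forall>T\<in>set Ss. wf_sys n T \<and> triangular n T) \<and> (\<forall>R\<in>set (obligations n T\<^sub>0 Ss). unsat R)"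
proof -
  have "alg_system n (sys_of T\<^sub>0)" by (rule alg_system_sys_of[OF wf0])
  then obtain Ss' where dec: "decomposition n (sys_of T\<^sub>0) Ss'" using decomposition_exists by blast
  define code where "code C = (case C of Eqn p \<Rightarrow> (False, terms_of n p) | Ineqn p \<Rightarrow> (True, terms_of n p))"
    for C :: "'a mpoly constr"
  have code: "constr_of (code C) = C" "snd (code C) = terms_of n (lhs C)" if "lhs C \<in> poly_ring n" for C
    using that by (cases C; simp add: code_def constr_of_def terms_of)+
  have "\<exists>T. sys_of T = S \<and> set T = code ` S" if "S \<in> set Ss'" for S
  proof -
    have alg: "alg_system n S" using dec that by (simp add: decomposition_def simple_system_def)
    then obtain xs where "set xs = S" using finite_list unfolding alg_system_def by metis
    then have "set (map code xs) = code ` S" by simp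
    moreover have "constr_of ` code ` S = S"
      using alg code(1) by (force simp: alg_system_def image_image)
    ultimately show ?thesis by metis
  qed
  then obtain g where g: "\<And>S. S \<in> set Ss' \<Longrightarrow> sys_of (g S) = S \<and> set (g S) = code ` S" by metis
  define Ss where "Ss = map g Ss'"
  have "map (\<lambda>S. sys_of (g S)) Ss' = Ss'" by (rule map_idI) (use g in blast)
  then have sys: "map sys_of Ss = Ss'" unfolding Ss_def by (simp add: comp_def)
  have main: "wf_sys n T \<and> triangular n T \<and> (\<forall>R\<in>set (simple_obligations n T). unsat R)" if T: "T \<in> set Ss" for T
  proof -
    obtain S where S: "S \<in> set Ss'" "T = g S" using T by (auto simp: Ss_def)
    have sT: "sys_of T = S" "set T = code ` S" using g S by blast+
    have simple: "simple_system n S" using dec S(1) by (simp add: decomposition_def)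
    have ring: "lhs C \<in> poly_ring n" if "C \<in> S" for C
      using simple that by (auto simp: simple_system_def alg_system_def)
    have mem: "\<exists>C\<in>S. c = code C \<and> snd c = terms_of n (lhs C) \<and> constr_of c = C \<and> poly_of (snd c) = lhs C"
      if "c \<in> set T" for c
      using that code ring terms_of(2) unfolding sT(2) by (metis imageE)
    have wf: "wf_sys n T"
      unfolding wf_sys_def using mem ring terms_of(1) by metis
    have ld: "ld (poly_of (snd c)) = Suc i" if "c \<in> set T" "i < n" "has_leader n i (snd c)" for c i
      using that leads_sound(1)[OF _ wf_sysD[OF wf]] unfolding has_leader_def by blast
    have "\<exists>i<n. has_leader n i (snd c)" if "c \<in> set T" for c
    proof -
      obtain C where C: "C \<in> S" "snd c = terms_of n (lhs C)" using mem[OF \<open>c \<in> set T\<close>] by blast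
      have "vars (lhs C) \<noteq> {}"
      proof
        assume "vars (lhs C) = {}"
        then obtain k where "lhs C = single 0 k" unfolding vars_empty_iff by blast
        then show False using simple C(1) unfolding simple_system_def by (cases C) auto
      qed
      then show ?thesis using has_leader_terms_of[OF ring[OF C(1)]] C(2) by simp
    qed
    moreover have "c = d" if "c \<in> set T" "d \<in> set T" "i < n" "has_leader n i (snd c)" "has_leader n i (snd d)" for c d i
    proof -
      obtain C D where C: "C \<in> S" "c = code C" "poly_of (snd c) = lhs C"
        and D: "D \<in> S" "d = code D" "poly_of (snd d) = lhs D"
        using mem \<open>c \<in> set T\<close> \<open>d \<in> set T\<close> by metis
      have "ld (lhs C) = Suc i" "ld (lhs D) = Suc i"
        using ld[OF that(1,3,4)] ld[OF that(2,3,5)] C(3) D(3) by simp_all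
      then have "C \<in> sys_at S (Suc i)" "D \<in> sys_at S (Suc i)"
        using C(1) D(1) by (simp_all add: sys_at_def)
      moreover have "card (sys_at S (Suc i)) \<le> 1"
        using simple \<open>i < n\<close> by (auto simp: simple_system_def)
      moreover have "finite (sys_at S (Suc i))"
        using simple by (auto simp: simple_system_def alg_system_def sys_at_def)
      ultimately have "C = D" by (simp add: card_le_Suc0_iff_eq)
      then show ?thesis using C D by simp
    qed
    ultimately have "triangular n T" by (rule triangularI)
    moreover have "unsat R" if R: "R \<in> set (simple_obligations n T)" for R
    proof -
      obtain c i t where c: "c \<in> set T" and i: "i < n" and t: "t \<in> set (snd c)" "leads n i (expo i t) (snd c)"
        and R: "R = (False, coeff_tpoly n i (expo i t) (snd c)) # below_tsys n i T \<or>
         R = (False, snd c) # (False, deriv_tpoly n i (snd c)) # below_tsys n i T"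
        using R unfolding set_simple_obligations by blast
      obtain C where C: "C \<in> S" "poly_of (snd c) = lhs C" using mem[OF c] by blast
      have wfc: "wf_poly n (snd c)" using wf c by (auto simp: wf_sys_def)
      have ldC: "ld (lhs C) = Suc i" using ld[OF c i] t C(2) by (auto simp: has_leader_def)
      have below: "holds a (sys_below S (Suc i))" if "holds a (sys_of (below_tsys n i T))" for a
        using holds_subset[OF that] below_tsys_terms_of[of T n i] mem ring sT(1) by metis
      have simp: "eval_at a (init (lhs C)) \<noteq> 0" "squarefree (spec a (upoly (Suc i) (lhs C)))"
        if "holds a (sys_of (below_tsys n i T))" for a
        using simple_systemD[OF simple C(1) ldC i below[OF that]] by blast+
      have init: "init (lhs C) = poly_of (coeff_tpoly n i (expo i t) (snd c))"
        using leads_sound(2)[OF t(2) wfc i] C(2) by simp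
      have deriv: "poly_of (deriv_tpoly n i (snd c)) = deriv_in (Suc i) (lhs C)"
        using poly_of_deriv_tpoly[OF wfc i] C(2) by simp
      have "\<not> holds a (sys_of R)" for a
      proof
        assume a: "holds a (sys_of R)"
        then have b: "holds a (sys_of (below_tsys n i T))"
          using R unfolding holds_sys_of by auto
        show False
          using R
        proof
          assume "R = (False, coeff_tpoly n i (expo i t) (snd c)) # below_tsys n i T"
          then have "eval_at a (init (lhs C)) = 0" using a by (simp add: holds_Cons init del: list.set)
          then show False using simp(1)[OF b] by simp
        next
          assume "R = (False, snd c) # (False, deriv_tpoly n i (snd c)) # below_tsys n i T"
          then have "eval_at a (lhs C) = 0" "eval_at a (deriv_in (Suc i) (lhs C)) = 0"
            using a by (simp_all add: holds_Cons C(2) deriv del: list.set)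
          then show False
            using simp(2)[OF b] unfolding squarefree_iff_no_common_root
              eval_at_deriv_in eval_at_upoly[of a "lhs C" "Suc i"] by blast
        qed
      qed
      then show ?thesis by (simp add: unsat_def)
    qed
    ultimately show ?thesis using wf by blast
  qed
  have cover: "holds a (sys_of T\<^sub>0) \<longleftrightarrow> (\<exists>T\<in>set Ss. holds a (sys_of T))" for a
    using dec unfolding decomposition_def sys[symmetric] by simp
  have "unsat R" if "R \<in> set (overlaps Ss)" for R
    using overlaps[of Ss] dec that unfolding decomposition_def sys by blast
  moreover have "unsat (negate c # T)" if "c \<in> set T\<^sub>0" "T \<in> set Ss" for c T
  proof -
    have "holds a (sys_of T) \<Longrightarrow> holds a (sys_of [c])" for a
      using cover[of a] that unfolding holds_sys_of by auto
    then show ?thesis unfolding unsat_def holds_negate by blast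
  qed
  moreover have "unsat (T\<^sub>0 @ R)" if "R \<in> set (negations Ss)" for R
    unfolding unsat_append disjoint_systems_def using cover holds_negations[of Ss] that by blast
  ultimately have "\<forall>R\<in>set (obligations n T\<^sub>0 Ss). unsat R"
    using main unfolding obligations_def by auto
  then show ?thesis using main by blast
qed

section \<open>Computability of the verification\<close>

text \<open>With these rules the computability of a function is proved by a syntax-directed resolution
  along its definition. Bound variables appear as projections from the environment. The rule for
  constants is tried last, as are the projections.\<close>

named_theorems computable_intros

lemmas [computable_intros] = computable_if computable_nat_eq computable_le computable_Suc computable_add
  computable_diff computable_not computable_conj computable_imp computable_Cons computable_append
  computable_concat computable_map computable_filter computable_fold computable_list_all
  computable_list_ex computable_nth_default computable_rec_nat computable_length

context
  fixes \<iota> :: "'a::field_char_0 \<Rightarrow> nat"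
  assumes field: "computable_field \<iota>"
begin

lemma inj_iota: "inj \<iota>" using field by (simp add: computable_field_def)

lemma computable_field_add [computable_intros]:
  "computable e \<iota> f \<Longrightarrow> computable e \<iota> g \<Longrightarrow> computable e \<iota> (\<lambda>x. f x + g x)"
  using field computable_binary[of _ \<iota> \<iota> \<iota> "(+)"] unfolding computable_field_def by blast

lemma computable_field_mult [computable_intros]:
  "computable e \<iota> f \<Longrightarrow> computable e \<iota> g \<Longrightarrow> computable e \<iota> (\<lambda>x. f x * g x)"
  using field computable_binary[of _ \<iota> \<iota> \<iota> "(*)"] unfolding computable_field_def by blast

text \<open>A number that codes no field element is taken for the code of \<open>0\<close>; the decidability of the
  set of codes is used here.\<close>

lemma searchable_field: "searchable \<iota>"
proof -
  obtain D where D: "\<And>c. rec_eval D [c] = Some (if c \<in> range \<iota> then 1 else 0)"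
    using field unfolding computable_field_def by blast
  have "computable nat_code \<iota> (\<lambda>c. if c \<in> range \<iota> then inv_into UNIV \<iota> c else 0)"
  proof (rule computableI)
    fix c
    show "rec_eval (CompR (PrimR (const_prog (\<iota> 0)) (ProjR 2)) [D, ProjR 0]) [nat_code c] =
        Some (\<iota> (if c \<in> range \<iota> then inv_into UNIV \<iota> c else 0))"
      by (auto simp: D nat_code_def f_inv_into_f)
  qed
  moreover have "(if \<iota> x \<in> range \<iota> then inv_into UNIV \<iota> (\<iota> x) else 0) = x" for x
    using inj_iota by simp
  ultimately show ?thesis unfolding searchable_def by blast
qed

abbreviation "exps_code \<equiv> list_code nat_code"
abbreviation "term_code \<equiv> pair_code \<iota> exps_code"
abbreviation "tpoly_code \<equiv> list_code term_code"
abbreviation "constr_code \<equiv> pair_code bool_code tpoly_code"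
abbreviation "tsystem_code \<equiv> list_code constr_code"
abbreviation "certificate_code \<equiv>
  pair_code (list_code tpoly_code) (list_code (pair_code tpoly_code tpoly_code))"

lemmas computable_exps_eq [computable_intros] = computable_eq[OF inj_list_code[OF inj_nat_code]]

lemma computable_constr_eq [computable_intros]:
  "computable e constr_code f \<Longrightarrow> computable e constr_code g \<Longrightarrow> computable e bool_code (\<lambda>x. f x = g x)"
  by (rule computable_eq) (simp_all add: inj_iota)

lemma computable_expo:
  "computable (pair_code nat_code term_code) nat_code (\<lambda>z. expo (fst z) (snd z))"
  unfolding expo_def by (rule computable_intros computable_basic)+
lemmas [computable_intros] = computable_app2[OF computable_expo]

lemma computable_coeff_sum:
  "computable (pair_code tpoly_code exps_code) \<iota> (\<lambda>z. coeff_sum (fst z) (snd z))"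
  unfolding coeff_sum_def by (rule computable_intros computable_basic)+
lemmas [computable_intros] = computable_app2[OF computable_coeff_sum]

lemma computable_same_poly:
  "computable (pair_code tpoly_code tpoly_code) bool_code (\<lambda>z. same_poly (fst z) (snd z))"
  unfolding same_poly_def
  by (rule computable_eq[OF inj_iota] computable_intros computable_basic)+
lemmas [computable_intros] = computable_app2[OF computable_same_poly]

lemma computable_mult_term:
  "computable (pair_code term_code term_code) term_code (\<lambda>z. mult_term n (fst z) (snd z))"
  unfolding mult_term_def by (rule computable_intros computable_basic)+
lemmas [computable_intros] = computable_app2[OF computable_mult_term]

lemma computable_mult_tpoly:
  "computable (pair_code tpoly_code tpoly_code) tpoly_code (\<lambda>z. mult_tpoly n (fst z) (snd z))"
  unfolding mult_tpoly_def by (rule computable_intros computable_basic)+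
lemmas [computable_intros] = computable_app2[OF computable_mult_tpoly]

lemma computable_prod_tpolys:
  "computable (list_code tpoly_code) tpoly_code (\<lambda>ps. prod_tpolys n ps)"
  unfolding prod_tpolys_def by (rule computable_intros computable_basic)+
lemmas [computable_intros] = computable_comp[OF computable_prod_tpolys]

lemma computable_scale_nat:
  "computable (pair_code nat_code \<iota>) \<iota> (\<lambda>z. scale_nat (fst z) (snd z))"
  unfolding scale_nat_def by (rule computable_intros computable_basic)+
lemmas [computable_intros] = computable_app2[OF computable_scale_nat]

lemma computable_deriv_tpoly:
  "computable (pair_code nat_code tpoly_code) tpoly_code (\<lambda>z. deriv_tpoly n (fst z) (snd z))"
  unfolding deriv_tpoly_def by (rule computable_intros computable_basic)+
lemmas [computable_intros] = computable_app2[OF computable_deriv_tpoly]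

lemma computable_coeff_tpoly:
  "computable (pair_code nat_code (pair_code nat_code tpoly_code)) tpoly_code
     (\<lambda>z. coeff_tpoly n (fst z) (fst (snd z)) (snd (snd z)))"
  unfolding coeff_tpoly_def by (rule computable_intros computable_basic)+
lemmas [computable_intros] = computable_app3[OF computable_coeff_tpoly]

lemma computable_leads:
  "computable (pair_code nat_code (pair_code nat_code tpoly_code)) bool_code
     (\<lambda>z. leads n (fst z) (fst (snd z)) (snd (snd z)))"
  unfolding leads_def by (rule computable_intros computable_basic)+
lemmas [computable_intros] = computable_app3[OF computable_leads]

lemma computable_has_leader:
  "computable (pair_code nat_code tpoly_code) bool_code (\<lambda>z. has_leader n (fst z) (snd z))"
  unfolding has_leader_def by (rule computable_intros computable_basic)+
lemmas [computable_intros] = computable_app2[OF computable_has_leader]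

lemma computable_below_tsys:
  "computable (pair_code nat_code tsystem_code) tsystem_code (\<lambda>z. below_tsys n (fst z) (snd z))"
  unfolding below_tsys_def by (rule computable_intros computable_basic)+
lemmas [computable_intros] = computable_app2[OF computable_below_tsys]

lemma computable_wf_poly: "computable tpoly_code bool_code (\<lambda>p. wf_poly n p)"
  unfolding wf_poly_def by (rule computable_intros computable_basic)+
lemmas [computable_intros] = computable_comp[OF computable_wf_poly]

lemma computable_wf_sys: "computable tsystem_code bool_code (\<lambda>T. wf_sys n T)"
  unfolding wf_sys_def by (rule computable_intros computable_basic)+
lemmas [computable_intros] = computable_comp[OF computable_wf_sys]

lemma computable_triangular: "computable tsystem_code bool_code (\<lambda>T. triangular n T)"
  unfolding triangular_def by (rule computable_intros computable_basic)+
lemmas [computable_intros] = computable_comp[OF computable_triangular]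

lemma computable_refutes:
  "computable (pair_code tsystem_code certificate_code) bool_code (\<lambda>z. refutes n (fst z) (snd z))"
  unfolding refutes_def by (rule computable_intros computable_basic)+
lemmas [computable_intros] = computable_app2[OF computable_refutes]

lemma computable_simple_obligations:
  "computable tsystem_code (list_code tsystem_code) (\<lambda>T. simple_obligations n T)"
  unfolding simple_obligations_def leader_obligations_def
  by (rule computable_intros computable_basic)+
lemmas [computable_intros] = computable_comp[OF computable_simple_obligations]

lemma computable_negations:
  "computable (list_code tsystem_code) (list_code tsystem_code) (\<lambda>Ss. negations Ss)"
  unfolding negations_def negate_def by (rule computable_intros computable_basic)+
lemmas [computable_intros] = computable_comp[OF computable_negations]

lemma computable_overlaps:
  "computable (list_code tsystem_code) (list_code tsystem_code) (\<lambda>Ss. overlaps Ss)"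
  unfolding overlaps_def by (rule computable_intros computable_basic)+
lemmas [computable_intros] = computable_comp[OF computable_overlaps]

lemma computable_obligations:
  "computable (pair_code tsystem_code (list_code tsystem_code)) (list_code tsystem_code)
     (\<lambda>z. obligations n (fst z) (snd z))"
  unfolding obligations_def negate_def by (rule computable_intros computable_basic)+
lemmas [computable_intros] = computable_app2[OF computable_obligations]

text \<open>The certificates form one unordered pool, so that a candidate does not have to record which of
  them belongs to which obligation.\<close>

definition verified :: "nat \<Rightarrow> 'a tsystem \<Rightarrow> 'a tsystem list \<times> 'a certificate list \<Rightarrow> bool" where
  "verified n T\<^sub>0 z \<longleftrightarrow> (\<forall>T\<in>set (fst z). wf_sys n T \<and> triangular n T) \<and>
     (\<forall>R\<in>set (obligations n T\<^sub>0 (fst z)). \<exists>w\<in>set (snd z). refutes n R w)"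

lemma computable_verified:
  "computable (pair_code tsystem_code (pair_code (list_code tsystem_code) (list_code certificate_code)))
     bool_code (\<lambda>z. verified n (fst z) (snd z))"
  unfolding verified_def by (rule computable_intros computable_basic)+

lemma verified_sound:
  assumes "wf_sys n T\<^sub>0" "verified n T\<^sub>0 (Ss, W)"
  shows "thomas_decomposition n (sys_of T\<^sub>0) (map sys_of Ss)"
proof -
  have wf: "\<forall>T\<in>set Ss. wf_sys n T \<and> triangular n T"
    and ref: "\<forall>R\<in>set (obligations n T\<^sub>0 Ss). \<exists>w\<in>set W. refutes n R w"
    using assms(2) by (simp_all add: verified_def)
  have "unsat R" if "R \<in> set (obligations n T\<^sub>0 Ss)" for R
    using refutes_sound[OF wf_obligations[OF assms(1) _ that]] wf ref that by blast
  then show ?thesis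
    using obligations_sound[OF wf] decomposition_imp_thomas by blast
qed

text \<open>This is where termination of the search comes from: a decomposition exists, and by the
  Nullstellensatz each of its obligations has a certificate.\<close>

lemma verified_complete:
  assumes "wf_sys n T\<^sub>0"
  shows "\<exists>z. verified n T\<^sub>0 z"
proof -
  obtain Ss where Ss: "\<forall>T\<in>set Ss. wf_sys n T \<and> triangular n T"
    "\<forall>R\<in>set (obligations n T\<^sub>0 Ss). unsat R"
    using obligations_complete[OF assms] by blast
  have "\<exists>w. refutes n R w" if "R \<in> set (obligations n T\<^sub>0 Ss)" for R
    using refutes_complete[OF wf_obligations[OF assms _ that]] Ss that by blast
  then obtain f where "\<And>R. R \<in> set (obligations n T\<^sub>0 Ss) \<Longrightarrow> refutes n R (f R)" by metis
  then have "verified n T\<^sub>0 (Ss, map f (obligations n T\<^sub>0 Ss))"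
    using Ss(1) by (auto simp: verified_def)
  then show ?thesis ..
qed

section \<open>Codes of systems\<close>

lemma tpoly_code_eq:
  "tpoly_code ts = list_encode (map (\<lambda>(a, es). prod_encode (\<iota> a, list_encode es)) ts)"
  unfolding list_code_def pair_code_def nat_code_def[abs_def] case_prod_beta by simp

lemma codes_poly_iff: "codes_poly \<iota> n c p \<longleftrightarrow> (\<exists>ts. wf_poly n ts \<and> p = poly_of ts \<and> c = tpoly_code ts)"
  unfolding codes_poly_def wf_poly_def poly_of_def exponents_def tpoly_code_eq case_prod_beta ..

lemma codes_constr_iff:
  "codes_constr \<iota> n c C \<longleftrightarrow> (\<exists>d. wf_poly n (snd d) \<and> C = constr_of d \<and> c = constr_code d)"
  by (cases C) (auto simp: codes_poly_iff constr_of_def pair_code_def bool_code_def)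

lemma codes_system_iff:
  "codes_system \<iota> n c S \<longleftrightarrow> (\<exists>T. wf_sys n T \<and> S = sys_of T \<and> c = tsystem_code T)"
proof
  assume "codes_system \<iota> n c S"
  then obtain cs Cs where *: "list_all2 (codes_constr \<iota> n) cs Cs" "c = list_encode cs" "S = set Cs"
    unfolding codes_system_def by blast
  have "\<exists>T. wf_sys n T \<and> Cs = map constr_of T \<and> cs = map constr_code T"
    using *(1)
  proof induction
    case (Cons c cs C Cs)
    then obtain T d where "wf_sys n T" "Cs = map constr_of T" "cs = map constr_code T"
      "wf_poly n (snd d)" "C = constr_of d" "c = constr_code d"
      unfolding codes_constr_iff by blast
    then show ?case by (intro exI[of _ "d # T"]) simp
  qed simp
  then show "\<exists>T. wf_sys n T \<and> S = sys_of T \<and> c = tsystem_code T"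
    using * by (auto simp: list_code_def)
next
  assume "\<exists>T. wf_sys n T \<and> S = sys_of T \<and> c = tsystem_code T"
  then obtain T where T: "wf_sys n T" "S = sys_of T" "c = tsystem_code T" by blast
  have "list_all2 (codes_constr \<iota> n) (map constr_code T) (map constr_of T)"
    unfolding list.rel_map list.rel_refl_strong codes_constr_iff using wf_sysD[OF T(1)]
    by (intro list.rel_refl_strong) blast
  then show "codes_system \<iota> n c S"
    unfolding codes_system_def T(2,3) list_code_def[of constr_code] list.set_map[symmetric] by blast
qed

lemma codes_family_tsystem_code:
  assumes "\<forall>T\<in>set Ss. wf_sys n T"
  shows "codes_family \<iota> n (list_code tsystem_code Ss) (map sys_of Ss)"
proof -
  have "list_all2 (codes_system \<iota> n) (map tsystem_code Ss) (map sys_of Ss)"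
    unfolding list.rel_map codes_system_iff using assms by (intro list.rel_refl_strong) blast
  then show ?thesis unfolding codes_family_def by (auto simp: list_code_def[of tsystem_code])
qed

end

section \<open>The algorithm\<close>

theorem mainTheorem1:
  fixes \<iota> :: "'a::field_char_0 \<Rightarrow> nat" and n :: nat
  assumes "computable_field \<iota>"
  shows "\<exists>P. \<forall>(S' :: 'a system) c. alg_system n S' \<and> codes_system \<iota> n c S' \<longrightarrow>
           (\<exists>d Ss. rec_eval P [c] = Some d \<and> codes_family \<iota> n d Ss \<and>
                   thomas_decomposition n S' Ss)"
proof -
  let ?ts = "list_code (pair_code bool_code (list_code (pair_code \<iota> (list_code nat_code))))"
  let ?tp = "list_code (pair_code \<iota> (list_code nat_code))"
  let ?z = "pair_code (list_code ?ts) (list_code (pair_code (list_code ?tp) (list_code (pair_code ?tp ?tp))))"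
  have "searchable ?z"
    by (intro searchable_pair searchable_list searchable_bool searchable_nat searchable_field[OF assms])
  from computable_search[OF computable_verified[OF assms] this]
  obtain P where P: "\<And>T. (\<exists>z. verified n T z) \<Longrightarrow> \<exists>z. verified n T z \<and> rec_eval P [?ts T] = Some (?z z)"
    by blast
  show ?thesis
  proof (intro exI[of _ "CompR fst_prog [P]"] allI impI)
    fix S' :: "'a system" and c assume "alg_system n S' \<and> codes_system \<iota> n c S'"
    then obtain T where T: "wf_sys n T" "S' = sys_of T" "c = ?ts T"
      using codes_system_iff[OF assms] by blast
    obtain Ss W where z: "verified n T (Ss, W)" "rec_eval P [?ts T] = Some (?z (Ss, W))"
      using P[OF verified_complete[OF assms T(1)]] by auto
    have "rec_eval (CompR fst_prog [P]) [c] = Some (list_code ?ts Ss)"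
      using z(2) by (simp add: T(3) pair_code_def)
    moreover have "codes_family \<iota> n (list_code ?ts Ss) (map sys_of Ss)"
      using z(1) by (intro codes_family_tsystem_code[OF assms]) (simp add: verified_def[OF assms])
    moreover have "thomas_decomposition n S' (map sys_of Ss)"
      using verified_sound[OF assms T(1) z(1)] T(2) by simp
    ultimately show "\<exists>d Ss. rec_eval (CompR fst_prog [P]) [c] = Some d \<and> codes_family \<iota> n d Ss \<and>
                   thomas_decomposition n S' Ss"
      by blast
  qed
qed

end
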